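(* Let $M$ be a compact, connected Riemannian manifold without boundary, let $r\ge 2$ be an integer, and let $(X_t)_t$ be the flow generated by $X\in\mathfrak{X}^r(M)$. If $\mu$ is a non-atomic, $(X_t)_t$-invariant, ergodic and hyperbolic probability measure, then $\mathcal{Z}^1(X|_{\operatorname{supp}\mu})$ is trivial, that is: for every $Y\in\mathcal{Z}^1(X)$ the flow generated by $Y$ preserves $\operatorname{supp}\mu$ and there exists $c\in\mathbb{R}$ such that $Y=cX$ on $\operatorname{supp}\mu$.
   Context: $\mathfrak{X}^r(M)$ is the space of $C^r$ vector fields on $M$, and $\mathcal{Z}^1(X)=\{Y\in\mathfrak{X}^1(M):[X,Y]=0\}$ (equivalently, the flows of $X$ and $Y$ commute). By Oseledets' theorem, for $\mu$-almost every $x$ there is a $DX_t$-invariant splitting $T_xM=E^0_x\oplus E^1_x\oplus\dots\oplus E^{k(x)}_x$, with $E^0_x$ the one-dimensional space generated by $X(x)$, and Lyapunov exponents $\lambda_i(X,x)=\lim_{t\to\pm\infty}\frac1t\log\|DX_t(x)v_i\|$ for $v_i\in E^i_x\setminus\{0\}$, $1\le i\le k(x)$; if $\mu$ is ergodic these are $\mu$-a.e. constant, denoted $\lambda_i(X,\mu)$, $1\le i\le k$. An ergodic $\mu$ is hyperbolic if $\lambda_i(X,\mu)\ne 0$ for every $1\le i\le k$ (i.e. the only zero exponent is that of the flow direction $E^0$). *)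

theory Defs
  imports "HOL-Probability.Probability" "HOL-Library.Function_Algebras"
begin

(* Pointwise real vector space structure on functions; HOL-Library.Function_Algebras
   already provides the additive group structure. *)
instantiation "fun" :: (type, real_vector) real_vector
begin

definition scaleR_fun :: "real \<Rightarrow> ('a \<Rightarrow> 'b) \<Rightarrow> 'a \<Rightarrow> 'b" where
  "scaleR_fun a f = (\<lambda>x. a *\<^sub>R f x)"

instance
  by standard (auto simp: scaleR_fun_def fun_eq_iff scaleR_add_right scaleR_add_left)

end


(* C^k maps on an open set S of a normed space. For a finite-dimensional domain,
   continuity of all directional derivatives is continuity of the derivative. *)
primrec Ck_on :: "nat \<Rightarrow> 'e::real_normed_vector set \<Rightarrow> ('e \<Rightarrow> 'f::real_normed_vector) \<Rightarrow> bool" where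
  "Ck_on 0 S f \<longleftrightarrow> continuous_on S f"
| "Ck_on (Suc k) S f \<longleftrightarrow>
     (\<forall>x\<in>S. f differentiable (at x)) \<and>
     (\<forall>v. Ck_on k S (\<lambda>x. frechet_derivative f (at x) v))"

definition smooth_on :: "'e::real_normed_vector set \<Rightarrow> ('e \<Rightarrow> 'f::real_normed_vector) \<Rightarrow> bool" where
  "smooth_on S f \<longleftrightarrow> (\<forall>k. Ck_on k S f)"


(* A chart is a pair of its domain and its coordinate map; the values of the coordinate map
   outside the domain are irrelevant. The manifold is the whole type 'a, of dimension DIM('e). *)
type_synonym ('a, 'e) chart = "'a set \<times> ('a \<Rightarrow> 'e)"

definition chart_inv :: "('a, 'e) chart \<Rightarrow> 'e \<Rightarrow> 'a" where
  "chart_inv c = inv_into (fst c) (snd c)"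

definition chart_image :: "('a, 'e) chart \<Rightarrow> 'e set" where
  "chart_image c = snd c ` fst c"

(* Second countability is not required: it follows from compactness, which is assumed separately. *)
definition smooth_atlas :: "('a::t2_space, 'e::euclidean_space) chart set \<Rightarrow> bool" where
  "smooth_atlas A \<longleftrightarrow>
     (\<Union>c\<in>A. fst c) = UNIV \<and>
     (\<forall>c\<in>A. open (fst c) \<and> open (chart_image c) \<and>
             homeomorphism (fst c) (chart_image c) (snd c) (chart_inv c)) \<and>
     (\<forall>c\<in>A. \<forall>d\<in>A. smooth_on (snd c ` (fst c \<inter> fst d)) (snd d \<circ> chart_inv c))"


(* A tangent vector at p is the family of its coordinate vectors in all charts around p,
   which transform by the derivatives of the transition maps (and are 0 by convention
   in all other places). *)
type_synonym ('a, 'e) tangent = "('a, 'e) chart \<Rightarrow> 'e"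

definition tangent_space ::
  "('a::t2_space, 'e::euclidean_space) chart set \<Rightarrow> 'a \<Rightarrow> ('a, 'e) tangent set" where
  "tangent_space A p =
     {v. (\<forall>c\<in>A. \<forall>d\<in>A. p \<in> fst c \<inter> fst d \<longrightarrow>
            v d = frechet_derivative (snd d \<circ> chart_inv c) (at (snd c p)) (v c)) \<and>
         (\<forall>c. c \<notin> A \<or> p \<notin> fst c \<longrightarrow> v c = 0)}"

(* The tangent vector at p whose coordinate vector in the chart c is e. *)
definition tangent_of_coord ::
  "('a::t2_space, 'e::euclidean_space) chart set \<Rightarrow> ('a, 'e) chart \<Rightarrow> 'a \<Rightarrow> 'e \<Rightarrow> ('a, 'e) tangent" where
  "tangent_of_coord A c p e =
     (\<lambda>d. if d \<in> A \<and> p \<in> fst d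
          then frechet_derivative (snd d \<circ> chart_inv c) (at (snd c p)) e else 0)"

(* The differential of f at p. For f differentiable at p, the chain rule makes the value
   independent of the chart c selected at p. *)
definition tangent_map ::
  "('a::t2_space, 'e::euclidean_space) chart set \<Rightarrow> ('a \<Rightarrow> 'a) \<Rightarrow> 'a \<Rightarrow> ('a, 'e) tangent \<Rightarrow> ('a, 'e) tangent"
where
  "tangent_map A f p v =
     (let c = (SOME c. c \<in> A \<and> p \<in> fst c) in
      (\<lambda>d. if d \<in> A \<and> f p \<in> fst d
           then frechet_derivative (snd d \<circ> f \<circ> chart_inv c) (at (snd c p)) (v c) else 0))"


(* The third clause is bilinearity (in view of symmetry); in the last clause the functions are the
   components of the metric tensor in the chart c. *)
definition riemannian_metric ::
  "('a::t2_space, 'e::euclidean_space) chart set \<Rightarrow>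
   ('a \<Rightarrow> ('a, 'e) tangent \<Rightarrow> ('a, 'e) tangent \<Rightarrow> real) \<Rightarrow> bool" where
  "riemannian_metric A g \<longleftrightarrow>
     (\<forall>p. \<forall>u\<in>tangent_space A p. \<forall>v\<in>tangent_space A p. g p u v = g p v u) \<and>
     (\<forall>p. \<forall>u\<in>tangent_space A p. u \<noteq> 0 \<longrightarrow> g p u u > 0) \<and>
     (\<forall>p. \<forall>u\<in>tangent_space A p. \<forall>v\<in>tangent_space A p. \<forall>w\<in>tangent_space A p. \<forall>a b.
        g p (a *\<^sub>R u + b *\<^sub>R v) w = a * g p u w + b * g p v w) \<and>
     (\<forall>c\<in>A. \<forall>e e'. smooth_on (chart_image c)
        (\<lambda>z. g (chart_inv c z) (tangent_of_coord A c (chart_inv c z) e)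
                               (tangent_of_coord A c (chart_inv c z) e')))"

definition metric_norm ::
  "('a \<Rightarrow> ('a, 'e) tangent \<Rightarrow> ('a, 'e) tangent \<Rightarrow> real) \<Rightarrow> 'a \<Rightarrow> ('a, 'e) tangent \<Rightarrow> real" where
  "metric_norm g p v = sqrt (g p v v)"


definition coord_field ::
  "('a \<Rightarrow> ('a, 'e) tangent) \<Rightarrow> ('a, 'e) chart \<Rightarrow> 'e \<Rightarrow> 'e" where
  "coord_field X c = (\<lambda>z. X (chart_inv c z) c)"

definition vector_fields ::
  "('a::t2_space, 'e::euclidean_space) chart set \<Rightarrow> nat \<Rightarrow> ('a \<Rightarrow> ('a, 'e) tangent) set" where
  "vector_fields A r =
     {X. (\<forall>p. X p \<in> tangent_space A p) \<and>
         (\<forall>c\<in>A. Ck_on r (chart_image c) (coord_field X c))}"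

(* In coordinates, [X,Y] = DY(X) - DX(Y). *)
definition lie_bracket ::
  "('a::t2_space, 'e::euclidean_space) chart set \<Rightarrow> ('a \<Rightarrow> ('a, 'e) tangent) \<Rightarrow>
   ('a \<Rightarrow> ('a, 'e) tangent) \<Rightarrow> 'a \<Rightarrow> ('a, 'e) tangent" where
  "lie_bracket A X Y p =
     (\<lambda>c. if c \<in> A \<and> p \<in> fst c
          then frechet_derivative (coord_field Y c) (at (snd c p)) (X p c)
             - frechet_derivative (coord_field X c) (at (snd c p)) (Y p c)
          else 0)"

definition C1_centralizer ::
  "('a::t2_space, 'e::euclidean_space) chart set \<Rightarrow> ('a \<Rightarrow> ('a, 'e) tangent) \<Rightarrow>
   ('a \<Rightarrow> ('a, 'e) tangent) set" where
  "C1_centralizer A X = {Y \<in> vector_fields A 1. \<forall>p. lie_bracket A X Y p = 0}"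

(* Continuity of orbits is needed since chart maps have arbitrary values outside their domain. *)
definition generates_flow ::
  "('a::t2_space, 'e::euclidean_space) chart set \<Rightarrow> ('a \<Rightarrow> ('a, 'e) tangent) \<Rightarrow>
   (real \<Rightarrow> 'a \<Rightarrow> 'a) \<Rightarrow> bool" where
  "generates_flow A X \<phi> \<longleftrightarrow>
     (\<forall>x. \<phi> 0 x = x) \<and>
     (\<forall>s t x. \<phi> (s + t) x = \<phi> s (\<phi> t x)) \<and>
     (\<forall>x. continuous_on UNIV (\<lambda>t. \<phi> t x)) \<and>
     (\<forall>x t. \<forall>c\<in>A. \<phi> t x \<in> fst c \<longrightarrow>
        ((\<lambda>s. snd c (\<phi> s x)) has_vector_derivative X (\<phi> t x) c) (at t))"


definition non_atomic :: "'a measure \<Rightarrow> bool" where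
  "non_atomic \<mu> \<longleftrightarrow>
     \<not> (\<exists>S\<in>sets \<mu>. emeasure \<mu> S > 0 \<and>
          (\<forall>T\<in>sets \<mu>. T \<subseteq> S \<longrightarrow> emeasure \<mu> T = 0 \<or> emeasure \<mu> T = emeasure \<mu> S))"

definition flow_invariant :: "(real \<Rightarrow> 'a \<Rightarrow> 'a) \<Rightarrow> 'a measure \<Rightarrow> bool" where
  "flow_invariant \<phi> \<mu> \<longleftrightarrow> (\<forall>t. \<phi> t \<in> measurable \<mu> \<mu> \<and> distr \<mu> \<mu> (\<phi> t) = \<mu>)"

definition flow_ergodic :: "(real \<Rightarrow> 'a \<Rightarrow> 'a) \<Rightarrow> 'a measure \<Rightarrow> bool" where
  "flow_ergodic \<phi> \<mu> \<longleftrightarrow>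
     (\<forall>S\<in>sets \<mu>. (\<forall>t. \<phi> t -` S \<inter> space \<mu> = S) \<longrightarrow> emeasure \<mu> S = 0 \<or> emeasure \<mu> (space \<mu> - S) = 0)"

definition measure_support :: "'a::topological_space measure \<Rightarrow> 'a set" where
  "measure_support \<mu> = {x. \<forall>U. open U \<longrightarrow> x \<in> U \<longrightarrow> emeasure \<mu> U > 0}"


(* E x 0, ..., E x (k x) is the Oseledets splitting at mu-almost every x, with
   Lyapunov exponents lam x 1, ..., lam x (k x) on the summands transverse to the flow. *)
definition oseledets_splitting ::
  "('a::t2_space, 'e::euclidean_space) chart set \<Rightarrow>
   ('a \<Rightarrow> ('a, 'e) tangent \<Rightarrow> ('a, 'e) tangent \<Rightarrow> real) \<Rightarrow>
   ('a \<Rightarrow> ('a, 'e) tangent) \<Rightarrow> (real \<Rightarrow> 'a \<Rightarrow> 'a) \<Rightarrow> 'a measure \<Rightarrow>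
   ('a \<Rightarrow> nat) \<Rightarrow> ('a \<Rightarrow> nat \<Rightarrow> ('a, 'e) tangent set) \<Rightarrow> ('a \<Rightarrow> nat \<Rightarrow> real) \<Rightarrow> bool" where
  "oseledets_splitting A g X \<phi> \<mu> k E lam \<longleftrightarrow>
     (AE x in \<mu>.
        (\<forall>i\<le>k x. subspace (E x i) \<and> E x i \<subseteq> tangent_space A x \<and> E x i \<noteq> {0}) \<and>
        E x 0 = span {X x} \<and> dim (E x 0) = 1 \<and>
        (\<forall>v\<in>tangent_space A x. \<exists>!u :: nat \<Rightarrow> ('a, 'e) tangent.
           (\<forall>i\<le>k x. u i \<in> E x i) \<and> (\<forall>i>k x. u i = 0) \<and> v = (\<Sum>i\<le>k x. u i)) \<and>
        (\<forall>t. k (\<phi> t x) = k x \<and> (\<forall>i\<le>k x. tangent_map A (\<phi> t) x ` E x i = E (\<phi> t x) i)) \<and>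
        (\<forall>i\<in>{1..k x}. \<forall>v\<in>E x i - {0}.
           ((\<lambda>t. ln (metric_norm g (\<phi> t x) (tangent_map A (\<phi> t) x v)) / t) \<longlongrightarrow> lam x i) at_top \<and>
           ((\<lambda>t. ln (metric_norm g (\<phi> t x) (tangent_map A (\<phi> t) x v)) / t) \<longlongrightarrow> lam x i) at_bot))"

(* Meant for ergodic measures, where the number of summands and the exponents are constant almost
   everywhere. The existential asserts the Oseledets data; the set of exponents does not depend
   on the choice of k, E and lam. *)
definition hyperbolic_measure ::
  "('a::t2_space, 'e::euclidean_space) chart set \<Rightarrow>
   ('a \<Rightarrow> ('a, 'e) tangent \<Rightarrow> ('a, 'e) tangent \<Rightarrow> real) \<Rightarrow>
   ('a \<Rightarrow> ('a, 'e) tangent) \<Rightarrow> (real \<Rightarrow> 'a \<Rightarrow> 'a) \<Rightarrow> 'a measure \<Rightarrow> bool" where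
  "hyperbolic_measure A g X \<phi> \<mu> \<longleftrightarrow>
     (\<exists>k E lam. oseledets_splitting A g X \<phi> \<mu> (\<lambda>_. k) E (\<lambda>_. lam) \<and>
        (\<forall>i\<in>{1..k}. lam i \<noteq> 0))"

end

theory Submission
  imports Defs
begin

text \<open>
  Let \<open>Y\<close> commute with \<open>X\<close>. The differential of the flow \<open>\<phi>\<close> of \<open>X\<close> carries the vector \<open>Y(x)\<close> to
  \<open>Y(\<phi>\<^sub>t x)\<close>, so on a compact manifold the orbit of \<open>Y(x)\<close> under the differential is bounded for all
  times, and so is that of \<open>X(x)\<close>. Split \<open>Y(x) = a X(x) + u + v\<close>, where \<open>u\<close> collects the Oseledets
  components with positive exponent and \<open>v\<close> those with negative exponent. As time goes to minus infinity \<open>u\<close>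
  decays exponentially, and as time goes to infinity \<open>v\<close> does; since \<open>u + v\<close> is bounded, both \<open>u\<close> and \<open>v\<close>
  have bounded orbits.

  A bounded orbit of a nonzero vector cannot decay exponentially in one direction of time, except over a null set
  (\<open>AE_bounded_decaying_vanishes\<close>). For a single summand of the splitting this is the
  growth that its exponent prescribes, but several summands may share an exponent, and their
  components might cancel. The splitting is not given as a measurable function of the point either, so the
  argument is one of recurrence for sets that are defined without it. For \<open>\<delta> > 0\<close> and
  bounds \<open>b k\<close> at the integer times \<open>k\<close>, the points with a vector of length at least \<open>\<delta>\<close> whose
  images obey these bounds form a compact set (\<open>compact_bounded_growth_set\<close>). If \<open>b\<close> is bounded and tends to
  \<open>0\<close> in one direction, then every orbit visits this set only finitely often in that direction: pulled back
  to the initial point, the vectors found along the orbit are bounded and tend to \<open>0\<close>, and they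
  do so uniformly because a tangent space has finite dimension. As the flow
  preserves \<open>\<mu>\<close>, the set is null (\<open>bounded_growth_set_null\<close>).

  Hence \<open>Y = a X\<close> almost everywhere (\<open>AE_commuting_field_parallel\<close>). The factor \<open>a\<close> is invariant, so it
  is a constant \<open>c\<close> by ergodicity (\<open>ergodic_factor_constant\<close>), and \<open>Y = c X\<close> on the support by continuity
  (\<open>field_eq_on_support\<close>). The support is invariant under \<open>\<phi>\<close>, and on it the integral curves of \<open>Y\<close>
  are those of \<open>X\<close> run at speed \<open>c\<close>, because integral curves are unique (\<open>commuting_flow_on_support\<close>).

  All this rests on the differentiability of the flow of a \<open>C\<^sup>1\<close> field, with a differential that
  solves the variational equation and thus preserves commuting fields (\<open>flow_C1_commuting\<close>).
  It is proved for short times in coordinates, where Gronwall's inequality takes a very simple form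
  (\<open>short_time_bound\<close>), and extended to all times by compactness and iteration.
\<close>


section \<open>Maps of class \<open>C\<^sup>1\<close> on open sets\<close>

definition C1_on :: "'e::real_normed_vector set \<Rightarrow> ('e \<Rightarrow> 'f::real_normed_vector) \<Rightarrow> bool" where
  "C1_on S f \<longleftrightarrow> (\<forall>x\<in>S. f differentiable (at x)) \<and>
     (\<forall>v. continuous_on S (\<lambda>x. frechet_derivative f (at x) v))"

lemma C1_onD:
  assumes "C1_on S f" "x \<in> S"
  shows "(f has_derivative frechet_derivative f (at x)) (at x)"
    and "linear (frechet_derivative f (at x))"
  using assms unfolding C1_on_def
  by (auto simp: frechet_derivative_works[symmetric] linear_frechet_derivative)

lemma C1_on_continuous: "C1_on S f \<Longrightarrow> continuous_on S f"
  unfolding C1_on_def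
  by (meson continuous_at_imp_continuous_on differentiable_imp_continuous_within)

lemma Ck_on_imp_C1_on: "k \<ge> 1 \<Longrightarrow> Ck_on k S f \<Longrightarrow> C1_on S f"
proof -
  assume "k \<ge> 1" "Ck_on k S f"
  then obtain m where m: "Ck_on (Suc m) S f" by (cases k) auto
  have "continuous_on S (\<lambda>x. frechet_derivative f (at x) v)" for v
  proof (cases m)
    case 0 then show ?thesis using m by simp
  next
    case (Suc j)
    then have "\<forall>x\<in>S. (\<lambda>x. frechet_derivative f (at x) v) differentiable (at x)" using m by simp
    then show ?thesis
      by (meson continuous_at_imp_continuous_on differentiable_imp_continuous_within)
  qed
  then show ?thesis using m unfolding C1_on_def by auto
qed

lemma C1_on_subset: "C1_on S f \<Longrightarrow> T \<subseteq> S \<Longrightarrow> C1_on T f"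
  unfolding C1_on_def by (meson continuous_on_subset subsetD)

lemma C1_on_cong:
  assumes "open S" "C1_on S f" "\<And>x. x \<in> S \<Longrightarrow> f x = h x"
  shows "C1_on S h" "x \<in> S \<Longrightarrow> frechet_derivative h (at x) = frechet_derivative f (at x)"
proof -
  have d: "(h has_derivative frechet_derivative f (at x)) (at x)" if "x \<in> S" for x
    using has_derivative_transform_within_open[OF C1_onD(1)[OF assms(2) that] assms(1) that assms(3)]
    by simp
  have e: "frechet_derivative h (at x) = frechet_derivative f (at x)" if "x \<in> S" for x
    using frechet_derivative_at[OF d[OF that]] by simp
  have "continuous_on S (\<lambda>x. frechet_derivative h (at x) v)" for v
    using assms(2) e by (simp add: C1_on_def cong: continuous_on_cong)
  then show "C1_on S h"
    using d unfolding C1_on_def differentiable_def by blast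
  show "x \<in> S \<Longrightarrow> frechet_derivative h (at x) = frechet_derivative f (at x)" by (rule e)
qed

lemma linear_expand_Basis:
  fixes L :: "'e::euclidean_space \<Rightarrow> 'f::real_vector"
  assumes "linear L"
  shows "L v = (\<Sum>b\<in>Basis. (v \<bullet> b) *\<^sub>R L b)"
proof -
  interpret L: linear L by fact
  have "L v = L (\<Sum>b\<in>Basis. (v \<bullet> b) *\<^sub>R b)" by (simp add: euclidean_representation)
  also have "\<dots> = (\<Sum>b\<in>Basis. (v \<bullet> b) *\<^sub>R L b)" by (simp add: L.sum L.scaleR)
  finally show ?thesis .
qed

lemma continuous_on_linear_apply:
  fixes L :: "'x::topological_space \<Rightarrow> 'e::euclidean_space \<Rightarrow> 'f::real_normed_vector"
  assumes "\<And>x. x \<in> S \<Longrightarrow> linear (L x)" "\<And>b. continuous_on S (\<lambda>x. L x b)" "continuous_on S w"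
  shows "continuous_on S (\<lambda>x. L x (w x))"
proof -
  have "continuous_on S (\<lambda>x. \<Sum>b\<in>Basis. (w x \<bullet> b) *\<^sub>R L x b)"
    by (intro continuous_intros assms)
  then show ?thesis
    by (simp add: linear_expand_Basis[OF assms(1), symmetric] cong: continuous_on_cong)
qed

lemma C1_on_apply_continuous:
  fixes f :: "'e::euclidean_space \<Rightarrow> 'f::real_normed_vector"
  assumes "C1_on T f" "continuous_on S a" "a ` S \<subseteq> T" "continuous_on S w"
  shows "continuous_on S (\<lambda>x. frechet_derivative f (at (a x)) (w x))"
proof (rule continuous_on_linear_apply[OF _ _ assms(4)])
  show "linear (frechet_derivative f (at (a x)))" if "x \<in> S" for x
    using C1_onD(2)[OF assms(1)] assms(3) that by blast
  show "continuous_on S (\<lambda>x. frechet_derivative f (at (a x)) b)" for b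
    using continuous_on_compose2[of T "\<lambda>x. frechet_derivative f (at x) b" S a] assms
    by (auto simp: C1_on_def)
qed

lemma C1_on_compose:
  fixes f :: "'e::euclidean_space \<Rightarrow> 'f::euclidean_space" and h :: "'f \<Rightarrow> 'h::real_normed_vector"
  assumes "C1_on S f" "C1_on T h" "f ` S \<subseteq> T"
  shows "C1_on S (h \<circ> f)"
    and "x \<in> S \<Longrightarrow> frechet_derivative (h \<circ> f) (at x) v
            = frechet_derivative h (at (f x)) (frechet_derivative f (at x) v)"
proof -
  have d: "((h \<circ> f) has_derivative
      (frechet_derivative h (at (f x)) \<circ> frechet_derivative f (at x))) (at x)" if "x \<in> S" for x
    using diff_chain_at[OF C1_onD(1)[OF assms(1) that] C1_onD(1)[OF assms(2)]] assms(3) that by blast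
  have e: "frechet_derivative (h \<circ> f) (at x) v
            = frechet_derivative h (at (f x)) (frechet_derivative f (at x) v)" if "x \<in> S" for x v
    using frechet_derivative_at[OF d[OF that]] by (metis comp_apply)
  have "continuous_on S (\<lambda>x. frechet_derivative h (at (f x)) (frechet_derivative f (at x) v))" for v
    using assms C1_on_continuous[OF assms(1)]
    by (intro C1_on_apply_continuous) (auto simp: C1_on_def)
  then show "C1_on S (h \<circ> f)"
    using d e unfolding C1_on_def differentiable_def by (auto cong: continuous_on_cong)
  show "x \<in> S \<Longrightarrow> frechet_derivative (h \<circ> f) (at x) v
            = frechet_derivative h (at (f x)) (frechet_derivative f (at x) v)" by (rule e)
qed

lemma linear_bound_Basis:
  fixes L :: "'e::euclidean_space \<Rightarrow> 'f::real_normed_vector"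
    and m :: real
  assumes "linear L" "\<And>b. b \<in> Basis \<Longrightarrow> norm (L b) \<le> m"
  shows "norm (L v) \<le> DIM('e) * m * norm v"
proof -
  have "norm (L v) \<le> (\<Sum>b\<in>Basis. norm ((v \<bullet> b) *\<^sub>R L b))"
    unfolding linear_expand_Basis[OF assms(1), of v] by (rule norm_sum)
  also have "\<dots> \<le> (\<Sum>b\<in>(Basis::'e set). norm v * m)"
    by (intro sum_mono) (auto intro!: mult_mono assms Basis_le_norm)
  finally show ?thesis by (simp add: mult_ac)
qed

section \<open>Short-time flows in Euclidean space\<close>

text \<open>On an interval so short that \<open>L \<tau> \<le> 1/2\<close>, Gronwall's inequality reduces to the mean value
  inequality at the point where the norm of \<open>u\<close> is largest.\<close>

lemma short_time_bound:
  fixes u :: "real \<Rightarrow> 'e::real_normed_vector"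
  assumes der: "\<And>t. t \<in> {-\<tau>..\<tau>} \<Longrightarrow> (u has_vector_derivative u' t) (at t within {-\<tau>..\<tau>})"
    and bd: "\<And>t. t \<in> {-\<tau>..\<tau>} \<Longrightarrow> norm (u' t) \<le> L * norm (u t) + \<epsilon>"
    and "L \<ge> 0" "\<epsilon> \<ge> 0" "\<tau> \<ge> 0" "L * \<tau> \<le> 1/2" and t: "t \<in> {-\<tau>..\<tau>}"
  shows "norm (u t) \<le> 2 * norm (u 0) + 2 * \<tau> * \<epsilon>"
proof -
  let ?I = "{-\<tau>..\<tau>}"
  have "continuous_on ?I u"
    using der has_vector_derivative_continuous continuous_on_eq_continuous_within by blast
  then obtain s where s: "s \<in> ?I" "\<And>r. r \<in> ?I \<Longrightarrow> norm (u r) \<le> norm (u s)"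
    using continuous_attains_sup[OF compact_Icc _ continuous_on_norm, of "-\<tau>" \<tau> u] t by auto
  have "norm (u s - u 0) \<le> (L * norm (u s) + \<epsilon>) * norm (s - 0)"
  proof (rule differentiable_bound[of ?I u "\<lambda>t h. h *\<^sub>R u' t"])
    show "(u has_derivative (\<lambda>h. h *\<^sub>R u' x)) (at x within ?I)" if "x \<in> ?I" for x
      using der[OF that] by (simp add: has_vector_derivative_def)
    show "onorm (\<lambda>h. h *\<^sub>R u' x) \<le> L * norm (u s) + \<epsilon>" if "x \<in> ?I" for x
    proof (rule onorm_le)
      fix h :: real
      have "norm (u' x) \<le> L * norm (u s) + \<epsilon>"
        using bd[OF that] s(2)[OF that] \<open>L \<ge> 0\<close> by (meson add_right_mono mult_left_mono order_trans)
      then show "norm (h *\<^sub>R u' x) \<le> (L * norm (u s) + \<epsilon>) * norm h"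
        by (metis abs_ge_zero mult.commute mult_left_mono norm_scaleR real_norm_def)
    qed
  qed (use s assms in auto)
  also have "\<dots> \<le> (L * norm (u s) + \<epsilon>) * \<tau>"
    using s(1) assms by (intro mult_left_mono) auto
  also have "\<dots> = (L * \<tau>) * norm (u s) + \<epsilon> * \<tau>" by (simp add: algebra_simps)
  also have "\<dots> \<le> 1/2 * norm (u s) + \<epsilon> * \<tau>"
    using assms by (intro add_right_mono mult_right_mono) auto
  finally have "norm (u s - u 0) \<le> 1/2 * norm (u s) + \<epsilon> * \<tau>" .
  moreover have "norm (u s) \<le> norm (u 0) + norm (u s - u 0)"
    by (metis add.commute diff_add_cancel norm_triangle_ineq)
  ultimately have "norm (u s) \<le> 2 * norm (u 0) + 2 * \<tau> * \<epsilon>" by (simp add: algebra_simps)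
  then show ?thesis using s(2)[OF t] by linarith
qed

text \<open>The setting of a flow box read in coordinates: orbits that start in the open set \<open>U\<close> stay in the
  compact convex set \<open>K\<close> up to time \<open>\<tau>\<close>. The bound \<open>L \<tau> \<le> 1/2\<close> makes \<open>short_time_bound\<close> applicable
  to differences of orbits.\<close>

locale short_flow =
  fixes f :: "'e::euclidean_space \<Rightarrow> 'e" and K U :: "'e set" and L \<tau> :: real
    and \<Phi> :: "real \<Rightarrow> 'e \<Rightarrow> 'e" and Df
  assumes convK: "convex K" and compK: "compact K" and openU: "open U"
    and derf: "\<And>z. z \<in> K \<Longrightarrow> (f has_derivative Df z) (at z)"
    and contDf: "\<And>v. continuous_on K (\<lambda>z. Df z v)"
    and boundDf: "\<And>z v. z \<in> K \<Longrightarrow> norm (Df z v) \<le> L * norm v"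
    and L: "L \<ge> 0" and \<tau>: "\<tau> \<ge> 0" and L\<tau>: "L * \<tau> \<le> 1/2"
    and flow_in: "\<And>z t. z \<in> U \<Longrightarrow> t \<in> {-\<tau>..\<tau>} \<Longrightarrow> \<Phi> t z \<in> K"
    and flow_0: "\<And>z. z \<in> U \<Longrightarrow> \<Phi> 0 z = z"
    and flow_der: "\<And>z t. z \<in> U \<Longrightarrow> t \<in> {-\<tau>..\<tau>} \<Longrightarrow>
      ((\<lambda>s. \<Phi> s z) has_vector_derivative f (\<Phi> t z)) (at t within {-\<tau>..\<tau>})"
begin

abbreviation "I \<equiv> {-\<tau>..\<tau>}"

lemma lin_Df: "z \<in> K \<Longrightarrow> linear (Df z)"
  using derf has_derivative_linear by blast

lemma f_Lipschitz: "y \<in> K \<Longrightarrow> z \<in> K \<Longrightarrow> norm (f y - f z) \<le> L * norm (y - z)"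
  by (rule differentiable_bound[OF convK, of f Df])
     (auto intro: derf has_derivative_at_withinI onorm_le boundDf)

lemma Df_uniformly_continuous:
  assumes "\<epsilon> > 0"
  shows "\<exists>\<eta>>0. \<forall>y\<in>K. \<forall>z\<in>K. norm (y - z) < \<eta> \<longrightarrow> (\<forall>v. norm (Df y v - Df z v) \<le> \<epsilon> * norm v)"
proof -
  let ?e = "\<epsilon> / DIM('e)"
  have e: "?e > 0" using assms by simp
  have "\<exists>\<eta>>0. \<forall>y\<in>K. \<forall>z\<in>K. norm (y - z) < \<eta> \<longrightarrow> norm (Df y b - Df z b) < ?e" for b
    using compact_uniformly_continuous[OF contDf compK, of b] e
    unfolding uniformly_continuous_on_def dist_norm by metis
  then obtain h where h: "\<And>b. h b > 0"
      "\<And>b y z. y \<in> K \<Longrightarrow> z \<in> K \<Longrightarrow> norm (y - z) < h b \<Longrightarrow> norm (Df y b - Df z b) < ?e"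
    by metis
  define \<eta> where "\<eta> = Min (h ` Basis)"
  have "\<eta> > 0" using h(1) by (auto simp: \<eta>_def)
  moreover have "norm (Df y v - Df z v) \<le> \<epsilon> * norm v"
    if "y \<in> K" "z \<in> K" "norm (y - z) < \<eta>" for y z v
  proof -
    have "norm (Df y b - Df z b) \<le> ?e" if "b \<in> Basis" for b
      using h(2)[OF \<open>y \<in> K\<close> \<open>z \<in> K\<close>, of b] \<open>norm (y - z) < \<eta>\<close> that
      by (force simp: \<eta>_def)
    then have "norm (Df y v - Df z v) \<le> DIM('e) * ?e * norm v"
      using linear_bound_Basis[of "\<lambda>v. Df y v - Df z v" ?e v]
        linear_compose_sub[OF lin_Df[OF \<open>y \<in> K\<close>] lin_Df[OF \<open>z \<in> K\<close>]] by blast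
    then show ?thesis by simp
  qed
  ultimately show ?thesis by blast
qed

text \<open>The mean value inequality for \<open>f - Df(z)\<close>, whose derivative is small near \<open>z\<close>, gives a first
  order expansion that is uniform in the base point.\<close>

lemma f_remainder:
  assumes "\<epsilon> > 0"
  shows "\<exists>\<eta>>0. \<forall>y\<in>K. \<forall>z\<in>K. norm (y - z) < \<eta> \<longrightarrow> norm (f y - f z - Df z (y - z)) \<le> \<epsilon> * norm (y - z)"
proof -
  obtain \<eta> where \<eta>: "\<eta> > 0"
    "\<And>y z v. y \<in> K \<Longrightarrow> z \<in> K \<Longrightarrow> norm (y - z) < \<eta> \<Longrightarrow> norm (Df y v - Df z v) \<le> \<epsilon> * norm v"
    using Df_uniformly_continuous[OF assms] by blast
  have "norm (f y - f z - Df z (y - z)) \<le> \<epsilon> * norm (y - z)"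
    if yz: "y \<in> K" "z \<in> K" "norm (y - z) < \<eta>" for y z
  proof -
    interpret Dz: linear "Df z" using lin_Df yz by blast
    have "norm ((f y - Df z y) - (f z - Df z z)) \<le> \<epsilon> * norm (y - z)"
    proof (rule differentiable_bound[of "K \<inter> ball z \<eta>" _ "\<lambda>x v. Df x v - Df z v"])
      show "convex (K \<inter> ball z \<eta>)" by (intro convex_Int convK convex_ball)
      show "((\<lambda>a. f a - Df z a) has_derivative (\<lambda>v. Df x v - Df z v)) (at x within K \<inter> ball z \<eta>)"
        if "x \<in> K \<inter> ball z \<eta>" for x
      proof (rule has_derivative_at_withinI, rule has_derivative_diff)
        show "(f has_derivative Df x) (at x)" using that by (intro derf) auto
        show "(Df z has_derivative Df z) (at x)" by (rule linear_imp_has_derivative[OF lin_Df[OF yz(2)]])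
      qed
      show "onorm (\<lambda>v. Df x v - Df z v) \<le> \<epsilon>" if "x \<in> K \<inter> ball z \<eta>" for x
        using that \<eta>(2)[of x z] yz by (intro onorm_le) (auto simp: dist_norm norm_minus_commute)
    qed (use yz \<eta> in \<open>auto simp: dist_norm norm_minus_commute\<close>)
    then show ?thesis by (simp add: Dz.diff algebra_simps)
  qed
  then show ?thesis using \<eta>(1) by blast
qed

lemma flow_Lipschitz:
  assumes "y \<in> U" "z \<in> U" "t \<in> I"
  shows "norm (\<Phi> t y - \<Phi> t z) \<le> 2 * norm (y - z)"
proof -
  have "norm (\<Phi> t y - \<Phi> t z) \<le> 2 * norm (\<Phi> 0 y - \<Phi> 0 z) + 2 * \<tau> * 0"
  proof (rule short_time_bound[where u = "\<lambda>t. \<Phi> t y - \<Phi> t z" and u' = "\<lambda>t. f (\<Phi> t y) - f (\<Phi> t z)"])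
    show "((\<lambda>t. \<Phi> t y - \<Phi> t z) has_vector_derivative f (\<Phi> t y) - f (\<Phi> t z)) (at t within I)"
      if "t \<in> I" for t
      using that assms by (intro has_vector_derivative_diff flow_der)
    show "norm (f (\<Phi> t y) - f (\<Phi> t z)) \<le> L * norm (\<Phi> t y - \<Phi> t z) + 0" if "t \<in> I" for t
      using that assms by (simp add: f_Lipschitz flow_in)
  qed (use L \<tau> L\<tau> assms in auto)
  then show ?thesis using assms by (simp add: flow_0)
qed

text \<open>The difference of two nearby orbits solves the variational equation along either of them up to an
  error that is small compared with their distance. This is the source of both the existence of solutions and the
  differentiability of the flow.\<close>

lemma flow_difference_linearized:
  assumes "\<epsilon> > 0"
  shows "\<exists>\<eta>>0. \<forall>y\<in>U. \<forall>z\<in>U. \<forall>t\<in>I. norm (y - z) < \<eta> \<longrightarrow>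
     norm (f (\<Phi> t y) - f (\<Phi> t z) - Df (\<Phi> t z) (\<Phi> t y - \<Phi> t z)) \<le> \<epsilon> * norm (y - z)"
proof -
  obtain \<eta> where \<eta>: "\<eta> > 0" "\<And>y z. y \<in> K \<Longrightarrow> z \<in> K \<Longrightarrow> norm (y - z) < \<eta> \<Longrightarrow>
      norm (f y - f z - Df z (y - z)) \<le> \<epsilon> / 2 * norm (y - z)"
    using f_remainder[of "\<epsilon> / 2"] assms by (metis half_gt_zero)
  have "norm (f (\<Phi> t y) - f (\<Phi> t z) - Df (\<Phi> t z) (\<Phi> t y - \<Phi> t z)) \<le> \<epsilon> * norm (y - z)"
    if "y \<in> U" "z \<in> U" "t \<in> I" "norm (y - z) < \<eta> / 2" for y z t
  proof -
    have *: "norm (\<Phi> t y - \<Phi> t z) \<le> 2 * norm (y - z)" by (rule flow_Lipschitz[OF that(1-3)])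
    have "norm (f (\<Phi> t y) - f (\<Phi> t z) - Df (\<Phi> t z) (\<Phi> t y - \<Phi> t z)) \<le> \<epsilon> / 2 * norm (\<Phi> t y - \<Phi> t z)"
      using that * by (intro \<eta>(2) flow_in) auto
    also have "\<dots> \<le> \<epsilon> / 2 * (2 * norm (y - z))"
      using * assms by (intro mult_left_mono) auto
    finally show ?thesis by simp
  qed
  then show ?thesis using \<eta>(1) by (intro exI[of _ "\<eta> / 2"]) auto
qed

text \<open>Solutions of the variational equation \<open>q' = Df(\<Phi>\<^sub>t z) q\<close> with initial value \<open>v\<close>.\<close>

definition variational :: "'e \<Rightarrow> 'e \<Rightarrow> (real \<Rightarrow> 'e) \<Rightarrow> bool" where
  "variational z v q \<longleftrightarrow> q 0 = v \<and>
     (\<forall>t\<in>I. (q has_vector_derivative Df (\<Phi> t z) (q t)) (at t within I))"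

text \<open>An approximate solution stays close to the exact one, because their difference satisfies the
  hypothesis of \<open>short_time_bound\<close>.\<close>

lemma variational_estimate:
  assumes z: "z \<in> U" and q: "variational z v q" and "\<epsilon> \<ge> 0"
    and u: "\<And>t. t \<in> I \<Longrightarrow> (u has_vector_derivative u' t) (at t within I)"
    and bd: "\<And>t. t \<in> I \<Longrightarrow> norm (u' t - Df (\<Phi> t z) (u t)) \<le> \<epsilon>" and t: "t \<in> I"
  shows "norm (u t - q t) \<le> 2 * norm (u 0 - v) + 2 * \<tau> * \<epsilon>"
proof -
  have "norm (u t - q t) \<le> 2 * norm (u 0 - q 0) + 2 * \<tau> * \<epsilon>"
  proof (rule short_time_bound[where u = "\<lambda>t. u t - q t" and u' = "\<lambda>t. u' t - Df (\<Phi> t z) (q t)"])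
    show "((\<lambda>t. u t - q t) has_vector_derivative u' t - Df (\<Phi> t z) (q t)) (at t within I)"
      if "t \<in> I" for t
      using that q by (intro has_vector_derivative_diff u) (auto simp: variational_def)
    show "norm (u' t - Df (\<Phi> t z) (q t)) \<le> L * norm (u t - q t) + \<epsilon>" if "t \<in> I" for t
    proof -
      have K: "\<Phi> t z \<in> K" using flow_in[OF z that] .
      have eq: "u' t - Df (\<Phi> t z) (q t) = (u' t - Df (\<Phi> t z) (u t)) + Df (\<Phi> t z) (u t - q t)"
        using linear_diff[OF lin_Df[OF K]] by simp
      show ?thesis
        unfolding eq
        using norm_triangle_ineq[of "u' t - Df (\<Phi> t z) (u t)" "Df (\<Phi> t z) (u t - q t)"]
          bd[OF that] boundDf[OF K, of "u t - q t"] by linarith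
    qed
  qed (use L \<tau> L\<tau> assms in auto)
  then show ?thesis using q by (simp add: variational_def)
qed

lemma variational_unique:
  assumes "z \<in> U" "variational z v q" "variational z v p" "t \<in> I"
  shows "p t = q t"
  using variational_estimate[OF assms(1,2), of 0 p "\<lambda>t. Df (\<Phi> t z) (p t)" t] assms(3,4)
  by (simp add: variational_def)

text \<open>The variational equation is solved by the directional derivatives of the flow: the difference
  quotients solve it up to an error that tends to \<open>0\<close> uniformly, so they form a uniform Cauchy
  sequence together with their derivatives, and the limit is a solution.\<close>

lemma variational_exists:
  assumes z: "z \<in> U"
  shows "\<exists>q. variational z v q"
proof -
  obtain \<rho> where \<rho>: "\<rho> > 0" "ball z \<rho> \<subseteq> U" using openU z openE by blast
  obtain N :: nat where N': "norm v / \<rho> < N" using reals_Archimedean2 by blast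
  have N: "N > 0" "norm v / N < \<rho>"
  proof -
    have "0 \<le> norm v / \<rho>" using \<rho>(1) by simp
    then show "N > 0" using N' by linarith
    then show "norm v / N < \<rho>" using N' \<rho>(1) by (simp add: field_simps)
  qed
  define s :: "nat \<Rightarrow> real" where "s n = n + N" for n
  have s: "s n > 0" "s n \<ge> N" for n using N by (auto simp: s_def)
  define y where "y n = z + (1 / s n) *\<^sub>R v" for n
  have ny: "norm (y n - z) = norm v / s n" for n using s(1)[of n] by (simp add: y_def)
  have "norm v / s n < \<rho>" for n
    using frac_le[of "norm v" "norm v" "real N" "s n"] s[of n] N by simp
  then have yU: "y n \<in> U" for n using ny[of n] \<rho>(2) by (metis dist_commute dist_norm mem_ball subsetD)
  define q where "q n t = s n *\<^sub>R (\<Phi> t (y n) - \<Phi> t z)" for n t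
  define q' where "q' n t = s n *\<^sub>R (f (\<Phi> t (y n)) - f (\<Phi> t z))" for n t
  have q0: "q n 0 = v" for n using s(1)[of n] by (simp add: q_def flow_0 yU z) (simp add: y_def)
  have qd: "(q n has_vector_derivative q' n t) (at t within I)" if "t \<in> I" for n t
    unfolding q_def q'_def
    using bounded_linear.has_vector_derivative[OF bounded_linear_scaleR_right
        has_vector_derivative_diff[OF flow_der[OF yU that] flow_der[OF z that]]] .
  have s_lim: "(\<lambda>n. norm v / s n) \<longlonglongrightarrow> 0"
    using tendsto_mult_right_zero[OF LIMSEQ_ignore_initial_segment[OF lim_inverse_n[where 'a=real], of N], of "norm v"]
    by (simp add: s_def divide_inverse)
  have approx: "\<forall>\<^sub>F n in sequentially. \<forall>t\<in>I. norm (q' n t - Df (\<Phi> t z) (q n t)) \<le> \<epsilon>"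
    if "\<epsilon> > 0" for \<epsilon>
  proof -
    define \<delta> where "\<delta> = \<epsilon> / (norm v + 1)"
    have \<delta>: "\<delta> > 0" "\<delta> * norm v \<le> \<epsilon>"
      using that by (auto simp: \<delta>_def field_simps add_pos_nonneg)
    obtain \<eta> where \<eta>: "\<eta> > 0" "\<And>y t. y \<in> U \<Longrightarrow> t \<in> I \<Longrightarrow> norm (y - z) < \<eta> \<Longrightarrow>
       norm (f (\<Phi> t y) - f (\<Phi> t z) - Df (\<Phi> t z) (\<Phi> t y - \<Phi> t z)) \<le> \<delta> * norm (y - z)"
      using flow_difference_linearized[OF \<delta>(1)] z by blast
    have "\<forall>\<^sub>F n in sequentially. norm v / s n < \<eta>"
      using order_tendstoD(2)[OF s_lim \<eta>(1)] .
    then show ?thesis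
    proof eventually_elim
      case (elim n)
      show ?case
      proof
        fix t assume t: "t \<in> I"
        have "q' n t - Df (\<Phi> t z) (q n t)
            = s n *\<^sub>R (f (\<Phi> t (y n)) - f (\<Phi> t z) - Df (\<Phi> t z) (\<Phi> t (y n) - \<Phi> t z))"
          unfolding q_def q'_def linear_cmul[OF lin_Df[OF flow_in[OF z t]]] scaleR_diff_right[symmetric] ..
        also have "norm \<dots> \<le> s n * (\<delta> * norm (y n - z))"
          using \<eta>(2)[OF yU t, of n] elim s(1)[of n] unfolding ny norm_scaleR
          by (intro mult_mono) auto
        also have "\<dots> = \<delta> * norm v" using ny[of n] s(1)[of n] by simp
        finally show "norm (q' n t - Df (\<Phi> t z) (q n t)) \<le> \<epsilon>" using \<delta>(2) by linarith
      qed
    qed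
  qed
  have cauchy: "\<exists>M. \<forall>m\<ge>M. \<forall>n\<ge>M. \<forall>t\<in>I. norm (q m t - q n t) \<le> \<epsilon>" if "\<epsilon> > 0" for \<epsilon>
  proof -
    define \<delta> where "\<delta> = \<epsilon> / (4 * \<tau> + 1)"
    have \<delta>: "\<delta> > 0" "4 * \<tau> * \<delta> \<le> \<epsilon>" using that \<tau> by (auto simp: \<delta>_def field_simps add_nonneg_pos)
    obtain M where M: "\<And>n t. n \<ge> M \<Longrightarrow> t \<in> I \<Longrightarrow> norm (q' n t - Df (\<Phi> t z) (q n t)) \<le> \<delta>"
      using approx[OF \<delta>(1)] unfolding eventually_sequentially by blast
    have "norm (q m t - q n t) \<le> \<epsilon>" if mn: "m \<ge> M" "n \<ge> M" and t: "t \<in> I" for m n t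
    proof -
      have "norm (q m t - q n t) \<le> 2 * norm (q m 0 - q n 0) + 2 * \<tau> * (2 * \<delta>)"
      proof (rule short_time_bound[where u = "\<lambda>t. q m t - q n t" and u' = "\<lambda>t. q' m t - q' n t"])
        show "((\<lambda>t. q m t - q n t) has_vector_derivative q' m t - q' n t) (at t within I)"
          if "t \<in> I" for t
          using that by (intro has_vector_derivative_diff qd)
        show "norm (q' m t - q' n t) \<le> L * norm (q m t - q n t) + 2 * \<delta>" if "t \<in> I" for t
        proof -
          have K: "\<Phi> t z \<in> K" using flow_in[OF z that] .
          have "q' m t - q' n t = (q' m t - Df (\<Phi> t z) (q m t)) - (q' n t - Df (\<Phi> t z) (q n t))
              + Df (\<Phi> t z) (q m t - q n t)"
            using linear_diff[OF lin_Df[OF K]] by simp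
          then have "norm (q' m t - q' n t) \<le> norm (q' m t - Df (\<Phi> t z) (q m t))
              + norm (q' n t - Df (\<Phi> t z) (q n t)) + norm (Df (\<Phi> t z) (q m t - q n t))"
            by (metis (no_types, lifting) norm_triangle_mono norm_triangle_ineq4 order_refl)
          then show ?thesis
            using M[OF mn(1) that] M[OF mn(2) that] boundDf[OF K, of "q m t - q n t"] by linarith
        qed
      qed (use L \<tau> L\<tau> \<delta> t in auto)
      then show ?thesis using \<delta>(2) by (simp add: q0)
    qed
    then show ?thesis by blast
  qed
  define p where "p t = lim (\<lambda>n. q n t)" for t
  have lim: "(\<lambda>n. q n t) \<longlonglongrightarrow> p t" if "t \<in> I" for t
  proof -
    have "Cauchy (\<lambda>n. q n t)"
      unfolding Cauchy_altdef2 dist_norm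
    proof (intro allI impI)
      fix e :: real assume "e > 0"
      then obtain M where M: "\<forall>m\<ge>M. \<forall>n\<ge>M. \<forall>t\<in>I. norm (q m t - q n t) \<le> e / 2"
        using cauchy[of "e / 2"] by auto
      have "norm (q n t - q M t) < e" if "n \<ge> M" for n
        using M[rule_format, OF that order_refl \<open>t \<in> I\<close>] \<open>e > 0\<close> by linarith
      then show "\<exists>N. \<forall>n\<ge>N. norm (q n t - q N t) < e" by blast
    qed
    then show ?thesis unfolding p_def by (simp add: Cauchy_convergent_iff convergent_LIMSEQ_iff)
  qed
  have unif: "\<forall>\<^sub>F n in sequentially. \<forall>t\<in>I. norm (q n t - p t) \<le> \<epsilon>" if "\<epsilon> > 0" for \<epsilon>
  proof -
    obtain M where M: "\<forall>m\<ge>M. \<forall>n\<ge>M. \<forall>t\<in>I. norm (q m t - q n t) \<le> \<epsilon>" using cauchy[OF \<open>\<epsilon> > 0\<close>] by blast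
    have "norm (q m t - p t) \<le> \<epsilon>" if "m \<ge> M" "t \<in> I" for m t
    proof (rule tendsto_upperbound)
      show "(\<lambda>n. norm (q m t - q n t)) \<longlonglongrightarrow> norm (q m t - p t)"
        by (intro tendsto_intros lim that)
      show "\<forall>\<^sub>F n in sequentially. norm (q m t - q n t) \<le> \<epsilon>"
        using M that unfolding eventually_sequentially by blast
    qed simp
    then show ?thesis unfolding eventually_sequentially by blast
  qed
  have "\<exists>g. \<forall>t\<in>I. (\<lambda>n. q n t) \<longlonglongrightarrow> g t \<and>
      (g has_derivative (\<lambda>h. h *\<^sub>R Df (\<Phi> t z) (p t))) (at t within I)"
  proof (rule has_derivative_sequence[where f' = "\<lambda>n t h. h *\<^sub>R q' n t" and ?x0.0 = 0 and l = v])
    show "(q n has_derivative (\<lambda>h. h *\<^sub>R q' n t)) (at t within I)" if "t \<in> I" for n t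
      using qd[OF that] by (simp add: has_vector_derivative_def)
    fix e :: real assume e: "e > 0"
    define \<delta> where "\<delta> = e / (2 * (L + 1))"
    have \<delta>: "\<delta> > 0" "L * \<delta> \<le> e / 2" using e L by (auto simp: \<delta>_def field_simps)
    have "\<forall>\<^sub>F n in sequentially. \<forall>t\<in>I. norm (q n t - p t) \<le> \<delta>" by (rule unif[OF \<delta>(1)])
    moreover have "\<forall>\<^sub>F n in sequentially. \<forall>t\<in>I. norm (q' n t - Df (\<Phi> t z) (q n t)) \<le> e / 2"
      using e by (intro approx) auto
    ultimately show "\<forall>\<^sub>F n in sequentially. \<forall>t\<in>I. \<forall>h.
        norm (h *\<^sub>R q' n t - h *\<^sub>R Df (\<Phi> t z) (p t)) \<le> e * norm h"
    proof eventually_elim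
      case (elim n)
      show ?case
      proof (intro ballI allI)
        fix t h assume t: "t \<in> I"
        have K: "\<Phi> t z \<in> K" using flow_in[OF z t] .
        have eq: "q' n t - Df (\<Phi> t z) (p t) = (q' n t - Df (\<Phi> t z) (q n t)) + Df (\<Phi> t z) (q n t - p t)"
          using linear_diff[OF lin_Df[OF K]] by simp
        have "norm (q' n t - Df (\<Phi> t z) (p t)) \<le> e / 2 + L * norm (q n t - p t)"
          unfolding eq using elim t boundDf[OF K]
          by (intro norm_triangle_mono) auto
        also have "\<dots> \<le> e / 2 + L * \<delta>" using elim t L by (intro add_left_mono mult_left_mono) auto
        finally have "norm (q' n t - Df (\<Phi> t z) (p t)) \<le> e" using \<delta>(2) by linarith
        then show "norm (h *\<^sub>R q' n t - h *\<^sub>R Df (\<Phi> t z) (p t)) \<le> e * norm h"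
          using mult_right_mono[OF _ abs_ge_zero[of h]]
          by (simp add: scaleR_diff_right[symmetric] mult.commute[of "\<bar>h\<bar>"])
      qed
    qed
  qed (use q0 \<tau> in auto)
  then obtain g where g: "\<And>t. t \<in> I \<Longrightarrow> (\<lambda>n. q n t) \<longlonglongrightarrow> g t"
      "\<And>t. t \<in> I \<Longrightarrow> (g has_derivative (\<lambda>h. h *\<^sub>R Df (\<Phi> t z) (p t))) (at t within I)" by blast
  have gp: "g t = p t" if "t \<in> I" for t using LIMSEQ_unique[OF g(1) lim] that by blast
  have "(\<lambda>n. v) \<longlonglongrightarrow> g 0" using g(1)[of 0] \<tau> by (simp add: q0)
  then have "g 0 = v" using LIMSEQ_unique[OF _ tendsto_const] by blast
  then have "variational z v g"
    using g(2) gp by (auto simp: variational_def has_vector_derivative_def)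
  then show ?thesis by blast
qed

definition D :: "real \<Rightarrow> 'e \<Rightarrow> 'e \<Rightarrow> 'e" where
  "D t z v = (SOME q. variational z v q) t"

lemma variational_D: "z \<in> U \<Longrightarrow> variational z v (\<lambda>t. D t z v)"
  unfolding D_def using someI_ex[OF variational_exists] by simp

lemma variational_eq_D:
  "z \<in> U \<Longrightarrow> variational z v q \<Longrightarrow> t \<in> I \<Longrightarrow> q t = D t z v"
  by (rule variational_unique[OF _ variational_D])

lemma linear_D:
  assumes "z \<in> U" "t \<in> I"
  shows "linear (D t z)"
proof
  have lin: "linear (Df (\<Phi> t z))" if "t \<in> I" for t using lin_Df flow_in assms that by blast
  fix v w and a :: real
  have "variational z (v + w) (\<lambda>t. D t z v + D t z w)"
    using variational_D[OF assms(1), of v] variational_D[OF assms(1), of w]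
    by (auto simp: variational_def linear_add[OF lin] intro: has_vector_derivative_add)
  then show "D t z (v + w) = D t z v + D t z w"
    using variational_eq_D assms by metis
  have "variational z (a *\<^sub>R v) (\<lambda>t. a *\<^sub>R D t z v)"
    using variational_D[OF assms(1), of v]
    by (auto simp: variational_def linear_cmul[OF lin]
        intro: bounded_linear.has_vector_derivative[OF bounded_linear_scaleR_right])
  then show "D t z (a *\<^sub>R v) = a *\<^sub>R D t z v"
    using variational_eq_D assms by metis
qed

lemma D_bound:
  assumes "z \<in> U" "t \<in> I"
  shows "norm (D t z v) \<le> 2 * norm v"
proof -
  have "norm (D t z v) \<le> 2 * norm (D 0 z v) + 2 * \<tau> * 0"
  proof (rule short_time_bound[where u' = "\<lambda>t. Df (\<Phi> t z) (D t z v)"])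
    show "((\<lambda>t. D t z v) has_vector_derivative Df (\<Phi> t z) (D t z v)) (at t within I)"
      if "t \<in> I" for t
      using variational_D[OF assms(1)] that by (simp add: variational_def)
    show "norm (Df (\<Phi> t z) (D t z v)) \<le> L * norm (D t z v) + 0" if "t \<in> I" for t
      using boundDf[OF flow_in[OF assms(1) that]] by simp
  qed (use L \<tau> L\<tau> assms in auto)
  then show ?thesis using variational_D[OF assms(1)] by (simp add: variational_def)
qed

text \<open>The difference of two orbits and \<open>D t z (y - z)\<close> are an approximate and an exact solution with
  the same initial value, and the error is small compared with \<open>y - z\<close>.\<close>

lemma flow_has_derivative:
  assumes z: "z \<in> U" and t: "t \<in> I"
  shows "(\<Phi> t has_derivative D t z) (at z)"
  unfolding has_derivative_at_alt
proof (intro conjI allI impI)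
  show "bounded_linear (D t z)" using linear_D[OF z t] by (simp add: linear_conv_bounded_linear)
  fix e :: real assume e: "e > 0"
  define \<delta> where "\<delta> = e / (2 * \<tau> + 1)"
  have \<delta>: "\<delta> > 0" "2 * \<tau> * \<delta> \<le> e" using e \<tau> by (auto simp: \<delta>_def field_simps add_nonneg_pos)
  obtain \<eta> where \<eta>: "\<eta> > 0" "\<And>y t. y \<in> U \<Longrightarrow> t \<in> I \<Longrightarrow> norm (y - z) < \<eta> \<Longrightarrow>
     norm (f (\<Phi> t y) - f (\<Phi> t z) - Df (\<Phi> t z) (\<Phi> t y - \<Phi> t z)) \<le> \<delta> * norm (y - z)"
    using flow_difference_linearized[OF \<delta>(1)] z by blast
  obtain \<rho> where \<rho>: "\<rho> > 0" "ball z \<rho> \<subseteq> U" using openU z openE by blast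
  have "norm (\<Phi> t y - \<Phi> t z - D t z (y - z)) \<le> e * norm (y - z)"
    if y: "norm (y - z) < min \<eta> \<rho>" for y
  proof -
    have yU: "y \<in> U" using y \<rho>(2) by (auto simp: subset_iff dist_norm norm_minus_commute)
    have "norm ((\<Phi> t y - \<Phi> t z) - D t z (y - z))
        \<le> 2 * norm ((\<Phi> 0 y - \<Phi> 0 z) - (y - z)) + 2 * \<tau> * (\<delta> * norm (y - z))"
    proof (rule variational_estimate[OF z variational_D[OF z]])
      show "((\<lambda>t. \<Phi> t y - \<Phi> t z) has_vector_derivative f (\<Phi> t y) - f (\<Phi> t z)) (at t within I)"
        if "t \<in> I" for t
        using that yU z by (intro has_vector_derivative_diff flow_der)
    qed (use \<delta> \<eta> y yU t in auto)
    also have "\<dots> = (2 * \<tau> * \<delta>) * norm (y - z)" using yU z by (simp add: flow_0)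
    also have "\<dots> \<le> e * norm (y - z)" using \<delta>(2) by (intro mult_right_mono) auto
    finally show ?thesis .
  qed
  then show "\<exists>d>0. \<forall>y. norm (y - z) < d \<longrightarrow>
      norm (\<Phi> t y - \<Phi> t z - D t z (y - z)) \<le> e * norm (y - z)"
    using \<eta>(1) \<rho>(1) by (intro exI[of _ "min \<eta> \<rho>"]) auto
qed

text \<open>A solution along the orbit of \<open>y\<close> is an approximate solution along the orbit of a nearby \<open>z\<close>.\<close>

lemma continuous_on_D:
  assumes t: "t \<in> I"
  shows "continuous_on U (\<lambda>z. D t z v)"
  unfolding continuous_on_iff dist_norm
proof (intro ballI allI impI)
  fix z and e :: real assume z: "z \<in> U" and e: "e > 0"
  define \<delta> where "\<delta> = e / (2 * (2 * \<tau> * (2 * norm v) + 1))"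
  have den: "2 * \<tau> * (2 * norm v) + 1 > 0" using \<tau> by (simp add: add_nonneg_pos)
  have \<delta>: "\<delta> > 0" using e den by (simp add: \<delta>_def)
  have "2 * \<tau> * (\<delta> * (2 * norm v)) \<le> \<delta> * (2 * \<tau> * (2 * norm v) + 1)"
    using \<delta> by (simp add: algebra_simps)
  also have "\<dots> = e / 2" using den by (simp only: \<delta>_def) (simp add: divide_simps)
  finally have \<delta>2: "2 * \<tau> * (\<delta> * (2 * norm v)) < e" using e by linarith
  obtain \<eta> where \<eta>: "\<eta> > 0"
    "\<And>y z v. y \<in> K \<Longrightarrow> z \<in> K \<Longrightarrow> norm (y - z) < \<eta> \<Longrightarrow> norm (Df y v - Df z v) \<le> \<delta> * norm v"
    using Df_uniformly_continuous[OF \<delta>] by blast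
  have "norm (D t y v - D t z v) < e" if y: "y \<in> U" "norm (y - z) < \<eta> / 2" for y
  proof -
    have "norm (D t y v - D t z v) \<le> 2 * norm (D 0 y v - v) + 2 * \<tau> * (\<delta> * (2 * norm v))"
    proof (rule variational_estimate[OF z variational_D[OF z]])
      show "((\<lambda>t. D t y v) has_vector_derivative Df (\<Phi> t y) (D t y v)) (at t within I)"
        if "t \<in> I" for t
        using variational_D[OF y(1), of v] that by (simp add: variational_def)
      show "norm (Df (\<Phi> t y) (D t y v) - Df (\<Phi> t z) (D t y v)) \<le> \<delta> * (2 * norm v)" if "t \<in> I" for t
      proof -
        have "norm (\<Phi> t y - \<Phi> t z) < \<eta>" using flow_Lipschitz[OF y(1) z that] y(2) by linarith
        then have "norm (Df (\<Phi> t y) (D t y v) - Df (\<Phi> t z) (D t y v)) \<le> \<delta> * norm (D t y v)"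
          using flow_in y(1) z that by (intro \<eta>(2)) auto
        also have "\<dots> \<le> \<delta> * (2 * norm v)"
          using D_bound[OF y(1) that, of v] \<delta> by (intro mult_left_mono) auto
        finally show ?thesis .
      qed
    qed (use \<delta> t in auto)
    also have "D 0 y v = v" using variational_D[OF y(1)] by (simp add: variational_def)
    finally show ?thesis using \<delta>2 by simp
  qed
  then show "\<exists>d>0. \<forall>y\<in>U. norm (y - z) < d \<longrightarrow> norm (D t y v - D t z v) < e"
    using \<eta>(1) by (intro exI[of _ "\<eta> / 2"]) auto
qed

lemma frechet_flow: "z \<in> U \<Longrightarrow> t \<in> I \<Longrightarrow> frechet_derivative (\<Phi> t) (at z) = D t z"
  using frechet_derivative_at[OF flow_has_derivative] by simp

lemma C1_on_flow:
  assumes "t \<in> I"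
  shows "C1_on U (\<Phi> t)"
  unfolding C1_on_def
proof (intro conjI ballI allI)
  show "\<Phi> t differentiable at z" if "z \<in> U" for z
    using flow_has_derivative[OF that assms] by (rule differentiableI)
  show "continuous_on U (\<lambda>z. frechet_derivative (\<Phi> t) (at z) v)" for v
    by (rule continuous_on_eq[OF continuous_on_D[OF assms]]) (simp add: frechet_flow[OF _ assms])
qed

text \<open>A vector field \<open>h\<close> with \<open>Dh(f) = Df(h)\<close> solves the variational equation along every orbit, and
  solutions are unique.\<close>

lemma frechet_flow_commuting:
  assumes z: "z \<in> U" and t: "t \<in> I"
    and h: "\<And>y. y \<in> K \<Longrightarrow> (h has_derivative Dh y) (at y)"
    and comm: "\<And>y. y \<in> K \<Longrightarrow> Dh y (f y) = Df y (h y)"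
  shows "frechet_derivative (\<Phi> t) (at z) (h z) = h (\<Phi> t z)"
proof -
  have "variational z (h z) (\<lambda>t. h (\<Phi> t z))"
    unfolding variational_def
  proof (intro conjI ballI)
    show "h (\<Phi> 0 z) = h z" by (simp add: flow_0 z)
    fix t assume t: "t \<in> I"
    have K: "\<Phi> t z \<in> K" using flow_in[OF z t] .
    have "((\<lambda>t. h (\<Phi> t z)) has_vector_derivative Dh (\<Phi> t z) (f (\<Phi> t z))) (at t within I)"
      using vector_derivative_diff_chain_within[OF flow_der[OF z t]
          has_derivative_at_withinI[OF h[OF K]]] by (simp add: o_def)
    then show "((\<lambda>t. h (\<Phi> t z)) has_vector_derivative Df (\<Phi> t z) (h (\<Phi> t z))) (at t within I)"
      using comm[OF K] by simp
  qed
  then show ?thesis using variational_eq_D[OF z _ t] frechet_flow[OF z t] by metis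
qed

end

section \<open>Charts, tangent vectors and maps of class \<open>C\<^sup>1\<close>\<close>

lemma scaleR_fun_apply: "(r *\<^sub>R u) c = r *\<^sub>R u c"
  by (simp add: scaleR_fun_def)

locale manifold =
  fixes A :: "('a::t2_space, 'e::euclidean_space) chart set"
  assumes atlas: "smooth_atlas A"
begin

lemma chart_exists: obtains c where "c \<in> A" "p \<in> fst c"
  using atlas unfolding smooth_atlas_def by blast

context
  fixes c assumes c: "c \<in> A"
begin

lemma open_domain: "open (fst c)" and open_chart_image: "open (chart_image c)"
  and chart_homeomorphism: "homeomorphism (fst c) (chart_image c) (snd c) (chart_inv c)"
  using atlas c unfolding smooth_atlas_def by auto

lemma chart_inv_chart: "p \<in> fst c \<Longrightarrow> chart_inv c (snd c p) = p"
  and chart_chart_inv: "z \<in> chart_image c \<Longrightarrow> snd c (chart_inv c z) = z"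
  and chart_inv_in: "z \<in> chart_image c \<Longrightarrow> chart_inv c z \<in> fst c"
  and chart_in: "p \<in> fst c \<Longrightarrow> snd c p \<in> chart_image c"
  and continuous_chart: "continuous_on (fst c) (snd c)"
  and continuous_chart_inv: "continuous_on (chart_image c) (chart_inv c)"
  using chart_homeomorphism unfolding homeomorphism_def by auto

lemma open_image_chart:
  assumes "open V" "V \<subseteq> fst c"
  shows "open (snd c ` V)"
proof -
  have "snd c ` V = chart_image c \<inter> chart_inv c -` V"
    using assms(2) chart_in chart_inv_chart chart_chart_inv by (force simp: image_iff)
  then show ?thesis
    using continuous_open_preimage[OF continuous_chart_inv open_chart_image assms(1)] by simp
qed

end

subsection \<open>Maps that are \<open>C\<^sup>1\<close> in a given pair of charts\<close>

text \<open>A coordinate expression of a map makes sense only where the map stays inside the second chart, so the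
  two charts and the domain are part of the notion.\<close>

definition C1_near :: "('a, 'e) chart \<Rightarrow> ('a, 'e) chart \<Rightarrow> 'a set \<Rightarrow> ('a \<Rightarrow> 'a) \<Rightarrow> bool" where
  "C1_near c d V F \<longleftrightarrow> c \<in> A \<and> d \<in> A \<and> open V \<and> V \<subseteq> fst c \<and> F ` V \<subseteq> fst d \<and>
     C1_on (snd c ` V) (snd d \<circ> F \<circ> chart_inv c)"

lemma C1_near_continuous:
  assumes "C1_near c d V F"
  shows "continuous_on V F"
proof -
  have cd: "c \<in> A" "d \<in> A" "V \<subseteq> fst c" "F ` V \<subseteq> fst d"
    "C1_on (snd c ` V) (snd d \<circ> F \<circ> chart_inv c)"
    using assms by (auto simp: C1_near_def)
  let ?f = "snd d \<circ> F \<circ> chart_inv c"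
  have "continuous_on V (snd c)" using continuous_chart[OF cd(1)] cd(3) continuous_on_subset by blast
  then have 1: "continuous_on V (?f \<circ> snd c)"
    by (rule continuous_on_compose[OF _ C1_on_continuous[OF cd(5)]])
  have "(?f \<circ> snd c) ` V \<subseteq> chart_image d"
    using cd chart_inv_chart[OF cd(1)] chart_in[OF cd(2)] by force
  then have "continuous_on V (chart_inv d \<circ> (?f \<circ> snd c))"
    by (intro continuous_on_compose[OF 1] continuous_on_subset[OF continuous_chart_inv[OF cd(2)]])
  then show ?thesis
    by (rule continuous_on_eq) (use cd chart_inv_chart in \<open>auto simp: subset_iff\<close>)
qed

text \<open>The chain rule. With the identity map as one of the two factors it also describes changes of charts.\<close>

lemma C1_near_compose:
  assumes F: "C1_near c d V F" and G: "C1_near d e W G"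
  shows "C1_near c e (V \<inter> F -` W) (G \<circ> F)"
    and "p \<in> V \<Longrightarrow> F p \<in> W \<Longrightarrow>
      frechet_derivative (snd e \<circ> (G \<circ> F) \<circ> chart_inv c) (at (snd c p)) v =
      frechet_derivative (snd e \<circ> G \<circ> chart_inv d) (at (snd d (F p)))
        (frechet_derivative (snd d \<circ> F \<circ> chart_inv c) (at (snd c p)) v)"
proof -
  let ?S = "V \<inter> F -` W" and ?f = "snd d \<circ> F \<circ> chart_inv c" and ?g = "snd e \<circ> G \<circ> chart_inv d"
  have F': "c \<in> A" "d \<in> A" "open V" "V \<subseteq> fst c" "F ` V \<subseteq> fst d" "C1_on (snd c ` V) ?f"
    and G': "e \<in> A" "open W" "W \<subseteq> fst d" "G ` W \<subseteq> fst e" "C1_on (snd d ` W) ?g"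
    using F G by (auto simp: C1_near_def)
  have opS: "open ?S"
    using continuous_open_preimage[OF C1_near_continuous[OF F] F'(3) G'(2)] .
  have op: "open (snd c ` ?S)"
    using F'(4) by (intro open_image_chart[OF F'(1) opS]) auto
  have f: "C1_on (snd c ` ?S) ?f" by (rule C1_on_subset[OF F'(6)]) auto
  have im: "?f ` (snd c ` ?S) \<subseteq> snd d ` W"
    using F'(4) chart_inv_chart[OF F'(1)] by (auto simp: subset_iff)
  have eq: "(?g \<circ> ?f) z = (snd e \<circ> (G \<circ> F) \<circ> chart_inv c) z" if "z \<in> snd c ` ?S" for z
    using that F' chart_inv_chart[OF F'(1)] chart_inv_chart[OF F'(2)] by (auto simp: subset_iff)
  note gf = C1_on_compose[OF f G'(5) im]
  show "C1_near c e ?S (G \<circ> F)"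
    unfolding C1_near_def
    using F' G' opS by (intro conjI C1_on_cong(1)[OF op gf(1) eq]) auto
  show "frechet_derivative (snd e \<circ> (G \<circ> F) \<circ> chart_inv c) (at (snd c p)) v =
      frechet_derivative ?g (at (snd d (F p))) (frechet_derivative ?f (at (snd c p)) v)"
    if p: "p \<in> V" "F p \<in> W"
  proof -
    from p have pz: "snd c p \<in> snd c ` ?S" by auto
    have "?f (snd c p) = snd d (F p)" using p F'(4) chart_inv_chart[OF F'(1)] by auto
    then show ?thesis
      using C1_on_cong(2)[OF op gf(1) eq pz] gf(2)[OF pz, of v] by metis
  qed
qed

lemma C1_near_id:
  assumes "c \<in> A" "d \<in> A"
  shows "C1_near c d (fst c \<inter> fst d) id"
proof -
  have "C1_on (snd c ` (fst c \<inter> fst d)) (snd d \<circ> chart_inv c)"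
    using atlas assms unfolding smooth_atlas_def smooth_on_def by (blast intro: Ck_on_imp_C1_on[of 1])
  moreover have "open (fst c \<inter> fst d)" using assms open_domain by blast
  ultimately show ?thesis using assms by (auto simp: C1_near_def)
qed

text \<open>Near \<open>snd c p\<close> the map agrees with the identity.\<close>

lemma frechet_chart_self:
  assumes "c \<in> A" "p \<in> fst c"
  shows "frechet_derivative (snd c \<circ> chart_inv c) (at (snd c p)) v = v"
proof -
  have "((\<lambda>z. z) has_derivative (\<lambda>v. v)) (at (snd c p))" by (rule has_derivative_ident)
  then have "((snd c \<circ> chart_inv c) has_derivative (\<lambda>v. v)) (at (snd c p))"
    by (rule has_derivative_transform_within_open[OF _ open_chart_image[OF assms(1)]])
       (use assms chart_in chart_chart_inv in auto)
  then show ?thesis using frechet_derivative_at by metis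
qed

subsection \<open>Tangent vectors in coordinates\<close>

abbreviation "T \<equiv> tangent_space A"

abbreviation "lift \<equiv> tangent_of_coord A"

lemma tangent_change_chart:
  assumes "w \<in> T p" "c \<in> A" "d \<in> A" "p \<in> fst c" "p \<in> fst d"
  shows "w d = frechet_derivative (snd d \<circ> chart_inv c) (at (snd c p)) (w c)"
  using assms unfolding tangent_space_def by blast

lemma tangent_spaceI:
  assumes "\<And>c d. c \<in> A \<Longrightarrow> d \<in> A \<Longrightarrow> p \<in> fst c \<Longrightarrow> p \<in> fst d \<Longrightarrow>
      w d = frechet_derivative (snd d \<circ> chart_inv c) (at (snd c p)) (w c)"
    and "\<And>c. c \<notin> A \<or> p \<notin> fst c \<Longrightarrow> w c = 0"
  shows "w \<in> T p"
  using assms unfolding tangent_space_def by blast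

lemma tangent_zero: "w \<in> T p \<Longrightarrow> c \<notin> A \<or> p \<notin> fst c \<Longrightarrow> w c = 0"
  unfolding tangent_space_def by blast

lemma linear_transition:
  assumes "c \<in> A" "d \<in> A" "p \<in> fst c" "p \<in> fst d"
  shows "linear (frechet_derivative (snd d \<circ> chart_inv c) (at (snd c p)))"
  using C1_onD(2)[of "snd c ` (fst c \<inter> fst d)" "snd d \<circ> id \<circ> chart_inv c"] C1_near_id[OF assms(1,2)] assms
  by (auto simp: C1_near_def)

lemma subspace_T: "subspace (T p)"
  unfolding subspace_def
proof (intro conjI ballI allI)
  show "0 \<in> T p" by (rule tangent_spaceI) (simp_all add: linear_0[OF linear_transition])
  show "u + v \<in> T p" if "u \<in> T p" "v \<in> T p" for u v
  proof (rule tangent_spaceI)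
    fix c d assume cd: "c \<in> A" "d \<in> A" "p \<in> fst c" "p \<in> fst d"
    show "(u + v) d = frechet_derivative (snd d \<circ> chart_inv c) (at (snd c p)) ((u + v) c)"
      unfolding plus_fun_apply linear_add[OF linear_transition[OF cd]]
      using tangent_change_chart[OF _ cd] that by metis
  qed (simp add: tangent_zero[OF that(1)] tangent_zero[OF that(2)])
  show "r *\<^sub>R u \<in> T p" if "u \<in> T p" for u r
  proof (rule tangent_spaceI)
    fix c d assume cd: "c \<in> A" "d \<in> A" "p \<in> fst c" "p \<in> fst d"
    show "(r *\<^sub>R u) d = frechet_derivative (snd d \<circ> chart_inv c) (at (snd c p)) ((r *\<^sub>R u) c)"
      unfolding scaleR_fun_apply linear_cmul[OF linear_transition[OF cd]]
      using tangent_change_chart[OF that cd] by metis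
  qed (simp add: tangent_zero[OF that] scaleR_fun_apply)
qed

text \<open>The coordinate vector in one chart determines those in all others.\<close>

lemma tangent_eqI:
  assumes "u \<in> T p" "v \<in> T p" "c \<in> A" "p \<in> fst c" "u c = v c"
  shows "u = v"
proof
  fix d
  show "u d = v d"
  proof (cases "d \<in> A \<and> p \<in> fst d")
    case True
    then show ?thesis using tangent_change_chart[OF _ assms(3)] assms by metis
  next
    case False
    then show ?thesis using assms tangent_zero by metis
  qed
qed

context
  fixes c p assumes c: "c \<in> A" "p \<in> fst c"
begin

lemma lift_in: "lift c p e \<in> T p"
proof (rule tangent_spaceI)
  fix d d' assume d: "d \<in> A" "d' \<in> A" "p \<in> fst d" "p \<in> fst d'"
  show "lift c p e d' = frechet_derivative (snd d' \<circ> chart_inv d) (at (snd d p)) (lift c p e d)"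
    using C1_near_compose(2)[OF C1_near_id[OF c(1) d(1)] C1_near_id[OF d(1,2)], of p e] c d
    by (simp add: tangent_of_coord_def)
qed (auto simp: tangent_of_coord_def)

lemma lift_same: "lift c p e c = e"
  using c by (simp add: tangent_of_coord_def frechet_chart_self)

lemma lift_of: "w \<in> T p \<Longrightarrow> lift c p (w c) = w"
  by (rule tangent_eqI[OF lift_in _ c]) (simp_all add: lift_same)

lemma lift_add: "lift c p (x + y) = lift c p x + lift c p y"
  by (rule tangent_eqI[OF lift_in subspace_add[OF subspace_T lift_in lift_in] c])
     (simp add: lift_same)

lemma lift_scale: "lift c p (r *\<^sub>R x) = r *\<^sub>R lift c p x"
  by (rule tangent_eqI[OF lift_in subspace_scale[OF subspace_T lift_in] c])
     (simp add: lift_same scaleR_fun_apply)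

end

text \<open>The differential is defined through a selected chart at \<open>p\<close>; by the chain rule any other chart at
  \<open>p\<close> gives the same vector.\<close>

lemma tangent_map_coord:
  assumes F: "C1_near c d V F" and p: "p \<in> V" and w: "w \<in> T p"
  shows "tangent_map A F p w d = frechet_derivative (snd d \<circ> F \<circ> chart_inv c) (at (snd c p)) (w c)"
proof -
  define c0 where "c0 = (SOME c. c \<in> A \<and> p \<in> fst c)"
  have "\<exists>c. c \<in> A \<and> p \<in> fst c" using chart_exists by metis
  from someI_ex[OF this] have c0: "c0 \<in> A" "p \<in> fst c0" by (simp_all add: c0_def)
  have F': "c \<in> A" "d \<in> A" "p \<in> fst c" "F p \<in> fst d" using F p by (auto simp: C1_near_def)
  have "tangent_map A F p w d = frechet_derivative (snd d \<circ> F \<circ> chart_inv c0) (at (snd c0 p)) (w c0)"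
    using F' by (simp add: tangent_map_def c0_def[symmetric])
  also have "\<dots> = frechet_derivative (snd d \<circ> F \<circ> chart_inv c) (at (snd c p))
      (frechet_derivative (snd c \<circ> chart_inv c0) (at (snd c0 p)) (w c0))"
    using C1_near_compose(2)[OF C1_near_id[OF c0(1) F'(1)] F, of p "w c0"] c0 F' p by simp
  also have "frechet_derivative (snd c \<circ> chart_inv c0) (at (snd c0 p)) (w c0) = w c"
    using tangent_change_chart[OF w c0(1) F'(1) c0(2) F'(3)] by simp
  finally show ?thesis .
qed

lemma tangent_map_zero: "d \<notin> A \<or> F p \<notin> fst d \<Longrightarrow> tangent_map A F p w d = 0"
  by (auto simp: tangent_map_def Let_def)

subsection \<open>Maps of class \<open>C\<^sup>1\<close> on the manifold\<close>

definition C1_map :: "('a \<Rightarrow> 'a) \<Rightarrow> bool" where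
  "C1_map F \<longleftrightarrow> (\<forall>p. \<exists>c d V. p \<in> V \<and> C1_near c d V F)"

lemma C1_map_near:
  assumes F: "C1_map F" and c: "c \<in> A" "p \<in> fst c" and d: "d \<in> A" "F p \<in> fst d"
  obtains V where "p \<in> V" "C1_near c d V F"
proof -
  obtain c' d' V where V: "p \<in> V" "C1_near c' d' V F" using F by (metis C1_map_def)
  then have c'd': "c' \<in> A" "d' \<in> A" "p \<in> fst c'" "F p \<in> fst d'" by (auto simp: C1_near_def)
  note 1 = C1_near_compose(1)[OF C1_near_id[OF c(1) c'd'(1)] V(2)]
  note 2 = C1_near_compose(1)[OF 1 C1_near_id[OF c'd'(2) d(1)]]
  show ?thesis
    by (rule that[OF _ 2[simplified]]) (use V c d c'd' in auto)
qed

lemma C1_map_continuous: "C1_map F \<Longrightarrow> continuous_on UNIV F"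
proof -
  assume F: "C1_map F"
  have "continuous (at p) F" for p
  proof -
    obtain c d V where "p \<in> V" "C1_near c d V F" using F by (metis C1_map_def)
    then show ?thesis
      using C1_near_continuous continuous_on_eq_continuous_at by (metis C1_near_def)
  qed
  then show ?thesis by (simp add: continuous_on_eq_continuous_within)
qed

lemma C1_map_id: "C1_map id"
  unfolding C1_map_def
proof
  fix p obtain c where c: "c \<in> A" "p \<in> fst c" by (rule chart_exists)
  have "p \<in> fst c \<inter> fst c \<and> C1_near c c (fst c \<inter> fst c) id" using c C1_near_id by blast
  then show "\<exists>c d V. p \<in> V \<and> C1_near c d V id" by blast
qed

lemma C1_map_compose:
  assumes F: "C1_map F" and G: "C1_map G"
  shows "C1_map (G \<circ> F)"
  unfolding C1_map_def
proof
  fix p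
  obtain c d V where V: "p \<in> V" "C1_near c d V F" using F by (metis C1_map_def)
  then have d: "d \<in> A" "F p \<in> fst d" by (auto simp: C1_near_def)
  obtain e where e: "e \<in> A" "G (F p) \<in> fst e" by (rule chart_exists)
  obtain W where W: "F p \<in> W" "C1_near d e W G" using C1_map_near[OF G d e] .
  have p: "p \<in> V \<inter> F -` W" using V W by auto
  show "\<exists>c d V. p \<in> V \<and> C1_near c d V (G \<circ> F)"
    by (intro exI conjI) (rule p, rule C1_near_compose(1)[OF V(2) W(2)])
qed

lemma tangent_map_id: "w \<in> T p \<Longrightarrow> tangent_map A id p w = w"
proof
  fix d assume w: "w \<in> T p"
  show "tangent_map A id p w d = w d"
  proof (cases "d \<in> A \<and> p \<in> fst d")
    case True
    then show ?thesis
      using tangent_map_coord[OF C1_near_id[of d d] _ w] frechet_chart_self[of d p] by simp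
  next
    case False
    then show ?thesis using tangent_zero[OF w] tangent_map_zero[of d id p] by auto
  qed
qed

lemma tangent_map_compose:
  assumes F: "C1_map F" and G: "C1_map G" and w: "w \<in> T p"
  shows "tangent_map A (G \<circ> F) p w = tangent_map A G (F p) (tangent_map A F p w)"
    and "tangent_map A F p w \<in> T (F p)"
proof -
  obtain c where c: "c \<in> A" "p \<in> fst c" by (rule chart_exists)
  have in_T: "tangent_map A F p w \<in> T (F p)" if F: "C1_map F" and w: "w \<in> T p" for F p w
  proof (rule tangent_spaceI)
    fix d assume "d \<notin> A \<or> F p \<notin> fst d"
    then show "tangent_map A F p w d = 0" by (rule tangent_map_zero)
  next
    fix d e assume d: "d \<in> A" and e: "e \<in> A" and Fp: "F p \<in> fst d" "F p \<in> fst e"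
    obtain c where c: "c \<in> A" "p \<in> fst c" by (rule chart_exists)
    obtain V where V: "p \<in> V" "C1_near c d V F" using C1_map_near[OF F c d] Fp by auto
    note de = C1_near_compose[OF V(2) C1_near_id[OF d e]]
    have "tangent_map A F p w e = frechet_derivative (snd e \<circ> F \<circ> chart_inv c) (at (snd c p)) (w c)"
      using tangent_map_coord[OF de(1) _ w] V Fp by simp
    also have "\<dots> = frechet_derivative (snd e \<circ> chart_inv d) (at (snd d (F p)))
        (frechet_derivative (snd d \<circ> F \<circ> chart_inv c) (at (snd c p)) (w c))"
      using de(2)[of p "w c"] V Fp by simp
    also have "frechet_derivative (snd d \<circ> F \<circ> chart_inv c) (at (snd c p)) (w c) = tangent_map A F p w d"
      using tangent_map_coord[OF V(2,1) w] by simp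
    finally show "tangent_map A F p w e
        = frechet_derivative (snd e \<circ> chart_inv d) (at (snd d (F p))) (tangent_map A F p w d)" .
  qed
  show Fw: "tangent_map A F p w \<in> T (F p)" using in_T[OF F w] .
  show "tangent_map A (G \<circ> F) p w = tangent_map A G (F p) (tangent_map A F p w)"
  proof
    fix e
    show "tangent_map A (G \<circ> F) p w e = tangent_map A G (F p) (tangent_map A F p w) e"
    proof (cases "e \<in> A \<and> G (F p) \<in> fst e")
      case False then show ?thesis using tangent_map_zero[of e] by (metis comp_apply)
    next
      case True
      obtain d where d: "d \<in> A" "F p \<in> fst d" by (rule chart_exists)
      obtain V where V: "p \<in> V" "C1_near c d V F" using C1_map_near[OF F c d] .
      obtain W where W: "F p \<in> W" "C1_near d e W G" using C1_map_near[OF G d, of e] True by auto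
      note GF = C1_near_compose[OF V(2) W(2)]
      show ?thesis
        using tangent_map_coord[OF GF(1) _ w] GF(2)[of p "w c"] V W
          tangent_map_coord[OF W(2,1) Fw] tangent_map_coord[OF V(2,1) w] by simp
    qed
  qed
qed

lemma tangent_map_linear:
  assumes F: "C1_map F" and u: "u \<in> T p" and v: "v \<in> T p"
  shows "tangent_map A F p (u + v) = tangent_map A F p u + tangent_map A F p v"
    and "tangent_map A F p (r *\<^sub>R u) = r *\<^sub>R tangent_map A F p u"
proof -
  have uv: "u + v \<in> T p" "r *\<^sub>R u \<in> T p"
    using subspace_T u v by (auto intro: subspace_add subspace_scale)
  obtain c where c: "c \<in> A" "p \<in> fst c" by (rule chart_exists)
  obtain d where d: "d \<in> A" "F p \<in> fst d" by (rule chart_exists)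
  obtain V where V: "p \<in> V" "C1_near c d V F" using C1_map_near[OF F c d] .
  have lin: "linear (frechet_derivative (snd d \<circ> F \<circ> chart_inv c) (at (snd c p)))"
    using V C1_onD(2) unfolding C1_near_def by blast
  note in_T = tangent_map_compose(2)[OF F C1_map_id]
  note coord = tangent_map_coord[OF V(2,1)]
  show "tangent_map A F p (u + v) = tangent_map A F p u + tangent_map A F p v"
    by (rule tangent_eqI[OF in_T[OF uv(1)] subspace_add[OF subspace_T in_T[OF u] in_T[OF v]] d])
       (simp add: coord u v uv linear_add[OF lin])
  show "tangent_map A F p (r *\<^sub>R u) = r *\<^sub>R tangent_map A F p u"
    by (rule tangent_eqI[OF in_T[OF uv(2)] subspace_scale[OF subspace_T in_T[OF u]] d])
       (simp add: coord u uv linear_cmul[OF lin] scaleR_fun_apply)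
qed

lemma continuous_on_charts:
  fixes h :: "'a \<Rightarrow> 'b::topological_space"
  assumes "\<And>c. c \<in> A \<Longrightarrow> continuous_on (chart_image c) (\<lambda>z. h (chart_inv c z))"
  shows "continuous_on UNIV h"
proof -
  have "continuous_on (fst c) h" if c: "c \<in> A" for c
  proof -
    have "continuous_on (fst c) (\<lambda>x. h (chart_inv c (snd c x)))"
      by (rule continuous_on_compose2[OF assms[OF c] continuous_chart[OF c]]) (auto intro: chart_in c)
    then show ?thesis by (rule continuous_on_eq) (simp add: chart_inv_chart c)
  qed
  then have "continuous_on (\<Union>c\<in>A. fst c) h"
    by (intro continuous_on_open_UN) (auto intro: open_domain)
  then show ?thesis using atlas by (simp add: smooth_atlas_def)
qed

lemma coord_fieldD:
  assumes "Y \<in> vector_fields A k" "k \<ge> 1"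
  shows "Y p \<in> T p" "c \<in> A \<Longrightarrow> C1_on (chart_image c) (coord_field Y c)"
proof -
  have Y: "\<And>p. Y p \<in> T p" "\<And>c. c \<in> A \<Longrightarrow> Ck_on k (chart_image c) (coord_field Y c)"
    using assms(1) by (auto simp: vector_fields_def)
  show "Y p \<in> T p" by (rule Y)
  show "c \<in> A \<Longrightarrow> C1_on (chart_image c) (coord_field Y c)"
    by (rule Ck_on_imp_C1_on[OF assms(2) Y(2)])
qed

end

section \<open>The Riemannian metric in coordinates\<close>

locale riemannian_manifold = manifold A
  for A :: "('a::t2_space, 'e::euclidean_space) chart set" +
  fixes g :: "'a \<Rightarrow> ('a, 'e) tangent \<Rightarrow> ('a, 'e) tangent \<Rightarrow> real"
  assumes metric: "riemannian_metric A g"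
begin

lemma g_sym: "u \<in> T p \<Longrightarrow> v \<in> T p \<Longrightarrow> g p u v = g p v u"
  and g_pos: "u \<in> T p \<Longrightarrow> u \<noteq> 0 \<Longrightarrow> g p u u > 0"
  and g_lin: "u \<in> T p \<Longrightarrow> v \<in> T p \<Longrightarrow> w \<in> T p \<Longrightarrow>
     g p (a *\<^sub>R u + b *\<^sub>R v) w = a * g p u w + b * g p v w"
  using metric unfolding riemannian_metric_def by auto

lemma g_add: "u \<in> T p \<Longrightarrow> v \<in> T p \<Longrightarrow> w \<in> T p \<Longrightarrow> g p (u + v) w = g p u w + g p v w"
  using g_lin[of u p v w 1 1] by simp

lemma g_scale: "u \<in> T p \<Longrightarrow> w \<in> T p \<Longrightarrow> g p (a *\<^sub>R u) w = a * g p u w"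
  using g_lin[of u p u w a 0] by simp

lemma g_add_right: "u \<in> T p \<Longrightarrow> v \<in> T p \<Longrightarrow> w \<in> T p \<Longrightarrow> g p w (u + v) = g p w u + g p w v"
  using g_add g_sym subspace_add[OF subspace_T] by metis

lemma g_scale_right: "u \<in> T p \<Longrightarrow> w \<in> T p \<Longrightarrow> g p w (a *\<^sub>R u) = a * g p w u"
  using g_scale g_sym subspace_scale[OF subspace_T] by metis

lemma g_nonneg: "u \<in> T p \<Longrightarrow> g p u u \<ge> 0"
  using g_pos[of u p] g_scale[of u p u 0] by (cases "u = 0") auto

abbreviation nrm :: "'a \<Rightarrow> ('a, 'e) tangent \<Rightarrow> real" where "nrm \<equiv> metric_norm g"

lemma nrm_sq: "u \<in> T p \<Longrightarrow> (nrm p u)\<^sup>2 = g p u u"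
  by (simp add: metric_norm_def g_nonneg)

lemma nrm_nonneg: "u \<in> T p \<Longrightarrow> nrm p u \<ge> 0"
  by (simp add: metric_norm_def g_nonneg)

lemma nrm_scale: "u \<in> T p \<Longrightarrow> nrm p (a *\<^sub>R u) = \<bar>a\<bar> * nrm p u"
  using subspace_scale[OF subspace_T]
  by (simp add: metric_norm_def g_scale g_scale_right mult.assoc[symmetric] real_sqrt_mult)

lemma g_expand:
  assumes "u \<in> T p" "v \<in> T p"
  shows "g p (a *\<^sub>R u + b *\<^sub>R v) (a *\<^sub>R u + b *\<^sub>R v)
       = a\<^sup>2 * g p u u + 2 * a * b * g p u v + b\<^sup>2 * g p v v"
proof -
  note S = subspace_scale[OF subspace_T] subspace_add[OF subspace_T]
  show ?thesis
    using assms g_sym[OF assms]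
    by (simp add: g_add g_scale g_add_right g_scale_right S power2_eq_square algebra_simps)
qed

text \<open>The form \<open>g\<close> is an inner product on each tangent space only, not on the ambient space of
  families of coordinate vectors, so the inequality is derived by the usual discriminant argument.\<close>

lemma g_Cauchy_Schwarz:
  assumes "u \<in> T p" "v \<in> T p"
  shows "(g p u v)\<^sup>2 \<le> g p u u * g p v v"
proof (cases "u = 0")
  case True
  then show ?thesis using g_scale[of u p v 0] g_scale[of u p u 0] assms by simp
next
  case False
  then have pos: "g p u u > 0" using assms by (simp add: g_pos)
  have "(- g p u v) *\<^sub>R u + g p u u *\<^sub>R v \<in> T p"
    by (intro subspace_scale[OF subspace_T] subspace_add[OF subspace_T] assms)
  from g_nonneg[OF this] have "0 \<le> g p u u * (g p u u * g p v v - (g p u v)\<^sup>2)"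
    unfolding g_expand[OF assms] by (simp add: power2_eq_square algebra_simps)
  then show ?thesis using pos by (simp add: zero_le_mult_iff)
qed

lemma nrm_triangle:
  assumes "u \<in> T p" "v \<in> T p"
  shows "nrm p (u + v) \<le> nrm p u + nrm p v"
proof (rule power2_le_imp_le)
  have "g p u v \<le> nrm p u * nrm p v"
    using real_sqrt_le_mono[OF g_Cauchy_Schwarz[OF assms]] 
    by (simp add: metric_norm_def real_sqrt_mult)
  moreover have "(nrm p (u + v))\<^sup>2 = (nrm p u)\<^sup>2 + 2 * g p u v + (nrm p v)\<^sup>2"
    using g_expand[OF assms, of 1 1] assms subspace_add[OF subspace_T] by (simp add: nrm_sq)
  ultimately show "(nrm p (u + v))\<^sup>2 \<le> (nrm p u + nrm p v)\<^sup>2"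
    by (simp add: power2_sum)
qed (use nrm_nonneg assms in auto)

text \<open>The metric tensor in the chart \<open>c\<close>.\<close>

definition gc :: "('a, 'e) chart \<Rightarrow> 'e \<Rightarrow> 'e \<Rightarrow> 'e \<Rightarrow> real" where
  "gc c z x y = g (chart_inv c z) (lift c (chart_inv c z) x) (lift c (chart_inv c z) y)"

lemma g_eq_gc: "c \<in> A \<Longrightarrow> p \<in> fst c \<Longrightarrow> u \<in> T p \<Longrightarrow> v \<in> T p \<Longrightarrow> g p u v = gc c (snd c p) (u c) (v c)"
  by (simp add: gc_def chart_inv_chart lift_of)

context
  fixes c assumes c: "c \<in> A"
begin

lemma linear_gc:
  assumes "z \<in> chart_image c"
  shows "linear (gc c z x)" "linear (\<lambda>x. gc c z x y)"
  using c chart_inv_in[OF c assms]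
  by (auto intro!: linearI simp: gc_def lift_add lift_scale g_add g_scale g_add_right g_scale_right lift_in)

lemma continuous_on_gc:
  fixes a u v :: "'x::topological_space \<Rightarrow> 'e"
  assumes "continuous_on S a" "a ` S \<subseteq> chart_image c" "continuous_on S u" "continuous_on S v"
  shows "continuous_on S (\<lambda>x. gc c (a x) (u x) (v x))"
proof (rule continuous_on_linear_apply[OF _ _ assms(4)])
  show "linear (gc c (a x) (u x))" if "x \<in> S" for x using that assms(2) by (intro linear_gc) auto
  fix b
  show "continuous_on S (\<lambda>x. gc c (a x) (u x) b)"
  proof (rule continuous_on_linear_apply[where L = "\<lambda>x e. gc c (a x) e b", OF _ _ assms(3)])
    show "linear (\<lambda>e. gc c (a x) e b)" if "x \<in> S" for x using that assms(2) by (intro linear_gc) auto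
    fix e
    have "Ck_on 0 (chart_image c) (\<lambda>z. gc c z e b)"
      using metric c unfolding riemannian_metric_def smooth_on_def gc_def by blast
    then show "continuous_on S (\<lambda>x. gc c (a x) e b)"
      using continuous_on_compose2[OF _ assms(1,2)] by simp
  qed
qed

lemma gc_pos:
  assumes "z \<in> chart_image c" "x \<noteq> 0"
  shows "gc c z x x > 0"
  unfolding gc_def
proof (intro g_pos lift_in chart_inv_in c assms)
  show "lift c (chart_inv c z) x \<noteq> 0"
    using lift_same[OF c chart_inv_in[OF c assms(1)], of x] assms(2) by auto
qed

text \<open>By homogeneity it is enough to minimize over the compact set of unit vectors over \<open>K\<close>.\<close>

lemma gc_lower_bound:
  assumes "compact K" "K \<subseteq> chart_image c"
  shows "\<exists>m>0. \<forall>z\<in>K. \<forall>x. m * (norm x)\<^sup>2 \<le> gc c z x x"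
proof (cases "K = {}")
  case True then show ?thesis by (auto intro: exI[of _ 1])
next
  case False
  let ?S = "K \<times> sphere (0::'e) 1"
  have cont: "continuous_on ?S (\<lambda>x. gc c (fst x) (snd x) (snd x))"
    using assms(2)
    by (intro continuous_on_gc[OF continuous_on_fst[OF continuous_on_id] _
          continuous_on_snd[OF continuous_on_id] continuous_on_snd[OF continuous_on_id]]) auto
  have "compact ?S" using assms by (intro compact_Times compact_sphere)
  moreover have "sphere (0::'e) 1 \<noteq> {}" by simp
  then have "?S \<noteq> {}" using False by blast
  ultimately obtain s where s: "s \<in> ?S" "\<And>x. x \<in> ?S \<Longrightarrow> gc c (fst s) (snd s) (snd s) \<le> gc c (fst x) (snd x) (snd x)"
    using continuous_attains_inf[OF _ _ cont] by blast
  define m where "m = gc c (fst s) (snd s) (snd s)"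
  have "m > 0" unfolding m_def using s(1) assms by (intro gc_pos) auto
  moreover have "m * (norm x)\<^sup>2 \<le> gc c z x x" if "z \<in> K" for z x
  proof (cases "x = 0")
    case True then show ?thesis using linear_0[OF linear_gc(1)] that assms by auto
  next
    case False
    let ?y = "(1 / norm x) *\<^sub>R x"
    have "m \<le> gc c z ?y ?y" using s(2)[of "(z, ?y)"] that False by (simp add: m_def)
    also have "\<dots> = (1 / norm x) * ((1 / norm x) * gc c z x x)"
    proof -
      have z: "z \<in> chart_image c" using that assms by auto
      show ?thesis
        by (simp only: linear_cmul[OF linear_gc(1)[OF z]] linear_cmul[OF linear_gc(2)[OF z]] real_scaleR_def)
    qed
    finally show ?thesis using False by (simp add: field_simps power2_eq_square)
  qed
  ultimately show ?thesis by blast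
qed

end

lemma continuous_g_fields:
  assumes "Y \<in> vector_fields A k" "Z \<in> vector_fields A l" "k \<ge> 1" "l \<ge> 1"
  shows "continuous_on UNIV (\<lambda>p. g p (Y p) (Z p))"
proof (rule continuous_on_charts)
  fix c assume c: "c \<in> A"
  have "continuous_on (chart_image c) (\<lambda>z. gc c z (coord_field Y c z) (coord_field Z c z))"
    by (rule continuous_on_gc[OF c continuous_on_id _ C1_on_continuous C1_on_continuous])
       (use c assms coord_fieldD(2) in auto)
  then show "continuous_on (chart_image c) (\<lambda>z. g (chart_inv c z) (Y (chart_inv c z)) (Z (chart_inv c z)))"
    by (rule continuous_on_eq)
       (use c assms in \<open>simp add: g_eq_gc[OF c chart_inv_in[OF c]] coord_fieldD coord_field_def chart_chart_inv\<close>)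
qed

end

section \<open>Integral curves and flows on the manifold\<close>

context manifold
begin

definition integral_curve :: "('a \<Rightarrow> ('a, 'e) tangent) \<Rightarrow> (real \<Rightarrow> 'a) \<Rightarrow> bool" where
  "integral_curve Y \<alpha> \<longleftrightarrow> continuous_on UNIV \<alpha> \<and>
     (\<forall>t. \<forall>c\<in>A. \<alpha> t \<in> fst c \<longrightarrow> ((\<lambda>s. snd c (\<alpha> s)) has_vector_derivative Y (\<alpha> t) c) (at t))"

lemma integral_curve_flow: "generates_flow A Y \<psi> \<Longrightarrow> integral_curve Y (\<lambda>t. \<psi> t x)"
  unfolding generates_flow_def integral_curve_def by simp

lemma integral_curve_shift:
  assumes "integral_curve Y \<alpha>"
  shows "integral_curve Y (\<lambda>t. \<alpha> (t + s))"
  unfolding integral_curve_def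
proof (intro conjI allI ballI impI)
  show "continuous_on UNIV (\<lambda>t. \<alpha> (t + s))"
    using assms continuous_on_compose2[of UNIV \<alpha> UNIV "\<lambda>t. t + s"]
    by (simp add: integral_curve_def continuous_on_add)
  fix t c assume c: "c \<in> A" "\<alpha> (t + s) \<in> fst c"
  then have d: "((\<lambda>s. snd c (\<alpha> s)) has_vector_derivative Y (\<alpha> (t + s)) c) (at (t + s))"
    using assms unfolding integral_curve_def by blast
  have "((\<lambda>t. t + s) has_vector_derivative 1) (at t)"
    unfolding has_real_derivative_iff_has_vector_derivative[symmetric]
    by (auto intro!: derivative_eq_intros)
  from vector_diff_chain_at[OF this d]
  show "((\<lambda>t. snd c (\<alpha> (t + s))) has_vector_derivative Y (\<alpha> (t + s)) c) (at t)"
    by (simp add: o_def)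
qed

text \<open>A coordinate ball of radius \<open>2\<rho>\<close> and a time \<open>\<tau>\<close> so short that orbits which start in the ball
  of radius \<open>\<rho>\<close> have no time to leave it.\<close>

definition flow_box ::
  "('a \<Rightarrow> ('a, 'e) tangent) \<Rightarrow> ('a, 'e) chart \<Rightarrow> 'e \<Rightarrow> real \<Rightarrow> real \<Rightarrow> real \<Rightarrow> bool" where
  "flow_box Y c z0 \<rho> \<tau> L \<longleftrightarrow> c \<in> A \<and> \<rho> > 0 \<and> \<tau> > 0 \<and> L \<ge> 0 \<and> L * \<tau> \<le> 1/2 \<and>
     cball z0 (2 * \<rho>) \<subseteq> chart_image c \<and> C1_on (chart_image c) (coord_field Y c) \<and>
     (\<forall>z\<in>cball z0 (2 * \<rho>). (\<forall>v. norm (frechet_derivative (coord_field Y c) (at z) v) \<le> L * norm v) \<and>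
        norm (coord_field Y c z) * \<tau> \<le> \<rho>)"

lemma flow_box_exists:
  assumes Y: "Y \<in> vector_fields A k" "k \<ge> 1" and c: "c \<in> A" "p \<in> fst c"
  shows "\<exists>\<rho> \<tau> L. flow_box Y c (snd c p) \<rho> \<tau> L"
proof -
  let ?f = "coord_field Y c"
  obtain e where e: "e > 0" "cball (snd c p) e \<subseteq> chart_image c"
    using open_chart_image[OF c(1)] chart_in[OF c] by (meson open_contains_cball)
  define \<rho> where "\<rho> = e / 2"
  let ?K = "cball (snd c p) (2 * \<rho>)"
  have \<rho>: "\<rho> > 0" "?K \<subseteq> chart_image c" using e by (auto simp: \<rho>_def)
  have f: "C1_on (chart_image c) ?f" using coord_fieldD Y c by blast
  have bdd: "\<exists>B>0. \<forall>z\<in>?K. norm (h z) \<le> B" if "continuous_on (chart_image c) h" for h :: "'e \<Rightarrow> 'e"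
  proof -
    have "compact (h ` ?K)"
      using continuous_on_subset[OF that \<rho>(2)] by (intro compact_continuous_image compact_cball)
    then show ?thesis using bounded_pos[of "h ` ?K"] compact_imp_bounded by auto
  qed
  obtain B where B: "B > 0" "\<And>z. z \<in> ?K \<Longrightarrow> norm (?f z) \<le> B"
    using bdd[OF C1_on_continuous[OF f]] by blast
  have "\<exists>B>0. \<forall>z\<in>?K. norm (frechet_derivative ?f (at z) b) \<le> B" for b
    using f unfolding C1_on_def by (intro bdd) blast
  then obtain M where M: "\<And>b. M b > 0" "\<And>b z. z \<in> ?K \<Longrightarrow> norm (frechet_derivative ?f (at z) b) \<le> M b"
    by metis
  define m where "m = Max (M ` Basis)"
  define L where "L = DIM('e) * m"
  have "m > 0" using M(1) nonempty_Basis by (auto simp: m_def Max_gr_iff ex_in_conv)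
  then have L: "L > 0" by (simp add: L_def)
  have bd: "norm (frechet_derivative ?f (at z) v) \<le> L * norm v" if "z \<in> ?K" for z v
    unfolding L_def
  proof (rule linear_bound_Basis)
    show "linear (frechet_derivative ?f (at z))" using C1_onD(2)[OF f] \<rho>(2) that by blast
    show "norm (frechet_derivative ?f (at z) b) \<le> m" if "b \<in> Basis" for b
    proof -
      have "M b \<le> m" unfolding m_def using that by (intro Max_ge) auto
      then show ?thesis using M(2)[OF \<open>z \<in> ?K\<close>, of b] by linarith
    qed
  qed
  define \<tau> where "\<tau> = min (\<rho> / B) (1 / (2 * L))"
  have \<tau>: "\<tau> > 0" "L * \<tau> \<le> 1/2" "B * \<tau> \<le> \<rho>"
    using \<rho>(1) B(1) L by (auto simp: \<tau>_def min_def field_simps)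
  have "norm (?f z) * \<tau> \<le> \<rho>" if "z \<in> ?K" for z
    using mult_right_mono[OF B(2)[OF that], of \<tau>] \<tau> by linarith
  then have "flow_box Y c (snd c p) \<rho> \<tau> L"
    using \<rho> \<tau> L bd f c by (simp add: flow_box_def)
  then show ?thesis by blast
qed

text \<open>A time of least absolute value outside the ball would be reached inside the closed ball, hence in
  the chart, where the curve has not had time to travel the distance \<open>\<rho>\<close>.\<close>

lemma flow_box_confines:
  assumes box: "flow_box Y c z0 \<rho> \<tau> L" and \<alpha>: "integral_curve Y \<alpha>"
    and start: "\<alpha> 0 \<in> fst c" "snd c (\<alpha> 0) \<in> ball z0 \<rho>" and t: "t \<in> {-\<tau>..\<tau>}"
  shows "\<alpha> t \<in> fst c" "snd c (\<alpha> t) \<in> ball z0 (2 * \<rho>)"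
proof -
  have c: "c \<in> A" and \<rho>: "\<rho> > 0" and K: "cball z0 (2 * \<rho>) \<subseteq> chart_image c"
    and speed: "\<And>z. z \<in> cball z0 (2 * \<rho>) \<Longrightarrow> norm (coord_field Y c z) * \<tau> \<le> \<rho>"
    using box by (auto simp: flow_box_def)
  have cont: "continuous_on UNIV \<alpha>" using \<alpha> by (simp add: integral_curve_def)
  define S where "S = fst c \<inter> snd c -` ball z0 (2 * \<rho>)"
  define S' where "S' = chart_inv c ` cball z0 (2 * \<rho>)"
  have "open S" unfolding S_def
    by (rule continuous_open_preimage[OF continuous_chart[OF c] open_domain[OF c] open_ball])
  have "closed S'" unfolding S'_def
    using continuous_on_subset[OF continuous_chart_inv[OF c] K]
    by (intro compact_imp_closed compact_continuous_image compact_cball)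
  have S': "x \<in> S' \<longleftrightarrow> x \<in> fst c \<and> snd c x \<in> cball z0 (2 * \<rho>)" for x
  proof
    assume "x \<in> S'"
    then obtain z where "z \<in> cball z0 (2 * \<rho>)" "x = chart_inv c z" by (auto simp: S'_def)
    then show "x \<in> fst c \<and> snd c x \<in> cball z0 (2 * \<rho>)"
      using K chart_chart_inv[OF c, of z] chart_inv_in[OF c, of z] by auto
  next
    assume "x \<in> fst c \<and> snd c x \<in> cball z0 (2 * \<rho>)"
    then show "x \<in> S'" unfolding S'_def using chart_inv_chart[OF c, of x] by (metis imageI)
  qed
  have "S \<subseteq> S'"
  proof
    fix x assume "x \<in> S"
    then show "x \<in> S'" unfolding S' by (simp add: S_def)
  qed
  have start_S: "\<alpha> 0 \<in> S" using start \<rho> by (simp add: S_def)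
  have "\<alpha> t \<in> S"
  proof (rule ccontr)
    assume "\<alpha> t \<notin> S"
    define Bad where "Bad = {-\<tau>..\<tau>} \<inter> \<alpha> -` (- S)"
    have "closed (\<alpha> -` (- S))"
      using continuous_closed_vimage[of "- S" \<alpha>] cont \<open>open S\<close>
      by (auto simp: continuous_on_eq_continuous_at)
    then have "compact Bad" unfolding Bad_def by (simp add: compact_Int_closed)
    moreover have "Bad \<noteq> {}" using t \<open>\<alpha> t \<notin> S\<close> by (auto simp: Bad_def)
    ultimately obtain t1 where t1: "t1 \<in> Bad" "\<And>s. s \<in> Bad \<Longrightarrow> \<bar>t1\<bar> \<le> \<bar>s\<bar>"
      using continuous_attains_inf[of Bad abs] continuous_on_rabs[OF continuous_on_id[of Bad]] by blast
    have t1\<tau>: "\<bar>t1\<bar> \<le> \<tau>" and t1S: "\<alpha> t1 \<notin> S" using t1(1) by (auto simp: Bad_def)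
    have "t1 \<noteq> 0" using t1S start_S by auto
    define \<beta> where "\<beta> r = \<alpha> (r * t1)" for r
    have \<beta>: "continuous_on UNIV \<beta>" unfolding \<beta>_def
      by (rule continuous_on_compose2[OF cont continuous_on_mult[OF continuous_on_id continuous_on_const]]) auto
    have "\<beta> r \<in> S'" if "r \<in> {0..<1}" for r
    proof -
      have "\<bar>r * t1\<bar> < \<bar>t1\<bar>" using that \<open>t1 \<noteq> 0\<close> by (simp add: abs_mult)
      then have "r * t1 \<notin> Bad" using t1(2) by force
      then have "\<beta> r \<in> S" using \<open>\<bar>r * t1\<bar> < \<bar>t1\<bar>\<close> t1\<tau> unfolding \<beta>_def Bad_def by auto
      then show ?thesis using \<open>S \<subseteq> S'\<close> by auto
    qed
    moreover have "closed (\<beta> -` S')"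
      using continuous_closed_vimage[OF \<open>closed S'\<close>, of \<beta>] \<beta>
      by (auto simp: continuous_on_eq_continuous_at)
    ultimately have "closure {0..<1} \<subseteq> \<beta> -` S'" by (intro closure_minimal) auto
    then have \<beta>S': "\<beta> r \<in> S'" if "r \<in> {0..1}" for r using that by auto
    define u where "u r = snd c (\<beta> r)" for r
    have u_eq: "u = (\<lambda>r. snd c (\<alpha> (r * t1)))" by (auto simp: u_def \<beta>_def)
    have "norm (u 1 - u 0) \<le> \<rho> * norm (1 - 0 :: real)"
    proof (rule differentiable_bound[of "{0..1}" u "\<lambda>r h. h *\<^sub>R (t1 *\<^sub>R coord_field Y c (u r))"])
      fix r :: real assume r: "r \<in> {0..1}"
      have in_c: "\<alpha> (r * t1) \<in> fst c" and in_K: "u r \<in> cball z0 (2 * \<rho>)"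
        using \<beta>S'[OF r] by (auto simp: S' \<beta>_def u_def)
      have "((\<lambda>r. r * t1) has_vector_derivative t1) (at r)"
        unfolding has_real_derivative_iff_has_vector_derivative[symmetric]
        by (auto intro!: derivative_eq_intros)
      moreover have "((\<lambda>s. snd c (\<alpha> s)) has_vector_derivative coord_field Y c (u r)) (at (r * t1))"
        using \<alpha> c in_c unfolding integral_curve_def coord_field_def u_def \<beta>_def
        by (simp add: chart_inv_chart[OF c])
      ultimately have "(u has_vector_derivative t1 *\<^sub>R coord_field Y c (u r)) (at r)"
        using vector_diff_chain_at[of "\<lambda>r. r * t1" t1 r] unfolding u_eq by (simp add: o_def)
      then show "(u has_derivative (\<lambda>h. h *\<^sub>R (t1 *\<^sub>R coord_field Y c (u r)))) (at r within {0..1})"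
        by (simp add: has_vector_derivative_def has_derivative_at_withinI)
      have "\<bar>t1\<bar> * norm (coord_field Y c (u r)) \<le> norm (coord_field Y c (u r)) * \<tau>"
        using mult_right_mono[OF t1\<tau> norm_ge_zero] by (simp add: mult.commute)
      also have "\<dots> \<le> \<rho>" by (rule speed[OF in_K])
      finally have le: "norm (t1 *\<^sub>R coord_field Y c (u r)) \<le> \<rho>" by simp
      show "onorm (\<lambda>h. h *\<^sub>R (t1 *\<^sub>R coord_field Y c (u r))) \<le> \<rho>"
      proof (rule onorm_le)
        fix h :: real
        show "norm (h *\<^sub>R (t1 *\<^sub>R coord_field Y c (u r))) \<le> \<rho> * norm h"
          using mult_left_mono[OF le abs_ge_zero[of h]] 
          by (simp add: abs_mult mult_ac)
      qed
    qed auto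
    then have "dist (u 0) (u 1) \<le> \<rho>" by (simp add: dist_norm norm_minus_commute)
    moreover have "dist z0 (u 0) < \<rho>" using start by (simp add: u_def \<beta>_def)
    ultimately have "dist z0 (u 1) < 2 * \<rho>" using dist_triangle[of z0 "u 1" "u 0"] by linarith
    then have "\<alpha> t1 \<in> S" using \<beta>S'[of 1] S' by (auto simp: S_def u_def \<beta>_def)
    then show False using t1S by simp
  qed
  then show "\<alpha> t \<in> fst c" "snd c (\<alpha> t) \<in> ball z0 (2 * \<rho>)" by (auto simp: S_def)
qed

lemma flow_box_derivative:
  assumes box: "flow_box Y c z0 \<rho> \<tau> L" and \<alpha>: "integral_curve Y \<alpha>"
    and start: "\<alpha> 0 \<in> fst c" "snd c (\<alpha> 0) \<in> ball z0 \<rho>" and t: "t \<in> {-\<tau>..\<tau>}"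
  shows "((\<lambda>s. snd c (\<alpha> s)) has_vector_derivative coord_field Y c (snd c (\<alpha> t))) (at t within S)"
proof -
  have c: "c \<in> A" using box by (simp add: flow_box_def)
  then have "((\<lambda>s. snd c (\<alpha> s)) has_vector_derivative Y (\<alpha> t) c) (at t)"
    using \<alpha> flow_box_confines(1)[OF assms] unfolding integral_curve_def by blast
  then show ?thesis
    using chart_inv_chart[OF c flow_box_confines(1)[OF assms]]
    by (simp add: coord_field_def has_vector_derivative_at_within)
qed

lemma integral_curves_agree_near_0:
  assumes Y: "Y \<in> vector_fields A k" "k \<ge> 1"
    and \<alpha>: "integral_curve Y \<alpha>" and \<beta>: "integral_curve Y \<beta>" and eq: "\<alpha> 0 = \<beta> 0"
  shows "\<exists>\<tau>>0. \<forall>t\<in>{-\<tau>..\<tau>}. \<alpha> t = \<beta> t"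
proof -
  obtain c where c: "c \<in> A" "\<alpha> 0 \<in> fst c" by (rule chart_exists)
  define z0 where "z0 = snd c (\<alpha> 0)"
  obtain \<rho> \<tau> L where box: "flow_box Y c z0 \<rho> \<tau> L" using flow_box_exists[OF Y c] by (auto simp: z0_def)
  let ?K = "cball z0 (2 * \<rho>)" and ?f = "coord_field Y c"
  have b: "\<rho> > 0" "\<tau> > 0" "L \<ge> 0" "L * \<tau> \<le> 1/2" "?K \<subseteq> chart_image c" "C1_on (chart_image c) ?f"
    "\<And>z v. z \<in> ?K \<Longrightarrow> norm (frechet_derivative ?f (at z) v) \<le> L * norm v"
    using box by (auto simp: flow_box_def)
  have start: "snd c (\<alpha> 0) \<in> ball z0 \<rho>" using b by (simp add: z0_def)
  note start' = c(2)[unfolded eq] start[unfolded eq]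
  have "\<alpha> t = \<beta> t" if t: "t \<in> {-\<tau>..\<tau>}" for t
  proof -
    have "norm (snd c (\<alpha> t) - snd c (\<beta> t)) \<le> 2 * norm (snd c (\<alpha> 0) - snd c (\<beta> 0)) + 2 * \<tau> * 0"
    proof (rule short_time_bound[where u = "\<lambda>t. snd c (\<alpha> t) - snd c (\<beta> t)"])
      fix t assume t: "t \<in> {-\<tau>..\<tau>}"
      show "((\<lambda>t. snd c (\<alpha> t) - snd c (\<beta> t)) has_vector_derivative
          ?f (snd c (\<alpha> t)) - ?f (snd c (\<beta> t))) (at t within {-\<tau>..\<tau>})"
        by (intro has_vector_derivative_diff flow_box_derivative[OF box \<alpha> c(2) start t]
            flow_box_derivative[OF box \<beta> start' t])
      have "snd c (\<alpha> t) \<in> ?K" "snd c (\<beta> t) \<in> ?K"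
        using flow_box_confines(2)[OF box \<alpha> c(2) start t] flow_box_confines(2)[OF box \<beta> start' t] by auto
      then have "norm (?f (snd c (\<alpha> t)) - ?f (snd c (\<beta> t))) \<le> L * norm (snd c (\<alpha> t) - snd c (\<beta> t))"
      proof (rule differentiable_bound[OF convex_cball, rotated 2])
        fix z assume z: "z \<in> ?K"
        then have "z \<in> chart_image c" using b(5) by blast
        then show "(?f has_derivative frechet_derivative ?f (at z)) (at z within ?K)"
          by (rule has_derivative_at_withinI[OF C1_onD(1)[OF b(6)]])
        show "onorm (frechet_derivative ?f (at z)) \<le> L" by (rule onorm_le[OF b(7)[OF z]])
      qed
      then show "norm (?f (snd c (\<alpha> t)) - ?f (snd c (\<beta> t))) \<le> L * norm (snd c (\<alpha> t) - snd c (\<beta> t)) + 0"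
        by simp
    qed (use b t in auto)
    then have "snd c (\<alpha> t) = snd c (\<beta> t)" by (simp add: eq)
    then show ?thesis
      using flow_box_confines(1)[OF box \<alpha> c(2) start t] flow_box_confines(1)[OF box \<beta> start' t]
        chart_inv_chart[OF c(1)] by metis
  qed
  then show ?thesis using b by blast
qed

text \<open>The set of times where the curves agree is closed, and open by local uniqueness.\<close>

lemma integral_curve_unique:
  assumes Y: "Y \<in> vector_fields A k" "k \<ge> 1"
    and \<alpha>: "integral_curve Y \<alpha>" and \<beta>: "integral_curve Y \<beta>" and eq: "\<alpha> 0 = \<beta> 0"
  shows "\<alpha> t = \<beta> t"
proof -
  define E where "E = {t. \<alpha> t = \<beta> t}"
  have "closed E" unfolding E_def
    using \<alpha> \<beta> by (intro closed_Collect_eq) (auto simp: integral_curve_def)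
  moreover have "open E"
    unfolding open_contains_ball
  proof
    fix s assume "s \<in> E"
    then have "\<exists>\<tau>>0. \<forall>t\<in>{-\<tau>..\<tau>}. \<alpha> (t + s) = \<beta> (t + s)"
      by (intro integral_curves_agree_near_0[OF Y] integral_curve_shift \<alpha> \<beta>) (simp add: E_def)
    then obtain \<tau> where \<tau>: "\<tau> > 0" "\<And>t. t \<in> {-\<tau>..\<tau>} \<Longrightarrow> \<alpha> (t + s) = \<beta> (t + s)" by blast
    have "ball s \<tau> \<subseteq> E"
    proof
      fix t assume "t \<in> ball s \<tau>"
      then have "t - s \<in> {-\<tau>..\<tau>}" by (auto simp: dist_real_def abs_less_iff)
      then show "t \<in> E" using \<tau>(2)[of "t - s"] by (simp add: E_def)
    qed
    then show "\<exists>e>0. ball s e \<subseteq> E" using \<tau>(1) by blast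
  qed
  moreover have "0 \<in> E" by (simp add: E_def eq)
  ultimately have "E = UNIV" using clopen[of E] by blast
  then show ?thesis by (auto simp: E_def)
qed

lemma flow_box_short_flow:
  assumes \<phi>: "generates_flow A Y \<phi>" and box: "flow_box Y c z0 \<rho> \<tau> L"
  shows "short_flow (coord_field Y c) (cball z0 (2 * \<rho>)) (ball z0 \<rho>) L \<tau>
    (\<lambda>t. snd c \<circ> \<phi> t \<circ> chart_inv c) (\<lambda>z. frechet_derivative (coord_field Y c) (at z))"
proof -
  let ?K = "cball z0 (2 * \<rho>)" and ?f = "coord_field Y c"
  have b: "c \<in> A" "\<rho> > 0" "\<tau> > 0" "L \<ge> 0" "L * \<tau> \<le> 1/2" "?K \<subseteq> chart_image c" "C1_on (chart_image c) ?f"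
    "\<And>z v. z \<in> ?K \<Longrightarrow> norm (frechet_derivative ?f (at z) v) \<le> L * norm v"
    using box by (auto simp: flow_box_def)
  have \<phi>0: "\<phi> 0 x = x" for x using \<phi> by (simp add: generates_flow_def)
  have start: "\<phi> 0 (chart_inv c z) \<in> fst c" "snd c (\<phi> 0 (chart_inv c z)) \<in> ball z0 \<rho>" if "z \<in> ball z0 \<rho>" for z
  proof -
    have "z \<in> cball z0 (2 * \<rho>)" using that b(2) by simp
    then have z: "z \<in> chart_image c" using b(6) by blast
    show "\<phi> 0 (chart_inv c z) \<in> fst c" "snd c (\<phi> 0 (chart_inv c z)) \<in> ball z0 \<rho>"
      unfolding \<phi>0 chart_chart_inv[OF b(1) z] using that chart_inv_in[OF b(1) z] by auto
  qed
  note curve = integral_curve_flow[OF \<phi>]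
  show ?thesis
  proof
    show "((\<lambda>s. (snd c \<circ> \<phi> s \<circ> chart_inv c) z) has_vector_derivative
        ?f ((snd c \<circ> \<phi> t \<circ> chart_inv c) z)) (at t within {-\<tau>..\<tau>})"
      if "z \<in> ball z0 \<rho>" "t \<in> {-\<tau>..\<tau>}" for z t
      using flow_box_derivative[OF box curve start[OF that(1)] that(2)] by simp
    show "(snd c \<circ> \<phi> t \<circ> chart_inv c) z \<in> ?K" if "z \<in> ball z0 \<rho>" "t \<in> {-\<tau>..\<tau>}" for z t
      using flow_box_confines(2)[OF box curve start[OF that(1)] that(2)] by simp
    show "(snd c \<circ> \<phi> 0 \<circ> chart_inv c) z = z" if "z \<in> ball z0 \<rho>" for z
    proof -
      have "z \<in> cball z0 (2 * \<rho>)" using that b(2) by simp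
      then have "z \<in> chart_image c" using b(6) by blast
      then show ?thesis by (simp add: \<phi>0 chart_chart_inv[OF b(1)])
    qed
    show "(?f has_derivative frechet_derivative ?f (at z)) (at z)" if "z \<in> ?K" for z
      using C1_onD(1)[OF b(7)] b(6) that by blast
    show "continuous_on ?K (\<lambda>z. frechet_derivative ?f (at z) v)" for v
      using b(6,7) continuous_on_subset unfolding C1_on_def by blast
  qed (use b in auto)
qed

text \<open>Flow boxes transport the two local facts of \<open>short_flow\<close> to the manifold: the flow is \<open>C\<^sup>1\<close>,
  and its differential carries a commuting field to itself.\<close>

lemma flow_C1_near:
  assumes \<phi>: "generates_flow A X \<phi>" and box: "flow_box X c z0 \<rho> \<tau> L" and t: "t \<in> {-\<tau>..\<tau>}"
  shows "C1_near c c (chart_inv c ` ball z0 \<rho>) (\<phi> t)"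
    and "Y \<in> C1_centralizer A X \<Longrightarrow> q \<in> chart_inv c ` ball z0 \<rho> \<Longrightarrow>
      frechet_derivative (snd c \<circ> \<phi> t \<circ> chart_inv c) (at (snd c q)) (Y q c) = Y (\<phi> t q) c"
proof -
  let ?K = "cball z0 (2 * \<rho>)" and ?f = "coord_field X c" and ?V = "chart_inv c ` ball z0 \<rho>"
  have c: "c \<in> A" "\<rho> > 0" and K: "?K \<subseteq> chart_image c"
    using box by (auto simp: flow_box_def)
  interpret short_flow ?f ?K "ball z0 \<rho>" L \<tau> "\<lambda>t. snd c \<circ> \<phi> t \<circ> chart_inv c"
      "\<lambda>z. frechet_derivative ?f (at z)"
    by (rule flow_box_short_flow[OF \<phi> box])
  have "ball z0 \<rho> \<subseteq> ?K" using c by auto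
  then have U: "ball z0 \<rho> \<subseteq> chart_image c" using K by blast
  have inv_z: "chart_inv c z \<in> fst c" "snd c (chart_inv c z) = z" if "z \<in> ball z0 \<rho>" for z
    using that U chart_inv_in[OF c(1), of z] chart_chart_inv[OF c(1), of z] by auto
  have snd_V: "snd c ` ?V = ball z0 \<rho>"
    unfolding image_image using inv_z(2) by simp
  have "?V = fst c \<inter> snd c -` ball z0 \<rho>"
  proof
    show "?V \<subseteq> fst c \<inter> snd c -` ball z0 \<rho>" using inv_z by auto
    show "fst c \<inter> snd c -` ball z0 \<rho> \<subseteq> ?V"
    proof
      fix x assume x: "x \<in> fst c \<inter> snd c -` ball z0 \<rho>"
      then have "x = chart_inv c (snd c x)" using chart_inv_chart[OF c(1), of x] by simp
      then show "x \<in> ?V" using x by (intro image_eqI[of x "chart_inv c" "snd c x"]) auto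
    qed
  qed
  then have "open ?V"
    using continuous_open_preimage[OF continuous_chart[OF c(1)] open_domain[OF c(1)] open_ball] by metis
  have in_dom: "\<phi> t (chart_inv c z) \<in> fst c" if "z \<in> ball z0 \<rho>" for z
  proof -
    have "\<phi> 0 x = x" for x using \<phi> by (simp add: generates_flow_def)
    then show ?thesis
      using flow_box_confines(1)[OF box integral_curve_flow[OF \<phi>, of "chart_inv c z"] _ _ t] inv_z[OF that] that
      by simp
  qed
  show "C1_near c c ?V (\<phi> t)"
    unfolding C1_near_def snd_V
    using c(1) \<open>open ?V\<close> in_dom C1_on_flow[OF t] inv_z(1) by (intro conjI) auto
  assume Y: "Y \<in> C1_centralizer A X" and q: "q \<in> ?V"
  then obtain z where z: "z \<in> ball z0 \<rho>" "q = chart_inv c z" by blast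
  have zc: "snd c q = z" using z inv_z(2) by simp
  have Y1: "Y \<in> vector_fields A 1" using Y by (simp add: C1_centralizer_def)
  have "frechet_derivative (snd c \<circ> \<phi> t \<circ> chart_inv c) (at z) (coord_field Y c z)
      = coord_field Y c ((snd c \<circ> \<phi> t \<circ> chart_inv c) z)"
  proof (rule frechet_flow_commuting[OF z(1) t])
    fix y assume "y \<in> ?K"
    then have y: "y \<in> chart_image c" using K by auto
    then show "(coord_field Y c has_derivative frechet_derivative (coord_field Y c) (at y)) (at y)"
      using C1_onD(1)[OF coord_fieldD(2)[OF Y1 order_refl c(1)]] by blast
    have "lie_bracket A X Y (chart_inv c y) c = 0" using Y by (simp add: C1_centralizer_def)
    then show "frechet_derivative (coord_field Y c) (at y) (?f y)
        = frechet_derivative ?f (at y) (coord_field Y c y)"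
      using y c chart_inv_in[OF c(1) y] by (simp add: lie_bracket_def chart_chart_inv coord_field_def[of _ c])
  qed
  then show "frechet_derivative (snd c \<circ> \<phi> t \<circ> chart_inv c) (at (snd c q)) (Y q c) = Y (\<phi> t q) c"
    unfolding zc using chart_inv_chart[OF c(1) in_dom[OF z(1)]] by (simp add: coord_field_def z(2))
qed

end

locale compact_flow = riemannian_manifold A g
  for A :: "('a::t2_space, 'e::euclidean_space) chart set" and g +
  fixes X :: "'a \<Rightarrow> ('a, 'e) tangent" and \<phi> :: "real \<Rightarrow> 'a \<Rightarrow> 'a" and r :: nat
  assumes compact: "compact (UNIV :: 'a set)" and X: "X \<in> vector_fields A r" and r: "r \<ge> 1"
    and flow: "generates_flow A X \<phi>"
begin

lemma \<phi>_0: "\<phi> 0 x = x" and \<phi>_add: "\<phi> (s + t) x = \<phi> s (\<phi> t x)"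
  using flow by (auto simp: generates_flow_def)

lemma \<phi>_inverse: "\<phi> t (\<phi> (- t) x) = x" "\<phi> (- t) (\<phi> t x) = x"
  using \<phi>_add[of t "- t" x] \<phi>_add[of "- t" t x] by (simp_all add: \<phi>_0)

text \<open>Finitely many flow boxes cover the compact manifold, which makes the short time uniform.\<close>

lemma flow_C1_short_time:
  "\<exists>\<tau>>0. \<forall>t\<in>{-\<tau>..\<tau>}. C1_map (\<phi> t) \<and>
     (\<forall>Y\<in>C1_centralizer A X. \<forall>q. tangent_map A (\<phi> t) q (Y q) = Y (\<phi> t q))"
proof -
  have "\<exists>c \<rho> \<tau> L. p \<in> fst c \<and> flow_box X c (snd c p) \<rho> \<tau> L" for p
    using chart_exists[of p] flow_box_exists[OF X r] by metis
  then obtain c \<rho> \<tau> L where box: "\<And>p. p \<in> fst (c p)"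
      "\<And>p. flow_box X (c p) (snd (c p) p) (\<rho> p) (\<tau> p) (L p)" by metis
  define V where "V p = chart_inv (c p) ` ball (snd (c p) p) (\<rho> p)" for p
  have b: "c p \<in> A" "\<rho> p > 0" "\<tau> p > 0" for p using box(2)[of p] by (auto simp: flow_box_def)
  have near: "C1_near (c p) (c p) (V p) (\<phi> t)" if "t \<in> {-\<tau> p..\<tau> p}" for p t
    using flow_C1_near(1)[OF flow box(2) that] by (simp add: V_def)
  have in_V: "p \<in> V p" for p
    unfolding V_def using chart_inv_chart[OF b(1) box(1)] b(2)
    by (metis centre_in_ball imageI)
  have "open (V p)" for p
    using near[of 0 p] b(3)[of p] by (simp add: C1_near_def)
  then obtain P where P: "finite P" "UNIV \<subseteq> (\<Union>p\<in>P. V p)"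
    by (rule compactE_image[OF compact, of UNIV V]) (use in_V in auto)
  define \<tau>0 where "\<tau>0 = Min (insert 1 (\<tau> ` P))"
  have "\<tau>0 > 0" using P(1) b(3) by (auto simp: \<tau>0_def)
  moreover have small: "t \<in> {-\<tau> p..\<tau> p}" if "p \<in> P" "t \<in> {-\<tau>0..\<tau>0}" for p t
    using Min_le[of "insert 1 (\<tau> ` P)" "\<tau> p"] P(1) that by (auto simp: \<tau>0_def)
  moreover have ex: "\<exists>p\<in>P. q \<in> V p" for q using P(2) by blast
  moreover have C1: "C1_map (\<phi> t)" if "t \<in> {-\<tau>0..\<tau>0}" for t
    unfolding C1_map_def
  proof
    fix q obtain p where p: "p \<in> P" "q \<in> V p" using ex by blast
    show "\<exists>c d V. q \<in> V \<and> C1_near c d V (\<phi> t)"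
      by (intro exI conjI) (rule p(2), rule near[OF small[OF p(1) that]])
  qed
  moreover have "tangent_map A (\<phi> t) q (Y q) = Y (\<phi> t q)"
    if t: "t \<in> {-\<tau>0..\<tau>0}" and Y: "Y \<in> C1_centralizer A X" for t q Y
  proof -
    obtain p where p: "p \<in> P" "q \<in> V p" using ex by blast
    have Yv: "Y q \<in> T q" for q using Y coord_fieldD(1)[of Y 1] by (simp add: C1_centralizer_def)
    have "\<phi> t q \<in> fst (c p)" using near[OF small[OF p(1) t]] p(2) by (auto simp: C1_near_def)
    moreover have "tangent_map A (\<phi> t) q (Y q) (c p) = Y (\<phi> t q) (c p)"
      unfolding tangent_map_coord[OF near[OF small[OF p(1) t]] p(2) Yv]
      using flow_C1_near(2)[OF flow box(2) small[OF p(1) t] Y] p(2) by (simp add: V_def)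
    ultimately show ?thesis
      by (intro tangent_eqI[OF tangent_map_compose(2)[OF C1[OF t] C1_map_id Yv] Yv b(1)])
  qed
  ultimately show ?thesis by blast
qed

text \<open>The flow at time \<open>t\<close> is the \<open>n\<close>-th iterate of the flow at the short time \<open>t / n\<close>.\<close>

lemma flow_C1_commuting:
  "C1_map (\<phi> t) \<and> (\<forall>Y\<in>C1_centralizer A X. \<forall>q. tangent_map A (\<phi> t) q (Y q) = Y (\<phi> t q))"
proof -
  obtain \<tau> where \<tau>: "\<tau> > 0" "\<And>t. t \<in> {-\<tau>..\<tau>} \<Longrightarrow> C1_map (\<phi> t) \<and>
     (\<forall>Y\<in>C1_centralizer A X. \<forall>q. tangent_map A (\<phi> t) q (Y q) = Y (\<phi> t q))"
    using flow_C1_short_time by blast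
  obtain n :: nat where n: "\<bar>t\<bar> / \<tau> < n" using reals_Archimedean2 by blast
  have "0 \<le> \<bar>t\<bar> / \<tau>" using \<tau>(1) by simp
  then have n0: "n > 0" using n by linarith
  define s where "s = t / n"
  have "\<bar>s\<bar> \<le> \<tau>" using n n0 \<tau>(1) by (simp add: s_def field_simps abs_divide)
  then have s: "C1_map (\<phi> s)" "\<And>Y q. Y \<in> C1_centralizer A X \<Longrightarrow> tangent_map A (\<phi> s) q (Y q) = Y (\<phi> s q)"
    using \<tau>(2)[of s] by (auto simp: abs_le_iff)
  have "C1_map (\<phi> (m * s)) \<and>
     (\<forall>Y\<in>C1_centralizer A X. \<forall>q. tangent_map A (\<phi> (m * s)) q (Y q) = Y (\<phi> (m * s) q))" for m :: nat
  proof (induction m)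
    case 0
    have \<phi>_id: "\<phi> (real 0 * s) = id" using \<phi>_0 by (simp add: fun_eq_iff)
    have Yq: "Y q \<in> T q" if "Y \<in> C1_centralizer A X" for Y q
      using that coord_fieldD(1)[of Y 1] by (simp add: C1_centralizer_def)
    show ?case unfolding \<phi>_id by (intro conjI ballI allI C1_map_id) (metis tangent_map_id Yq id_apply)
  next
    case (Suc m)
    have eq: "\<phi> (real (Suc m) * s) = \<phi> s \<circ> \<phi> (real m * s)"
      using \<phi>_add[of s "real m * s"] by (auto simp: algebra_simps)
    have "tangent_map A (\<phi> s \<circ> \<phi> (real m * s)) q (Y q) = Y ((\<phi> s \<circ> \<phi> (real m * s)) q)"
      if Y: "Y \<in> C1_centralizer A X" for Y q
    proof -
      have "Y q \<in> T q" using Y coord_fieldD(1)[of Y 1] by (simp add: C1_centralizer_def)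
      then show ?thesis using Suc s Y tangent_map_compose(1)[of "\<phi> (real m * s)" "\<phi> s" "Y q" q] by simp
    qed
    then show ?case unfolding eq using Suc s(1) C1_map_compose by blast
  qed
  from this[of n] show ?thesis using n0 by (simp add: s_def)
qed

end

section \<open>Growth of tangent vectors along orbits\<close>

context compact_flow
begin

lemma C1_flow: "C1_map (\<phi> t)"
  using flow_C1_commuting by blast

lemma flow_continuous: "continuous_on UNIV (\<phi> t)"
  by (rule C1_map_continuous[OF C1_flow])

abbreviation push :: "real \<Rightarrow> 'a \<Rightarrow> ('a, 'e) tangent \<Rightarrow> ('a, 'e) tangent" where
  "push t \<equiv> tangent_map A (\<phi> t)"

lemma push_in: "w \<in> T x \<Longrightarrow> push t x w \<in> T (\<phi> t x)"
  by (rule tangent_map_compose(2)[OF C1_flow C1_map_id])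

lemma push_add: "w \<in> T x \<Longrightarrow> push (s + t) x w = push s (\<phi> t x) (push t x w)"
proof -
  assume "w \<in> T x"
  moreover have "\<phi> (s + t) = \<phi> s \<circ> \<phi> t" using \<phi>_add by (simp add: fun_eq_iff)
  ultimately show ?thesis using tangent_map_compose(1)[OF C1_flow C1_flow] by metis
qed

lemma push_field: "Y \<in> C1_centralizer A X \<Longrightarrow> push t x (Y x) = Y (\<phi> t x)"
  using flow_C1_commuting by blast

lemma centralizer_field: "Y \<in> C1_centralizer A X \<Longrightarrow> Y \<in> vector_fields A 1"
  by (simp add: C1_centralizer_def)

lemma X_in_centralizer: "X \<in> C1_centralizer A X"
proof -
  have "lie_bracket A X X p = 0" for p
    by (auto simp: lie_bracket_def fun_eq_iff coord_field_def chart_inv_chart)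
  moreover have "X \<in> vector_fields A 1"
    using coord_fieldD(1,2)[OF X r] by (auto simp: vector_fields_def C1_on_def)
  ultimately show ?thesis by (simp add: C1_centralizer_def)
qed

definition growth :: "real \<Rightarrow> 'a \<Rightarrow> ('a, 'e) tangent \<Rightarrow> real" where
  "growth t x w = nrm (\<phi> t x) (push t x w)"

lemma growth_push: "w \<in> T x \<Longrightarrow> growth s (\<phi> t x) (push t x w) = growth (s + t) x w"
  by (simp add: growth_def push_add \<phi>_add)

lemma growth_0: "w \<in> T x \<Longrightarrow> growth 0 x w = nrm x w"
proof -
  assume w: "w \<in> T x"
  have "\<phi> 0 = id" using \<phi>_0 by (simp add: fun_eq_iff)
  then show ?thesis using tangent_map_id[OF w] \<phi>_0 by (simp only: growth_def)
qed

lemma growth_nonneg: "w \<in> T x \<Longrightarrow> growth t x w \<ge> 0"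
  by (simp add: growth_def nrm_nonneg push_in)

lemma growth_triangle:
  assumes "u \<in> T x" "v \<in> T x"
  shows "growth t x (u + v) \<le> growth t x u + growth t x v"
  unfolding growth_def tangent_map_linear(1)[OF C1_flow assms]
  by (intro nrm_triangle push_in assms)

lemma growth_scale:
  assumes "u \<in> T x"
  shows "growth t x (a *\<^sub>R u) = \<bar>a\<bar> * growth t x u"
  unfolding growth_def tangent_map_linear(2)[OF C1_flow assms assms]
  by (intro nrm_scale push_in assms)

lemma growth_diff:
  assumes "u \<in> T x" "v \<in> T x"
  shows "growth t x (u - v) \<le> growth t x u + growth t x v"
  using growth_triangle[OF assms(1) subspace_scale[OF subspace_T assms(2), of "-1"], of t]
    growth_scale[OF assms(2), of t "-1"] by simp

lemma growth_zero: "growth t x 0 = 0"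
  using growth_scale[OF subspace_0[OF subspace_T], of t x 0] by simp

text \<open>Read in the chart \<open>c\<close>, this is the continuity of the length of the image of a tangent vector on the tangent bundle.\<close>

lemma growth_continuous:
  assumes c: "c \<in> A"
  shows "continuous_on (chart_image c \<times> UNIV)
     (\<lambda>y. growth t (chart_inv c (fst y)) (lift c (chart_inv c (fst y)) (snd y)))" (is "continuous_on _ ?h")
proof -
  have "\<exists>d V. p \<in> V \<and> C1_near c d V (\<phi> t)" if p: "p \<in> fst c" for p
  proof -
    obtain d where d: "d \<in> A" "\<phi> t p \<in> fst d" by (rule chart_exists)
    obtain V where "p \<in> V" "C1_near c d V (\<phi> t)" using C1_map_near[OF C1_flow c p d] .
    then show ?thesis by blast
  qed
  then obtain d V where V: "\<And>p. p \<in> fst c \<Longrightarrow> p \<in> V p" "\<And>p. p \<in> fst c \<Longrightarrow> C1_near c (d p) (V p) (\<phi> t)"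
    by metis
  let ?S = "\<lambda>p. snd c ` V p \<times> (UNIV :: 'e set)"
  have piece: "open (?S p) \<and> continuous_on (?S p) ?h" if p: "p \<in> fst c" for p
  proof
    let ?f = "snd (d p) \<circ> \<phi> t \<circ> chart_inv c"
    have Vp: "d p \<in> A" "open (V p)" "V p \<subseteq> fst c" "\<phi> t ` V p \<subseteq> fst (d p)" "C1_on (snd c ` V p) ?f"
      using V(2)[OF p] by (auto simp: C1_near_def)
    show "open (?S p)" by (intro open_Times open_image_chart[OF c Vp(2,3)] open_UNIV)
    have fst_cont: "continuous_on (?S p) fst" and snd_cont: "continuous_on (?S p) snd"
      by (rule continuous_on_fst[OF continuous_on_id], rule continuous_on_snd[OF continuous_on_id])
    have "continuous_on (?S p) (\<lambda>y. ?f (fst y))"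
      by (rule continuous_on_compose2[OF C1_on_continuous[OF Vp(5)] fst_cont]) auto
    moreover have "continuous_on (?S p) (\<lambda>y. frechet_derivative ?f (at (fst y)) (snd y))"
      by (rule C1_on_apply_continuous[OF Vp(5) fst_cont _ snd_cont]) auto
    moreover have "(\<lambda>y. ?f (fst y)) ` ?S p \<subseteq> chart_image (d p)"
    proof -
      have "?f (snd c q) \<in> chart_image (d p)" if "q \<in> V p" for q
      proof -
        have "q \<in> fst c" "\<phi> t q \<in> fst (d p)" using Vp(3,4) that by auto
        then show ?thesis using chart_in[OF Vp(1)] by (simp add: chart_inv_chart[OF c])
      qed
      then show ?thesis by auto
    qed
    ultimately have "continuous_on (?S p) (\<lambda>y. sqrt (gc (d p) (?f (fst y))
        (frechet_derivative ?f (at (fst y)) (snd y)) (frechet_derivative ?f (at (fst y)) (snd y))))"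
      by (intro continuous_on_real_sqrt continuous_on_gc[OF Vp(1)])
    then show "continuous_on (?S p) ?h"
    proof (rule continuous_on_eq)
      fix y assume "y \<in> ?S p"
      then obtain q e where y: "y = (snd c q, e)" "q \<in> V p" by auto
      have q: "q \<in> fst c" "\<phi> t q \<in> fst (d p)" using y(2) Vp by auto
      have w: "lift c q e \<in> T q" by (rule lift_in[OF c q(1)])
      have "push t q (lift c q e) (d p) = frechet_derivative ?f (at (snd c q)) e"
        using tangent_map_coord[OF V(2)[OF p] y(2) w] lift_same[OF c q(1)] by simp
      then show "sqrt (gc (d p) (?f (fst y)) (frechet_derivative ?f (at (fst y)) (snd y))
          (frechet_derivative ?f (at (fst y)) (snd y))) = ?h y"
        using g_eq_gc[OF Vp(1) q(2) push_in[OF w] push_in[OF w]]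
        by (simp add: y(1) growth_def metric_norm_def chart_inv_chart[OF c q(1)])
    qed
  qed
  have "continuous_on (\<Union>p\<in>fst c. ?S p) ?h"
    using piece by (intro continuous_on_open_UN) auto
  moreover have "chart_image c \<times> UNIV \<subseteq> (\<Union>p\<in>fst c. ?S p)"
    using V(1) by (auto simp: chart_image_def)
  ultimately show ?thesis by (rule continuous_on_subset)
qed

text \<open>The witness \<open>w\<close> may depend on the point in any way; the weak inequalities make the set itself closed and
  hence measurable.\<close>

definition bounded_growth_set :: "real \<Rightarrow> (int \<Rightarrow> real) \<Rightarrow> 'a set" where
  "bounded_growth_set \<delta> b =
     {x. \<exists>w\<in>T x. growth 0 x w \<ge> \<delta> \<and> (\<forall>k. growth (of_int k) x w \<le> b k)}"

text \<open>In a chart it is the projection of a compact set: the bound at time \<open>0\<close> keeps the vectors over a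
  compact set of base points in a compact set.\<close>

lemma compact_bounded_growth_set: "compact (bounded_growth_set \<delta> b)"
proof -
  let ?G = "bounded_growth_set \<delta> b"
  have "\<exists>W C. open W \<and> p \<in> W \<and> W \<subseteq> C \<and> compact (?G \<inter> C)" for p
  proof -
    obtain c where c: "c \<in> A" "p \<in> fst c" by (rule chart_exists)
    obtain \<rho> where \<rho>: "\<rho> > 0" "cball (snd c p) \<rho> \<subseteq> chart_image c"
      using open_chart_image[OF c(1)] chart_in[OF c] by (meson open_contains_cball)
    let ?K = "cball (snd c p) \<rho>"
    obtain m where m: "m > 0" "\<And>z e. z \<in> ?K \<Longrightarrow> m * (norm e)\<^sup>2 \<le> gc c z e e"
      using gc_lower_bound[OF c(1) compact_cball \<rho>(2)] by blast
    define R where "R = sqrt ((b 0)\<^sup>2 / m)"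
    define h where "h t y = growth t (chart_inv c (fst y)) (lift c (chart_inv c (fst y)) (snd y))" for t y
    define Q where "Q = ((?K \<times> cball 0 R) \<inter> h 0 -` {\<delta>..}) \<inter> (\<Inter>k. (?K \<times> cball 0 R) \<inter> h (of_int k) -` {..b k})"
    have cont: "continuous_on (?K \<times> cball 0 R) (h t)" for t
      unfolding h_def by (rule continuous_on_subset[OF growth_continuous[OF c(1)]]) (use \<rho> in auto)
    have cl: "closed (?K \<times> cball (0::'e) R)" by (intro closed_Times closed_cball)
    have "closed Q" unfolding Q_def
      by (intro closed_Int closed_INT ballI continuous_closed_preimage[OF cont cl] closed_atLeast closed_atMost)
    moreover have "Q \<subseteq> ?K \<times> cball 0 R" by (auto simp: Q_def)
    ultimately have "compact Q"
      by (metis compact_Int_closed compact_Times compact_cball inf.absorb_iff2)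
    have inK: "chart_inv c z \<in> fst c" "snd c (chart_inv c z) = z" if "z \<in> ?K" for z
      using that \<rho>(2) chart_inv_in[OF c(1), of z] chart_chart_inv[OF c(1), of z] by auto
    have eq: "?G \<inter> chart_inv c ` ?K = chart_inv c ` fst ` Q"
    proof
      show "chart_inv c ` fst ` Q \<subseteq> ?G \<inter> chart_inv c ` ?K"
      proof
        fix x assume "x \<in> chart_inv c ` fst ` Q"
        then obtain z e where ze: "(z, e) \<in> Q" "x = chart_inv c z" by auto
        then have z: "z \<in> ?K" and h: "h 0 (z, e) \<ge> \<delta>" "\<And>k. h (of_int k) (z, e) \<le> b k"
          by (auto simp: Q_def)
        have "lift c x e \<in> T x" using lift_in[OF c(1) inK(1)[OF z]] ze(2) by simp
        then show "x \<in> ?G \<inter> chart_inv c ` ?K"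
          using h z ze(2) unfolding bounded_growth_set_def h_def by auto
      qed
      show "?G \<inter> chart_inv c ` ?K \<subseteq> chart_inv c ` fst ` Q"
      proof
        fix x assume x: "x \<in> ?G \<inter> chart_inv c ` ?K"
        then obtain z where z: "z \<in> ?K" "x = chart_inv c z" by blast
        obtain w where w: "w \<in> T x" "growth 0 x w \<ge> \<delta>" "\<And>k. growth (of_int k) x w \<le> b k"
          using x unfolding bounded_growth_set_def by blast
        have xc: "x \<in> fst c" "snd c x = z" using inK[OF z(1)] z(2) by auto
        have "m * (norm (w c))\<^sup>2 \<le> gc c z (w c) (w c)" by (rule m(2)[OF z(1)])
        also have "\<dots> = (growth 0 x w)\<^sup>2"
          using g_eq_gc[OF c(1) xc(1) w(1) w(1)] by (simp add: xc(2) growth_0[OF w(1)] nrm_sq[OF w(1)])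
        also have "\<dots> \<le> (b 0)\<^sup>2"
          using w(3)[of 0] growth_nonneg[OF w(1), of 0] by (intro power_mono) auto
        finally have "(norm (w c))\<^sup>2 \<le> (b 0)\<^sup>2 / m" using m(1) by (simp add: field_simps)
        then have "w c \<in> cball 0 R" unfolding R_def by (simp add: real_le_rsqrt)
        moreover have "h t (z, w c) = growth t x w" for t
          by (simp add: h_def z(2)[symmetric] lift_of[OF c(1) xc(1) w(1)])
        ultimately have "(z, w c) \<in> Q" using w z(1) by (simp add: Q_def)
        then show "x \<in> chart_inv c ` fst ` Q" using z(2) by (metis fst_conv image_eqI)
      qed
    qed
    have "compact (fst ` Q)"
      by (intro compact_continuous_image[OF _ \<open>compact Q\<close>] continuous_on_fst continuous_on_id)
    moreover have "fst ` Q \<subseteq> chart_image c" using \<rho>(2) by (auto simp: Q_def)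
    ultimately have "compact (chart_inv c ` fst ` Q)"
      using continuous_on_subset[OF continuous_chart_inv[OF c(1)]] compact_continuous_image by blast
    then have 1: "compact (?G \<inter> chart_inv c ` ?K)" using eq by simp
    have 2: "open (fst c \<inter> snd c -` ball (snd c p) \<rho>)"
      by (rule continuous_open_preimage[OF continuous_chart[OF c(1)] open_domain[OF c(1)] open_ball])
    have 3: "fst c \<inter> snd c -` ball (snd c p) \<rho> \<subseteq> chart_inv c ` ?K"
    proof
      fix x assume "x \<in> fst c \<inter> snd c -` ball (snd c p) \<rho>"
      then show "x \<in> chart_inv c ` ?K"
        using chart_inv_chart[OF c(1), of x] by (intro image_eqI[of x "chart_inv c" "snd c x"]) auto
    qed
    show ?thesis
      by (intro exI conjI) (rule 2, use c(2) \<rho>(1) in simp, rule 3, rule 1)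
  qed
  then obtain W C where WC: "\<And>p. open (W p)" "\<And>p. p \<in> W p" "\<And>p. W p \<subseteq> C p" "\<And>p. compact (?G \<inter> C p)"
    by metis
  obtain P where P: "finite P" "UNIV \<subseteq> (\<Union>p\<in>P. W p)"
    by (rule compactE_image[OF compact, of UNIV W]) (use WC(1,2) in auto)
  have "?G = (\<Union>p\<in>P. ?G \<inter> C p)" using P(2) WC(3) by blast
  moreover have "compact (\<Union>p\<in>P. ?G \<inter> C p)" using P(1) WC(4) by (intro compact_UN) auto
  ultimately show ?thesis by simp
qed

end

section \<open>Recurrence\<close>

text \<open>The vectors at which the seminorms tend to \<open>0\<close> form a subspace. On its bounded subsets the seminorms are
  controlled by their values on a finite orthonormal basis, so the convergence is uniform.\<close>

lemma seminorms_tendsto_0_uniformly: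
  fixes p :: "nat \<Rightarrow> 'e::euclidean_space \<Rightarrow> real"
  assumes tri: "\<And>j x y. p j (x + y) \<le> p j x + p j y"
    and scale: "\<And>j r x. p j (r *\<^sub>R x) = \<bar>r\<bar> * p j x" and "\<delta> > 0"
  shows "\<forall>\<^sub>F j in sequentially. \<forall>x. (\<lambda>j. p j x) \<longlonglongrightarrow> 0 \<longrightarrow> norm x \<le> R \<longrightarrow> p j x < \<delta>"
proof -
  have zero: "p j 0 = 0" for j using scale[of j 0 0] by simp
  have nonneg: "p j x \<ge> 0" for j x
    using tri[of j x "- x"] scale[of j "-1" x] zero[of j] by simp
  define S where "S = {x. (\<lambda>j. p j x) \<longlonglongrightarrow> 0}"
  have "subspace S"
    unfolding subspace_def S_def mem_Collect_eq
  proof (intro conjI ballI allI)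
    show "(\<lambda>j. p j 0) \<longlonglongrightarrow> 0" by (simp add: zero)
    show "(\<lambda>j. p j (x + y)) \<longlonglongrightarrow> 0"
      if "x \<in> {x. (\<lambda>j. p j x) \<longlonglongrightarrow> 0}" "y \<in> {x. (\<lambda>j. p j x) \<longlonglongrightarrow> 0}" for x y
    proof (rule tendsto_sandwich[OF _ _ tendsto_const])
      show "(\<lambda>j. p j x + p j y) \<longlonglongrightarrow> 0" using that tendsto_add[of _ 0 _ _ 0] by fastforce
    qed (use tri nonneg in auto)
    show "(\<lambda>j. p j (r *\<^sub>R x)) \<longlonglongrightarrow> 0" if "x \<in> {x. (\<lambda>j. p j x) \<longlonglongrightarrow> 0}" for r x
      using that by (simp add: scale tendsto_mult_right_zero)
  qed
  then obtain B where B: "B \<subseteq> S" "pairwise orthogonal B" "\<And>x. x \<in> B \<Longrightarrow> norm x = 1"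
      "independent B" "card B = dim S" "span B = S"
    using orthonormal_basis_subspace[OF \<open>subspace S\<close>] by metis
  have fin: "finite B" using B(4) by (rule finiteI_independent)
  have "(\<lambda>j. \<bar>R\<bar> * (\<Sum>i\<in>B. p j i)) \<longlonglongrightarrow> \<bar>R\<bar> * (\<Sum>i\<in>B. 0)"
    using B(1) by (intro tendsto_mult tendsto_const tendsto_sum) (auto simp: S_def)
  then have "\<forall>\<^sub>F j in sequentially. \<bar>R\<bar> * (\<Sum>i\<in>B. p j i) < \<delta>"
    using \<open>\<delta> > 0\<close> by (intro order_tendstoD) auto
  then show ?thesis
  proof eventually_elim
    case (elim j)
    have "p j x < \<delta>" if x: "x \<in> S" "norm x \<le> R" for x
    proof -
      have x_eq: "(\<Sum>i\<in>B. (x \<bullet> i) *\<^sub>R i) = x"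
        using B x(1) fin by (intro orthonormal_basis_expand) auto
      have sub: "p j (\<Sum>i\<in>B'. (x \<bullet> i) *\<^sub>R i) \<le> (\<Sum>i\<in>B'. p j ((x \<bullet> i) *\<^sub>R i))" if "finite B'" for B'
        using that
      proof (induction B')
        case (insert i B')
        then show ?case using tri[of j "(x \<bullet> i) *\<^sub>R i" "\<Sum>i\<in>B'. (x \<bullet> i) *\<^sub>R i"] by simp
      qed (simp add: zero)
      have "p j x \<le> (\<Sum>i\<in>B. \<bar>x \<bullet> i\<bar> * p j i)" using sub[OF fin] by (simp add: x_eq scale)
      also have "\<dots> \<le> (\<Sum>i\<in>B. \<bar>R\<bar> * p j i)"
      proof (intro sum_mono mult_right_mono nonneg)
        fix i assume "i \<in> B"
        then show "\<bar>x \<bullet> i\<bar> \<le> \<bar>R\<bar>"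
          using Cauchy_Schwarz_ineq2[of x i] B(3)[of i] x(2) by simp
      qed
      also have "\<dots> < \<delta>" using elim by (simp add: sum_distrib_left)
      finally show ?thesis .
    qed
    then show ?case by (simp add: S_def)
  qed
qed

text \<open>The preimages of \<open>G\<close> all have the measure of \<open>G\<close>, while the upper limit of these sets is empty.\<close>

lemma finitely_many_visits_null:
  assumes "prob_space M" and meas: "\<And>m::nat. f m \<in> measurable M M" and inv: "\<And>m. distr M M (f m) = M"
    and G: "G \<in> sets M" and fin: "\<And>x. finite {m. f m x \<in> G}"
  shows "G \<in> null_sets M"
proof -
  interpret prob_space M by fact
  define B where "B n = (\<Union>m\<in>{n..}. f m -` G \<inter> space M)" for n
  have sets: "f m -` G \<inter> space M \<in> sets M" for m using meas G by (rule measurable_sets)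
  have Bs: "B n \<in> sets M" for n unfolding B_def using sets by blast
  have "(\<lambda>n. measure M (B n)) \<longlonglongrightarrow> measure M (\<Inter>n. B n)"
  proof (rule finite_Lim_measure_decseq)
    show "decseq B" unfolding decseq_def B_def by (meson Int_mono SUP_subset_mono UN_mono atLeast_subset_iff order_refl)
  qed (use Bs in auto)
  moreover have "(\<Inter>n. B n) = {}"
  proof (rule ccontr)
    assume "(\<Inter>n. B n) \<noteq> {}"
    then obtain x0 where x0: "\<And>n. x0 \<in> B n" by blast
    have x: "\<exists>m\<ge>n. f m x0 \<in> G" for n using x0[of n] by (auto simp: B_def)
    obtain n where "\<And>m. f m x0 \<in> G \<Longrightarrow> m < n"
      using fin[of x0] unfolding finite_nat_set_iff_bounded by blast
    then show False using x[of n] by (meson not_less)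
  qed
  ultimately have lim: "(\<lambda>n. measure M (B n)) \<longlonglongrightarrow> 0" by simp
  have "measure M G \<le> measure M (B n)" for n
  proof -
    have "measure M G = measure (distr M M (f n)) G" by (simp add: inv)
    also have "\<dots> = measure M (f n -` G \<inter> space M)" by (rule measure_distr[OF meas G])
    also have "\<dots> \<le> measure M (B n)" using Bs by (intro finite_measure_mono) (auto simp: B_def)
    finally show ?thesis .
  qed
  then have "measure M G \<le> 0" using LIMSEQ_le_const[OF lim] by blast
  then show ?thesis using G by (simp add: emeasure_eq_measure null_setsI measure_le_0_iff)
qed

locale measured_flow = compact_flow A g X \<phi> r + prob_space \<mu>
  for A :: "('a::t2_space, 'e::euclidean_space) chart set" and g X \<phi> r and \<mu> :: "'a measure" +
  assumes sets_\<mu>: "sets \<mu> = sets borel" and invariant: "flow_invariant \<phi> \<mu>"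
begin

lemma space_\<mu>: "space \<mu> = UNIV"
  using sets_eq_imp_space_eq[OF sets_\<mu>] by simp

text \<open>Pulled back to the initial point \<open>x\<close>, the witnesses found along an orbit stay in a bounded set of vectors
  at \<open>x\<close> whose images tend to \<open>0\<close>, hence do so uniformly. So the orbit meets the set only finitely often
  in the direction of \<open>\<sigma>\<close>.\<close>

lemma bounded_growth_set_null:
  fixes \<sigma> :: int
  assumes \<delta>: "\<delta> > 0" and bdd: "\<And>k. b k \<le> C" and lim: "(\<lambda>m::nat. b (\<sigma> * int m)) \<longlonglongrightarrow> 0"
  shows "bounded_growth_set \<delta> b \<in> null_sets \<mu>"
proof (rule finitely_many_visits_null[where f = "\<lambda>m. \<phi> (of_int (\<sigma> * int m))"])
  let ?G = "bounded_growth_set \<delta> b"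
  show "?G \<in> sets \<mu>"
    unfolding sets_\<mu> using compact_bounded_growth_set by (intro borel_closed compact_imp_closed)
  fix x
  define t where "t m = real_of_int (\<sigma> * int m)" for m
  obtain c where c: "c \<in> A" "x \<in> fst c" by (rule chart_exists)
  obtain m0 where m0: "m0 > 0" "\<And>e. m0 * (norm e)\<^sup>2 \<le> gc c (snd c x) e e"
    using gc_lower_bound[OF c(1), of "{snd c x}"] chart_in[OF c] by auto
  define R where "R = sqrt (C\<^sup>2 / m0)"
  define p where "p j e = growth (t j) x (lift c x e)" for j e
  have p_tri: "p j (e + e') \<le> p j e + p j e'" for j e e'
    unfolding p_def lift_add[OF c] by (intro growth_triangle lift_in c)
  have p_scale: "p j (a *\<^sub>R e) = \<bar>a\<bar> * p j e" for j a e
    unfolding p_def lift_scale[OF c] by (intro growth_scale lift_in c)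
  obtain J where J: "\<And>j e. j \<ge> J \<Longrightarrow> (\<lambda>j. p j e) \<longlonglongrightarrow> 0 \<Longrightarrow> norm e \<le> R \<Longrightarrow> p j e < \<delta>"
    using seminorms_tendsto_0_uniformly[of p, OF p_tri p_scale \<delta>, of R]
    unfolding eventually_sequentially by blast
  have "m < J" if visit: "\<phi> (t m) x \<in> ?G" for m
  proof (rule ccontr)
    assume "\<not> m < J"
    obtain w where w: "w \<in> T (\<phi> (t m) x)" "growth 0 (\<phi> (t m) x) w \<ge> \<delta>"
        "\<And>k. growth (of_int k) (\<phi> (t m) x) w \<le> b k"
      using visit unfolding bounded_growth_set_def by blast
    define w' where "w' = push (- t m) (\<phi> (t m) x) w"
    have w'T: "w' \<in> T x" using push_in[OF w(1), of "- t m"] by (simp add: w'_def \<phi>_inverse)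
    have gr: "growth s x w' = growth (s - t m) (\<phi> (t m) x) w" for s
      using growth_push[OF w(1), of s "- t m"] by (simp add: w'_def \<phi>_inverse)
    have p_w': "p j (w' c) = growth (t j) x w'" for j by (simp add: p_def lift_of[OF c w'T])
    have diff: "t j - t m = of_int (\<sigma> * (int j - int m))" for j by (simp add: t_def algebra_simps)
    have "(\<lambda>j. p j (w' c)) \<longlonglongrightarrow> 0"
    proof (rule tendsto_sandwich[OF _ _ tendsto_const])
      have "(\<lambda>j. b (\<sigma> * (int (j + m) - int m))) \<longlonglongrightarrow> 0" using lim by simp
      then show "(\<lambda>j. b (\<sigma> * (int j - int m))) \<longlonglongrightarrow> 0" by (rule LIMSEQ_offset)
      show "\<forall>\<^sub>F j in sequentially. p j (w' c) \<le> b (\<sigma> * (int j - int m))"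
        unfolding p_w' gr diff using w(3) by (intro always_eventually allI)
      show "\<forall>\<^sub>F j in sequentially. 0 \<le> p j (w' c)"
        unfolding p_w' using growth_nonneg[OF w'T] by (intro always_eventually allI)
    qed
    moreover have "norm (w' c) \<le> R"
    proof -
      have "growth 0 x w' \<le> C"
        using order_trans[OF w(3)[of "- (\<sigma> * int m)"] bdd] gr[of 0] by (simp add: t_def)
      then have "(growth 0 x w')\<^sup>2 \<le> C\<^sup>2" using growth_nonneg[OF w'T, of 0] by (intro power_mono) auto
      moreover have "(growth 0 x w')\<^sup>2 = gc c (snd c x) (w' c) (w' c)"
        using g_eq_gc[OF c w'T w'T] by (simp add: growth_0[OF w'T] nrm_sq[OF w'T])
      ultimately have "m0 * (norm (w' c))\<^sup>2 \<le> C\<^sup>2" using m0(2)[of "w' c"] by linarith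
      then have "(norm (w' c))\<^sup>2 \<le> C\<^sup>2 / m0" using m0(1) by (simp add: field_simps)
      then show ?thesis unfolding R_def by (simp add: real_le_rsqrt)
    qed
    ultimately have "p m (w' c) < \<delta>" using J[of m "w' c"] \<open>\<not> m < J\<close> by simp
    moreover have "p m (w' c) \<ge> \<delta>" unfolding p_w' gr using w(2) by simp
    ultimately show False by simp
  qed
  then show "finite {m. \<phi> (of_int (\<sigma> * int m)) x \<in> ?G}"
    unfolding t_def finite_nat_set_iff_bounded by blast
next
  show "prob_space \<mu>" by (rule prob_space_axioms)
  show "\<phi> (of_int (\<sigma> * int m)) \<in> measurable \<mu> \<mu>" for m
    using invariant unfolding flow_invariant_def by blast
  show "distr \<mu> \<mu> (\<phi> (of_int (\<sigma> * int m))) = \<mu>" for m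
    using invariant unfolding flow_invariant_def by blast
qed

definition bounded_orbit :: "'a \<Rightarrow> ('a, 'e) tangent \<Rightarrow> bool" where
  "bounded_orbit x w \<longleftrightarrow> (\<exists>C. \<forall>k::int. growth (of_int k) x w \<le> C)"

text \<open>Exponential decay along the orbit at the times \<open>\<sigma> m\<close>, with \<open>\<sigma> = 1\<close> for the future and
  \<open>\<sigma> = -1\<close> for the past.\<close>

definition decays :: "int \<Rightarrow> 'a \<Rightarrow> ('a, 'e) tangent \<Rightarrow> bool" where
  "decays \<sigma> x w \<longleftrightarrow> (\<exists>C. \<exists>\<kappa>::real. \<kappa> > 0 \<and> (\<forall>m::nat. growth (of_int (\<sigma> * int m)) x w \<le> C * exp (- \<kappa> * m)))"

text \<open>A nonzero vector with a bounded orbit that decays in the direction \<open>\<sigma>\<close> puts its base point into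
  one of countably many sets \<open>bounded_growth_set \<delta> b\<close>, each of which is null.\<close>

lemma AE_bounded_decaying_vanishes:
  assumes \<sigma>: "\<sigma> = 1 \<or> \<sigma> = -1"
  shows "AE x in \<mu>. \<forall>w\<in>T x. bounded_orbit x w \<longrightarrow> decays \<sigma> x w \<longrightarrow> w = 0"
proof -
  define b where "b C n k = real C * min 1 (exp (- real_of_int (\<sigma> * k) / Suc n))" for C n :: nat and k :: int
  have b_decay: "b C n k = real C * exp (- real_of_int (\<sigma> * k) / Suc n)" if "\<sigma> * k \<ge> 0" for C n k
  proof -
    have "0 \<le> real_of_int (\<sigma> * k)" using that by (simp only: of_int_0_le_iff)
    then have "- real_of_int (\<sigma> * k) / Suc n \<le> 0" by (simp only: divide_nonpos_pos neg_le_0_iff_le of_nat_0_less_iff zero_less_Suc)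
    then show ?thesis unfolding b_def by (simp only: min_absorb2 exp_le_one_iff)
  qed
  have b_const: "b C n k = real C" if "\<sigma> * k \<le> 0" for C n k
  proof -
    have "real_of_int (\<sigma> * k) \<le> 0" using that by (simp only: of_int_le_0_iff)
    then have "0 \<le> - real_of_int (\<sigma> * k) / Suc n" by (simp only: divide_nonneg_pos neg_0_le_iff_le of_nat_0_less_iff zero_less_Suc)
    then show ?thesis unfolding b_def by (simp only: min_absorb1 one_le_exp_iff mult_1_right)
  qed
  have \<sigma>\<sigma>: "\<sigma> * (\<sigma> * k) = k" for k using \<sigma> by auto
  define G where "G C n i = bounded_growth_set (1 / Suc i) (b C n)" for C n i :: nat
  have "G C n i \<in> null_sets \<mu>" for C n i
    unfolding G_def
  proof (rule bounded_growth_set_null[where \<sigma> = \<sigma> and C = C])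
    show "b C n k \<le> real C" for k by (simp add: b_def mult_left_le)
    have eq: "b C n (\<sigma> * int m) = real C * exp (- real m / Suc n)" for m
      using b_decay[of "\<sigma> * int m" C n] by (simp add: \<sigma>\<sigma>)
    have "(\<lambda>m. real C * exp (- 1 / Suc n) ^ m) \<longlonglongrightarrow> real C * 0"
      by (intro tendsto_mult tendsto_const LIMSEQ_realpow_zero) auto
    then show "(\<lambda>m. b C n (\<sigma> * int m)) \<longlonglongrightarrow> 0"
      unfolding eq by (simp add: exp_of_nat_mult[symmetric])
  qed simp
  then have "AE x in \<mu>. \<forall>C n i. x \<notin> G C n i"
    unfolding AE_all_countable using AE_not_in by blast
  then show ?thesis
  proof eventually_elim
    case (elim x)
    show ?case
    proof (intro ballI impI, rule ccontr)
      fix w assume w: "w \<in> T x" and bo: "bounded_orbit x w" and de: "decays \<sigma> x w" and "w \<noteq> 0"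
      obtain C1 where C1: "\<And>k::int. growth (of_int k) x w \<le> C1" using bo by (auto simp: bounded_orbit_def)
      obtain C2 and \<kappa> :: real where C2: "\<kappa> > 0" "\<And>m::nat. growth (of_int (\<sigma> * int m)) x w \<le> C2 * exp (- \<kappa> * m)"
        using de unfolding decays_def by blast
      obtain C :: nat where "max C1 C2 \<le> C" using real_arch_simple by blast
      then have C: "C1 \<le> C" "C2 \<le> C" by auto
      obtain n where n: "1 / real (Suc n) < \<kappa>" using nat_approx_posE[OF C2(1)] .
      have "(growth 0 x w)\<^sup>2 > 0"
        using g_pos[OF w \<open>w \<noteq> 0\<close>] by (simp add: growth_0[OF w] nrm_sq[OF w])
      then have "growth 0 x w > 0" using growth_nonneg[OF w, of 0] by (simp add: zero_less_power2 less_le)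
      then obtain i where i: "1 / real (Suc i) < growth 0 x w" using nat_approx_posE by blast
      have "growth (of_int k) x w \<le> b C n k" for k
      proof (cases "\<sigma> * k \<ge> 0")
        case True
        define m where "m = nat (\<sigma> * k)"
        have m: "int m = \<sigma> * k" using True by (simp add: m_def)
        then have k: "k = \<sigma> * int m" using \<sigma> by auto
        have "growth (of_int k) x w \<le> C2 * exp (- \<kappa> * m)" unfolding k by (rule C2(2))
        also have "\<dots> \<le> real C * exp (- \<kappa> * m)" using C(2) by (intro mult_right_mono) auto
        also have "\<dots> \<le> real C * exp (- real m / Suc n)"
        proof (intro mult_left_mono)
          have "1 / real (Suc n) * m \<le> \<kappa> * m" using n by (intro mult_right_mono) auto
          then show "exp (- \<kappa> * m) \<le> exp (- real m / Suc n)" by simp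
        qed simp
        also have "\<dots> = b C n k"
          using b_decay[OF True, of C n] by (simp add: m[symmetric])
        finally show ?thesis .
      next
        case False
        then show ?thesis using C1[of k] C(1) b_const[of k C n] by linarith
      qed
      then have "x \<in> G C n i"
        unfolding G_def bounded_growth_set_def using w i less_imp_le by blast
      then show False using elim by blast
    qed
  qed
qed

end

section \<open>Commuting fields are almost everywhere multiples of \<open>X\<close>\<close>

lemma le_exp_if_ln_less:
  fixes y z :: real
  assumes "0 \<le> y" "ln y < z"
  shows "y \<le> exp z"
proof (cases "y = 0")
  case False
  then have "y = exp (ln y)" using assms(1) by simp
  also have "\<dots> \<le> exp z" using assms(2) by simp
  finally show ?thesis .
qed simp

context measured_flow
begin

text \<open>The flow carries \<open>Y\<close> to itself, and the continuous function \<open>|Y|\<close> is bounded on the compact manifold.\<close>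

lemma bounded_orbit_field:
  assumes Y: "Y \<in> C1_centralizer A X"
  shows "bounded_orbit x (Y x)"
proof -
  have "continuous_on UNIV (\<lambda>p. g p (Y p) (Y p))"
    using centralizer_field[OF Y] by (intro continuous_g_fields) auto
  then obtain q where q: "\<And>p. g p (Y p) (Y p) \<le> g q (Y q) (Y q)"
    using continuous_attains_sup[OF compact, of "\<lambda>p. g p (Y p) (Y p)"] by auto
  have "growth t x (Y x) \<le> nrm q (Y q)" for t
    unfolding growth_def push_field[OF Y] metric_norm_def by (intro real_sqrt_le_mono q)
  then show ?thesis unfolding bounded_orbit_def by blast
qed

lemma bounded_orbit_scale:
  assumes "w \<in> T x" "bounded_orbit x w"
  shows "bounded_orbit x (a *\<^sub>R w)"
proof -
  obtain C where "\<And>k::int. growth (of_int k) x w \<le> C" using assms(2) unfolding bounded_orbit_def by blast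
  then have "growth (of_int k) x (a *\<^sub>R w) \<le> \<bar>a\<bar> * C" for k
    unfolding growth_scale[OF assms(1)] by (intro mult_left_mono) auto
  then show ?thesis unfolding bounded_orbit_def by blast
qed

lemma bounded_orbit_diff:
  assumes "u \<in> T x" "v \<in> T x" "bounded_orbit x u" "bounded_orbit x v"
  shows "bounded_orbit x (u - v)"
proof -
  obtain C D where "\<And>k::int. growth (of_int k) x u \<le> C" "\<And>k::int. growth (of_int k) x v \<le> D"
    using assms(3,4) unfolding bounded_orbit_def by blast
  then have "growth (of_int k) x (u - v) \<le> C + D" for k
    using order_trans[OF growth_diff[OF assms(1,2)] add_mono] by blast
  then show ?thesis unfolding bounded_orbit_def by blast
qed

lemma decays_zero: "decays \<sigma> x 0"
  unfolding decays_def by (intro exI[of _ 0] exI[of _ 1]) (simp add: growth_zero)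

lemma decays_add:
  assumes "u \<in> T x" "v \<in> T x" "decays \<sigma> x u" "decays \<sigma> x v"
  shows "decays \<sigma> x (u + v)"
proof -
  obtain C1 and \<kappa>1 :: real where 1: "\<kappa>1 > 0" "\<And>m::nat. growth (of_int (\<sigma> * int m)) x u \<le> C1 * exp (- \<kappa>1 * m)"
    using assms(3) unfolding decays_def by blast
  obtain C2 and \<kappa>2 :: real where 2: "\<kappa>2 > 0" "\<And>m::nat. growth (of_int (\<sigma> * int m)) x v \<le> C2 * exp (- \<kappa>2 * m)"
    using assms(4) unfolding decays_def by blast
  define \<kappa> where "\<kappa> = min \<kappa>1 \<kappa>2"
  have e: "C * exp (- \<kappa>' * real m) \<le> \<bar>C\<bar> * exp (- \<kappa> * real m)" if "\<kappa> \<le> \<kappa>'" for C \<kappa>' and m :: nat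
  proof (rule mult_mono)
    show "exp (- \<kappa>' * real m) \<le> exp (- \<kappa> * real m)" using that by (simp add: mult_right_mono)
  qed auto
  have "growth (of_int (\<sigma> * int m)) x (u + v) \<le> (\<bar>C1\<bar> + \<bar>C2\<bar>) * exp (- \<kappa> * m)" for m :: nat
  proof -
    have "growth (of_int (\<sigma> * int m)) x (u + v) \<le> C1 * exp (- \<kappa>1 * m) + C2 * exp (- \<kappa>2 * m)"
      using growth_triangle[OF assms(1,2), of "of_int (\<sigma> * int m)"] 1(2)[of m] 2(2)[of m] by linarith
    also have "\<dots> \<le> \<bar>C1\<bar> * exp (- \<kappa> * m) + \<bar>C2\<bar> * exp (- \<kappa> * m)"
      by (intro add_mono e) (auto simp: \<kappa>_def)
    finally show ?thesis by (simp only: distrib_right)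
  qed
  moreover have "\<kappa> > 0" using 1(1) 2(1) by (simp add: \<kappa>_def)
  ultimately show ?thesis unfolding decays_def by blast
qed

lemma decays_sum:
  assumes "finite J" "\<And>i. i \<in> J \<Longrightarrow> u i \<in> T x \<and> decays \<sigma> x (u i)"
  shows "decays \<sigma> x (\<Sum>i\<in>J. u i)"
  using assms
proof (induction J)
  case empty
  then show ?case unfolding sum.empty by (intro decays_zero)
next
  case (insert j J)
  have "decays \<sigma> x (u j + (\<Sum>i\<in>J. u i))"
    by (intro decays_add subspace_sum[OF subspace_T]) (use insert in auto)
  then show ?case unfolding sum.insert[OF insert.hyps] .
qed

lemma decays_if_eventually:
  assumes "\<kappa> > 0" "\<forall>\<^sub>F m in sequentially. growth (of_int (\<sigma> * int m)) x w \<le> exp (- \<kappa> * real m)"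
  shows "decays \<sigma> x w"
proof -
  obtain M where M: "\<And>m. m \<ge> M \<Longrightarrow> growth (of_int (\<sigma> * int m)) x w \<le> exp (- \<kappa> * real m)"
    using assms(2) unfolding eventually_sequentially by blast
  define h where "h m = \<bar>growth (of_int (\<sigma> * int m)) x w\<bar> * exp (\<kappa> * real m)" for m :: nat
  define C where "C = 1 + (\<Sum>m<M. h m)"
  have h0: "h m \<ge> 0" for m by (simp add: h_def)
  have "growth (of_int (\<sigma> * int m)) x w \<le> C * exp (- \<kappa> * real m)" for m
  proof (cases "m < M")
    case True
    have "growth (of_int (\<sigma> * int m)) x w \<le> h m * exp (- \<kappa> * real m)"
      by (simp add: h_def mult.assoc exp_add[symmetric])
    also have "h m \<le> (\<Sum>m<M. h m)" using True h0 by (intro member_le_sum) auto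
    finally have "growth (of_int (\<sigma> * int m)) x w \<le> (\<Sum>m<M. h m) * exp (- \<kappa> * real m)" by simp
    also have "\<dots> \<le> C * exp (- \<kappa> * real m)" by (intro mult_right_mono) (simp_all add: C_def)
    finally show ?thesis .
  next
    case False
    have "1 \<le> C" unfolding C_def using sum_nonneg[of "{..<M}" h] h0 by simp
    then have "1 * exp (- \<kappa> * real m) \<le> C * exp (- \<kappa> * real m)" by (intro mult_right_mono) simp_all
    then show ?thesis using M[of m] False by linarith
  qed
  then show ?thesis using assms(1) unfolding decays_def by blast
qed

lemma decays_if_exponent_pos:
  assumes w: "w \<in> T x" and lam: "lam > 0" and lim: "((\<lambda>t. ln (growth t x w) / t) \<longlongrightarrow> lam) at_bot"
  shows "decays (-1) x w"
proof (rule decays_if_eventually[of "lam / 2"])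
  have "filterlim (\<lambda>m::nat. - real m) at_bot sequentially"
    using filterlim_real_sequentially by (simp add: filterlim_uminus_at_bot)
  then have "\<forall>\<^sub>F m::nat in sequentially. ln (growth (- real m) x w) / - real m > lam / 2"
    using lam order_tendstoD(1)[OF filterlim_compose[OF lim], of "\<lambda>m::nat. - real m" sequentially "lam / 2"]
    by simp
  then show "\<forall>\<^sub>F m in sequentially. growth (of_int (-1 * int m)) x w \<le> exp (- (lam / 2) * real m)"
    using eventually_gt_at_top[of 0]
  proof eventually_elim
    case (elim m)
    then have "ln (growth (- real m) x w) < - (lam / 2) * real m" by (simp add: field_simps)
    then show ?case using le_exp_if_ln_less[OF growth_nonneg[OF w]] by simp
  qed
qed (use lam in simp)

lemma decays_if_exponent_neg:
  assumes w: "w \<in> T x" and lam: "lam < 0" and lim: "((\<lambda>t. ln (growth t x w) / t) \<longlongrightarrow> lam) at_top"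
  shows "decays 1 x w"
proof (rule decays_if_eventually[of "- lam / 2"])
  have "\<forall>\<^sub>F m::nat in sequentially. ln (growth (real m) x w) / real m < lam / 2"
    using lam order_tendstoD(2)[OF filterlim_compose[OF lim filterlim_real_sequentially], of "lam / 2"]
    by simp
  then show "\<forall>\<^sub>F m in sequentially. growth (of_int (1 * int m)) x w \<le> exp (- (- lam / 2) * real m)"
    using eventually_gt_at_top[of 0]
  proof eventually_elim
    case (elim m)
    then have "ln (growth (real m) x w) < lam / 2 * real m" by (simp add: field_simps)
    then show ?case using le_exp_if_ln_less[OF growth_nonneg[OF w]] by simp
  qed
qed (use lam in simp)

text \<open>In one time direction \<open>u\<close> is bounded because it decays, in the other because it differs from the
  bounded \<open>u + v\<close> by the decaying \<open>v\<close>.\<close>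

lemma bounded_orbit_if_sum_bounded:
  assumes \<sigma>: "\<sigma> = 1 \<or> \<sigma> = -1" and u: "u \<in> T x" and v: "v \<in> T x"
    and "decays \<sigma> x u" "decays (- \<sigma>) x v" "bounded_orbit x (u + v)"
  shows "bounded_orbit x u"
proof -
  obtain C1 and \<kappa>1 :: real where 1: "\<kappa>1 > 0" "\<And>m::nat. growth (of_int (\<sigma> * int m)) x u \<le> C1 * exp (- \<kappa>1 * m)"
    using assms(4) unfolding decays_def by blast
  obtain C2 and \<kappa>2 :: real where 2: "\<kappa>2 > 0" "\<And>m::nat. growth (of_int (- \<sigma> * int m)) x v \<le> C2 * exp (- \<kappa>2 * m)"
    using assms(5) unfolding decays_def by blast
  obtain C3 where 3: "\<And>k::int. growth (of_int k) x (u + v) \<le> C3"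
    using assms(6) unfolding bounded_orbit_def by blast
  have e: "C * exp (- \<kappa> * real m) \<le> \<bar>C\<bar>" if "\<kappa> > 0" for C \<kappa> and m :: nat
  proof -
    have "C * exp (- \<kappa> * real m) \<le> \<bar>C\<bar> * 1" using that by (intro mult_mono) auto
    then show ?thesis by simp
  qed
  have "growth (of_int k) x u \<le> \<bar>C1\<bar> + \<bar>C2\<bar> + \<bar>C3\<bar>" for k
  proof (cases "\<sigma> * k \<ge> 0")
    case True
    then have "k = \<sigma> * int (nat (\<sigma> * k))" using \<sigma> by auto
    then have "growth (of_int k) x u \<le> \<bar>C1\<bar>" using 1(2) e[OF 1(1)] order_trans by metis
    then show ?thesis by linarith
  next
    case False
    then have "k = - \<sigma> * int (nat (- \<sigma> * k))" using \<sigma> by auto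
    then have "growth (of_int k) x v \<le> \<bar>C2\<bar>" using 2(2) e[OF 2(1)] order_trans by metis
    moreover have "growth (of_int k) x u \<le> growth (of_int k) x (u + v) + growth (of_int k) x v"
      using growth_diff[OF subspace_add[OF subspace_T u v] v, of "of_int k"] by simp
    ultimately show ?thesis using 3[of k] by linarith
  qed
  then show ?thesis unfolding bounded_orbit_def by blast
qed

text \<open>Write \<open>Y = a X + u + v\<close>, where \<open>u\<close> and \<open>v\<close> collect the components with positive and with
  negative exponent. Since \<open>Y\<close> and \<open>X\<close> have bounded orbits, so has \<open>u + v\<close>, hence so has \<open>u\<close>, which
  decays in the past, and \<open>v\<close>, which decays in the future. Almost surely both are \<open>0\<close>.\<close>

lemma AE_commuting_field_parallel:
  assumes os: "oseledets_splitting A g X \<phi> \<mu> (\<lambda>_. k) E (\<lambda>_. lam)"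
    and hyp: "\<forall>i\<in>{1..k}. lam i \<noteq> 0" and Y: "Y \<in> C1_centralizer A X"
  shows "AE x in \<mu>. X x \<noteq> 0 \<and> (\<exists>a. Y x = a *\<^sub>R X x)"
proof -
  have pos: "AE x in \<mu>. \<forall>w\<in>T x. bounded_orbit x w \<longrightarrow> decays 1 x w \<longrightarrow> w = 0"
    and neg: "AE x in \<mu>. \<forall>w\<in>T x. bounded_orbit x w \<longrightarrow> decays (-1) x w \<longrightarrow> w = 0"
    by (intro AE_bounded_decaying_vanishes; simp)+
  have Yx: "Y x \<in> T x" for x using coord_fieldD(1)[OF centralizer_field[OF Y]] by simp
  have Xx: "X x \<in> T x" for x using coord_fieldD(1)[OF X r] .
  have "AE x in \<mu>. (\<forall>i\<le>k. subspace (E x i) \<and> E x i \<subseteq> T x \<and> E x i \<noteq> {0}) \<and> E x 0 = span {X x} \<and>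
      (\<forall>v\<in>T x. \<exists>u. (\<forall>i\<le>k. u i \<in> E x i) \<and> v = (\<Sum>i\<le>k. u i)) \<and>
      (\<forall>i\<in>{1..k}. \<forall>v\<in>E x i - {0}. ((\<lambda>t. ln (growth t x v) / t) \<longlongrightarrow> lam i) at_top \<and>
         ((\<lambda>t. ln (growth t x v) / t) \<longlongrightarrow> lam i) at_bot)"
    using os unfolding oseledets_splitting_def growth_def
    by (rule eventually_mono) (metis (no_types, lifting) ex1_implies_ex)
  then show ?thesis using pos neg
  proof eventually_elim
    case (elim x)
    then have sub: "\<And>i. i \<le> k \<Longrightarrow> E x i \<subseteq> T x" and E0: "E x 0 = span {X x}" "E x 0 \<noteq> {0}" by auto
    obtain u where u: "\<And>i. i \<le> k \<Longrightarrow> u i \<in> E x i" "Y x = (\<Sum>i\<le>k. u i)" using elim Yx by meson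
    have uT: "u i \<in> T x" if "i \<le> k" for i using u(1) sub that by blast
    have exps: "((\<lambda>t. ln (growth t x (u i)) / t) \<longlongrightarrow> lam i) at_top"
        "((\<lambda>t. ln (growth t x (u i)) / t) \<longlongrightarrow> lam i) at_bot" if "i \<in> {1..k}" "u i \<noteq> 0" for i
      using elim u(1)[of i] that by auto
    define P where "P = {i \<in> {1..k}. lam i > 0}"
    define N where "N = {i \<in> {1..k}. lam i < 0}"
    have fin: "finite P" "finite N" by (auto simp: P_def N_def)
    have le: "i \<le> k" if "i \<in> P \<union> N" for i using that by (auto simp: P_def N_def)
    define up where "up = (\<Sum>i\<in>P. u i)"
    define un where "un = (\<Sum>i\<in>N. u i)"
    have upT: "up \<in> T x" and unT: "un \<in> T x"
      unfolding up_def un_def using uT le by (auto intro!: subspace_sum[OF subspace_T])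
    have "decays (-1) x (u i)" if "i \<in> P" for i
      using decays_if_exponent_pos[OF uT _ exps(2)] decays_zero that le[of i]
      by (cases "u i = 0") (auto simp: P_def)
    then have up: "decays (-1) x up" unfolding up_def using fin uT le by (intro decays_sum) auto
    have "decays 1 x (u i)" if "i \<in> N" for i
      using decays_if_exponent_neg[OF uT _ exps(1)] decays_zero that le[of i]
      by (cases "u i = 0") (auto simp: N_def)
    then have un: "decays 1 x un" unfolding un_def using fin uT le by (intro decays_sum) auto
    obtain a where a: "u 0 = a *\<^sub>R X x" using u(1)[of 0] E0 by (auto simp: span_singleton)
    have split: "{..k} = insert 0 (P \<union> N)" using hyp by (auto simp: P_def N_def Suc_le_eq neq_iff)
    have "0 \<notin> P \<union> N" "P \<inter> N = {}" by (auto simp: P_def N_def)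
    then have Ysum: "Y x = u 0 + (up + un)"
      unfolding u(2) split up_def un_def using fin by (simp only: sum.insert sum.union_disjoint finite_Un simp_thms)
    then have eq: "up + un = Y x - a *\<^sub>R X x" using a by simp
    have bdd: "bounded_orbit x (up + un)" unfolding eq
      by (intro bounded_orbit_diff bounded_orbit_scale bounded_orbit_field Y X_in_centralizer Yx Xx
          subspace_scale[OF subspace_T])
    have "bounded_orbit x up"
      by (rule bounded_orbit_if_sum_bounded[of "-1", OF _ upT unT up _ bdd]) (use un in auto)
    then have "up = 0" using elim upT up by blast
    moreover have "bounded_orbit x un"
      by (rule bounded_orbit_if_sum_bounded[of 1 un x up]) (use un up upT unT bdd in \<open>auto simp: add.commute\<close>)
    then have "un = 0" using elim unT un by blast
    ultimately have "Y x = a *\<^sub>R X x" using Ysum a by simp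
    moreover have "X x \<noteq> 0"
    proof
      assume "X x = 0"
      then have "span {X x} = {0}" unfolding span_singleton by auto
      then show False using E0 by metis
    qed
    ultimately show ?case by (intro conjI exI)
  qed
qed

section \<open>Ergodicity makes the factor constant\<close>

text \<open>The factor is invariant under the flow, so each of its sublevel sets \<open>S q\<close> is null or of full
  measure, and the factor is almost everywhere the infimum of those \<open>q\<close> for which \<open>S q\<close> has full measure.\<close>

lemma ergodic_factor_constant:
  assumes erg: "flow_ergodic \<phi> \<mu>" and Y: "Y \<in> C1_centralizer A X"
    and par: "AE x in \<mu>. X x \<noteq> 0 \<and> (\<exists>a. Y x = a *\<^sub>R X x)"
  shows "\<exists>c. AE x in \<mu>. Y x = c *\<^sub>R X x"
proof -
  have YT: "Y x \<in> T x" for x using coord_fieldD(1)[OF centralizer_field[OF Y]] by simp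
  have XT: "X x \<in> T x" for x using coord_fieldD(1)[OF X r] .
  define S where "S q = {x. X x \<noteq> 0 \<and> (\<exists>a\<le>q. Y x = a *\<^sub>R X x)}" for q
  let ?XX = "\<lambda>x. g x (X x) (X x)" and ?XY = "\<lambda>x. g x (X x) (Y x)" and ?YY = "\<lambda>x. g x (Y x) (Y x)"
  \<comment> \<open>Equality in the Cauchy-Schwarz inequality describes \<open>S q\<close> by continuous functions.\<close>
  have S_eq: "S q = {x. 0 < ?XX x} \<inter> {x. ?YY x * ?XX x = (?XY x)\<^sup>2} \<inter> {x. ?XY x \<le> q * ?XX x}" for q
  proof (intro set_eqI iffI)
    fix x assume "x \<in> S q"
    then obtain a where a: "X x \<noteq> 0" "a \<le> q" "Y x = a *\<^sub>R X x" by (auto simp: S_def)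
    have XX: "?XX x > 0" using g_pos[OF XT a(1)] .
    have "?XY x = a * ?XX x" "?YY x = a * (a * ?XX x)"
      unfolding a(3) using XT subspace_scale[OF subspace_T XT]
      by (simp_all add: g_scale g_scale_right)
    then show "x \<in> {x. 0 < ?XX x} \<inter> {x. ?YY x * ?XX x = (?XY x)\<^sup>2} \<inter> {x. ?XY x \<le> q * ?XX x}"
      using XX a(2) by (simp add: power2_eq_square mult_right_mono)
  next
    fix x assume x: "x \<in> {x. 0 < ?XX x} \<inter> {x. ?YY x * ?XX x = (?XY x)\<^sup>2} \<inter> {x. ?XY x \<le> q * ?XX x}"
    define a where "a = ?XY x / ?XX x"
    have XX: "?XX x > 0" using x by simp
    have XY: "?XY x = a * ?XX x" using XX by (simp add: a_def)
    have "?YY x * ?XX x = (?XY x)\<^sup>2" using x by blast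
    also have "\<dots> = (a * a * ?XX x) * ?XX x" unfolding XY power2_eq_square by (simp only: mult_ac)
    finally have "?YY x * ?XX x = (a * a * ?XX x) * ?XX x" .
    then have YY: "?YY x = a * a * ?XX x" using XX by (metis less_irrefl mult_right_cancel)
    have "g x ((- a) *\<^sub>R X x + 1 *\<^sub>R Y x) ((- a) *\<^sub>R X x + 1 *\<^sub>R Y x) = 0"
      unfolding g_expand[OF XT YT] XY YY by (simp add: power2_eq_square algebra_simps)
    then have "(- a) *\<^sub>R X x + 1 *\<^sub>R Y x = 0"
      using g_pos[of "(- a) *\<^sub>R X x + 1 *\<^sub>R Y x" x] subspace_add[OF subspace_T] subspace_scale[OF subspace_T] XT YT
      by (metis less_irrefl)
    then have "Y x = a *\<^sub>R X x" by (simp add: eq_neg_iff_add_eq_0 add.commute)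
    moreover have "a \<le> q" using x XX by (simp add: a_def divide_le_eq)
    moreover have "X x \<noteq> 0" using XX g_scale[OF XT XT, of x 0] by auto
    ultimately show "x \<in> S q" unfolding S_def by blast
  qed
  have cont: "continuous_on UNIV ?XX" "continuous_on UNIV ?XY" "continuous_on UNIV ?YY"
    using continuous_g_fields X r centralizer_field[OF Y] by auto
  have S_sets: "S q \<in> sets \<mu>" for q
    unfolding sets_\<mu> S_eq
    by (intro sets.Int borel_open[OF open_Collect_less] borel_closed[OF closed_Collect_eq]
        borel_closed[OF closed_Collect_le] continuous_on_mult continuous_on_power continuous_on_const cont)
  have S_step: "\<phi> t x \<in> S q" if "x \<in> S q" for t x q
  proof -
    obtain a where a: "X x \<noteq> 0" "a \<le> q" "Y x = a *\<^sub>R X x" using \<open>x \<in> S q\<close> by (auto simp: S_def)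
    have "Y (\<phi> t x) = a *\<^sub>R X (\<phi> t x)"
      using push_field[OF Y, of t x] tangent_map_linear(2)[OF C1_flow XT XT, of t x a]
        push_field[OF X_in_centralizer, of t x] a(3) by simp
    moreover have "X (\<phi> t x) \<noteq> 0"
    proof
      assume 0: "X (\<phi> t x) = 0"
      have "X x = push (- t) (\<phi> t x) (0 *\<^sub>R X (\<phi> t x))"
        using push_field[OF X_in_centralizer, of "- t" "\<phi> t x"] 0 by (simp add: \<phi>_inverse)
      also have "\<dots> = 0" using tangent_map_linear(2)[OF C1_flow XT XT, of "- t" "\<phi> t x" 0] by simp
      finally show False using a(1) by simp
    qed
    ultimately show ?thesis using a(2) unfolding S_def by blast
  qed
  have S_inv: "\<phi> t -` S q \<inter> space \<mu> = S q" for t q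
    using S_step[of _ q t] S_step[of "\<phi> t _" q "- t"] by (auto simp: space_\<mu> \<phi>_inverse)
  have dichotomy: "(AE x in \<mu>. x \<notin> S q) \<or> (AE x in \<mu>. x \<in> S q)" for q
  proof -
    have "emeasure \<mu> (S q) = 0 \<or> emeasure \<mu> (space \<mu> - S q) = 0"
      by (rule erg[unfolded flow_ergodic_def, THEN bspec, THEN mp, OF S_sets allI[OF S_inv]])
    then show ?thesis
    proof
      assume "emeasure \<mu> (S q) = 0"
      then have "S q \<in> null_sets \<mu>" using S_sets by (simp add: null_setsI)
      then show ?thesis using AE_not_in by blast
    next
      assume "emeasure \<mu> (space \<mu> - S q) = 0"
      then have "space \<mu> - S q \<in> null_sets \<mu>" using S_sets by (intro null_setsI) auto
      then have "AE x in \<mu>. x \<notin> space \<mu> - S q" by (rule AE_not_in)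
      then show ?thesis by (simp add: space_\<mu>)
    qed
  qed
  have S_mono: "S p \<subseteq> S q" if "p \<le> q" for p q using that unfolding S_def by force
  define Q where "Q = {q. AE x in \<mu>. x \<in> S q}"
  have notQ: "AE x in \<mu>. x \<notin> S q" if "q \<notin> Q" for q using dichotomy that by (auto simp: Q_def)
  have "\<exists>n::nat. real n \<in> Q"
  proof (rule ccontr)
    assume "\<nexists>n::nat. real n \<in> Q"
    then have "AE x in \<mu>. \<forall>n::nat. x \<notin> S (real n)" unfolding AE_all_countable using notQ by blast
    then have "AE x in \<mu>. False" using par
    proof eventually_elim
      case (elim x)
      then obtain a where a: "X x \<noteq> 0" "Y x = a *\<^sub>R X x" by blast
      obtain n :: nat where "a \<le> real n" using real_arch_simple by blast
      then have "x \<in> S (real n)" using a unfolding S_def by blast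
      then show ?case using elim by blast
    qed
    then show False by simp
  qed
  then have "Q \<noteq> {}" by blast
  have unique: "a = a'" if "X x \<noteq> 0" "a *\<^sub>R X x = a' *\<^sub>R X x" for a a' x
    using that by simp
  have "\<exists>n::nat. - real n \<notin> Q"
  proof (rule ccontr)
    assume "\<nexists>n::nat. - real n \<notin> Q"
    then have "AE x in \<mu>. \<forall>n::nat. x \<in> S (- real n)" unfolding AE_all_countable Q_def by blast
    then have "AE x in \<mu>. False" using par
    proof eventually_elim
      case (elim x)
      then obtain a where a: "X x \<noteq> 0" "Y x = a *\<^sub>R X x" by blast
      obtain n :: nat where n: "- a < real n" using reals_Archimedean2 by blast
      have "x \<in> S (- real n)" using elim by blast
      then obtain a' where "a' \<le> - real n" "Y x = a' *\<^sub>R X x" unfolding S_def by blast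
      then have "a \<le> - real n" using unique[OF a(1), of a a'] a(2) by simp
      then show ?case using n by linarith
    qed
    then show False by simp
  qed
  then obtain n :: nat where n: "- real n \<notin> Q" by blast
  have Q_up: "q \<in> Q" if "p \<in> Q" "p \<le> q" for p q
    using that S_mono[OF that(2)] unfolding Q_def by (auto elim: eventually_mono)
  have "bdd_below Q" using Q_up n by (intro bdd_belowI[of _ "- real n"]) (meson linear)
  define c where "c = Inf Q"
  have above: "c + 1 / Suc m \<in> Q" for m
  proof -
    have "c < c + 1 / Suc m" by simp
    then obtain q where "q \<in> Q" "q < c + 1 / Suc m"
      using cInf_less_iff[OF \<open>Q \<noteq> {}\<close> \<open>bdd_below Q\<close>] unfolding c_def by blast
    then show ?thesis using Q_up by auto
  qed
  have below: "c - 1 / Suc m \<notin> Q" for m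
  proof
    assume "c - 1 / Suc m \<in> Q"
    then have "c \<le> c - 1 / Suc m" unfolding c_def using \<open>bdd_below Q\<close> by (rule cInf_lower)
    moreover have "1 / real (Suc m) > 0" by simp
    ultimately show False by linarith
  qed
  have "AE x in \<mu>. \<forall>m::nat. x \<in> S (c + 1 / Suc m)"
    unfolding AE_all_countable using above by (simp add: Q_def)
  moreover have "AE x in \<mu>. \<forall>m::nat. x \<notin> S (c - 1 / Suc m)"
    unfolding AE_all_countable using notQ[OF below] by blast
  ultimately have "AE x in \<mu>. Y x = c *\<^sub>R X x" using par
  proof eventually_elim
    case (elim x)
    then obtain a where a: "X x \<noteq> 0" "Y x = a *\<^sub>R X x" by blast
    have ac: "\<bar>a - c\<bar> \<le> 1 / Suc m" for m :: nat
    proof -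
      obtain a' where "a' \<le> c + 1 / Suc m" "Y x = a' *\<^sub>R X x"
        using elim(1) unfolding S_def by blast
      then have "a \<le> c + 1 / Suc m" using unique[OF a(1), of a a'] a(2) by simp
      moreover have "\<not> a \<le> c - 1 / Suc m" using elim(2) a unfolding S_def by blast
      ultimately show ?thesis by (simp add: abs_le_iff)
    qed
    have "a = c"
    proof (rule ccontr)
      assume "a \<noteq> c"
      then have "\<bar>a - c\<bar> > 0" by simp
      then obtain m where "1 / real (Suc m) < \<bar>a - c\<bar>" by (rule nat_approx_posE)
      then show False using ac[of m] by linarith
    qed
    then show ?case using a(2) by simp
  qed
  then show ?thesis by blast
qed

section \<open>The support\<close>

text \<open>The two fields differ on an open set. It is null, so it does not meet the support.\<close>

lemma field_eq_on_support:
  assumes Y: "Y \<in> C1_centralizer A X" and ae: "AE x in \<mu>. Y x = c *\<^sub>R X x" and x: "x \<in> measure_support \<mu>"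
  shows "Y x = c *\<^sub>R X x"
proof (rule ccontr)
  assume ne: "Y x \<noteq> c *\<^sub>R X x"
  have YT: "Y x \<in> T x" for x using coord_fieldD(1)[OF centralizer_field[OF Y]] by simp
  have XT: "X x \<in> T x" for x using coord_fieldD(1)[OF X r] .
  define h where "h x = g x ((- c) *\<^sub>R X x + 1 *\<^sub>R Y x) ((- c) *\<^sub>R X x + 1 *\<^sub>R Y x)" for x
  have in_T: "(- c) *\<^sub>R X x + 1 *\<^sub>R Y x \<in> T x" for x
    by (intro subspace_add[OF subspace_T] subspace_scale[OF subspace_T] XT YT)
  have iff: "(- c) *\<^sub>R X x + 1 *\<^sub>R Y x = 0 \<longleftrightarrow> Y x = c *\<^sub>R X x" for x
    by (simp add: add_eq_0_iff2 add.commute eq_neg_iff_add_eq_0)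
  have h_pos: "h x > 0 \<longleftrightarrow> Y x \<noteq> c *\<^sub>R X x" for x
    using g_pos[OF in_T, of x] g_scale[OF subspace_0[OF subspace_T] subspace_0[OF subspace_T], of x 0] iff[of x]
    unfolding h_def by auto
  have "continuous_on UNIV h"
    unfolding h_def g_expand[OF XT YT]
    using continuous_g_fields X r centralizer_field[OF Y]
    by (intro continuous_on_add continuous_on_mult continuous_on_const) auto
  then have U: "open {x. h x > 0}" by (intro open_Collect_less continuous_on_const)
  then have "{x. h x > 0} \<in> sets \<mu>" unfolding sets_\<mu> by (rule borel_open)
  moreover have "AE x in \<mu>. x \<notin> {x. h x > 0}" using ae by (rule eventually_mono) (simp add: h_pos)
  ultimately have "emeasure \<mu> {x. h x > 0} = 0"
    using AE_iff_measurable[of "{x. h x > 0}" \<mu> "\<lambda>x. x \<notin> {x. h x > 0}"] by (simp add: space_\<mu>)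
  moreover have "emeasure \<mu> {x. h x > 0} > 0"
    using x U ne h_pos unfolding measure_support_def by blast
  ultimately show False by simp
qed

lemma flow_support_subset: "\<phi> t ` measure_support \<mu> \<subseteq> measure_support \<mu>"
proof
  fix y assume "y \<in> \<phi> t ` measure_support \<mu>"
  then obtain x where x: "x \<in> measure_support \<mu>" "y = \<phi> t x" by blast
  have "emeasure \<mu> U > 0" if U: "open U" "y \<in> U" for U
  proof -
    have "open (\<phi> t -` U)"
      using continuous_on_open_vimage[OF open_UNIV, THEN iffD1, OF flow_continuous] U(1) by simp
    then have "emeasure \<mu> (\<phi> t -` U) > 0"
      using x U(2) unfolding measure_support_def by blast
    also have "emeasure \<mu> (\<phi> t -` U) = emeasure (distr \<mu> \<mu> (\<phi> t)) U"
      using invariant U(1) by (subst emeasure_distr) (auto simp: flow_invariant_def sets_\<mu> space_\<mu>)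
    also have "distr \<mu> \<mu> (\<phi> t) = \<mu>" using invariant by (simp add: flow_invariant_def)
    finally show ?thesis .
  qed
  then show "y \<in> measure_support \<mu>" unfolding measure_support_def by blast
qed

lemma flow_support: "\<phi> t ` measure_support \<mu> = measure_support \<mu>"
proof
  show "measure_support \<mu> \<subseteq> \<phi> t ` measure_support \<mu>"
  proof
    fix x assume "x \<in> measure_support \<mu>"
    then have "\<phi> (- t) x \<in> measure_support \<mu>" using flow_support_subset by blast
    then show "x \<in> \<phi> t ` measure_support \<mu>" by (metis \<phi>_inverse(1) imageI)
  qed
qed (rule flow_support_subset)

text \<open>On the support, where \<open>Y = c X\<close>, the integral curves of \<open>Y\<close> are those of \<open>X\<close> run at speed \<open>c\<close>.\<close>

lemma commuting_flow_on_support: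
  assumes Y: "Y \<in> C1_centralizer A X" and eq: "\<And>x. x \<in> measure_support \<mu> \<Longrightarrow> Y x = c *\<^sub>R X x"
    and \<psi>: "generates_flow A Y \<psi>" and x: "x \<in> measure_support \<mu>"
  shows "\<psi> t x = \<phi> (c * t) x"
proof -
  have in_supp: "\<phi> s x \<in> measure_support \<mu>" for s using flow_support x by blast
  have curve: "integral_curve X (\<lambda>t. \<phi> t x)" by (rule integral_curve_flow[OF flow])
  have lin: "((\<lambda>t. c * t) has_vector_derivative c) (at t)" for t
    unfolding has_real_derivative_iff_has_vector_derivative[symmetric]
    by (auto intro!: derivative_eq_intros)
  have "integral_curve Y (\<lambda>t. \<phi> (c * t) x)"
    unfolding integral_curve_def
  proof (intro conjI allI ballI impI)
    have "continuous_on UNIV (\<lambda>t. \<phi> t x)" using curve unfolding integral_curve_def by blast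
    then show "continuous_on UNIV (\<lambda>t. \<phi> (c * t) x)"
      by (rule continuous_on_compose2[OF _ continuous_on_mult[OF continuous_on_const continuous_on_id]]) auto
    fix t d assume d: "d \<in> A" "\<phi> (c * t) x \<in> fst d"
    have "((\<lambda>s. snd d (\<phi> s x)) has_vector_derivative X (\<phi> (c * t) x) d) (at (c * t))"
      using curve d unfolding integral_curve_def by blast
    from vector_diff_chain_at[OF lin this]
    show "((\<lambda>s. snd d (\<phi> (c * s) x)) has_vector_derivative Y (\<phi> (c * t) x) d) (at t)"
      by (simp add: o_def eq[OF in_supp] scaleR_fun_apply)
  qed
  then show ?thesis
    using integral_curve_unique[OF centralizer_field[OF Y] order_refl integral_curve_flow[OF \<psi>, of x],
        of "\<lambda>t. \<phi> (c * t) x" t] \<psi>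
    by (simp add: generates_flow_def \<phi>_0)
qed

end

theorem corollary1:
  fixes A :: "('a::t2_space, 'e::euclidean_space) chart set"
    and g :: "'a \<Rightarrow> ('a, 'e) tangent \<Rightarrow> ('a, 'e) tangent \<Rightarrow> real"
    and X :: "'a \<Rightarrow> ('a, 'e) tangent"
    and \<phi> :: "real \<Rightarrow> 'a \<Rightarrow> 'a"
    and \<mu> :: "'a measure"
    and r :: nat
  assumes "smooth_atlas A"
    and "compact (UNIV :: 'a set)"
    and "connected (UNIV :: 'a set)"
    and "riemannian_metric A g"
    and "r \<ge> 2"
    and "X \<in> vector_fields A r"
    and "generates_flow A X \<phi>"
    and "prob_space \<mu>"
    and "sets \<mu> = sets borel"
    and "non_atomic \<mu>"
    and "flow_invariant \<phi> \<mu>"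
    and "flow_ergodic \<phi> \<mu>"
    and "hyperbolic_measure A g X \<phi> \<mu>"
  shows "\<forall>Y\<in>C1_centralizer A X.
           (\<forall>\<psi>. generates_flow A Y \<psi> \<longrightarrow>
              (\<forall>t. \<psi> t ` measure_support \<mu> = measure_support \<mu>)) \<and>
           (\<exists>c::real. \<forall>x\<in>measure_support \<mu>. Y x = c *\<^sub>R X x)"
proof -
  interpret manifold A by unfold_locales (rule assms(1))
  interpret riemannian_manifold A g by unfold_locales (rule assms(4))
  interpret compact_flow A g X \<phi> r
    by unfold_locales (use assms(2,5,6,7) in simp_all)
  interpret prob_space \<mu> by (rule assms(8))
  interpret measured_flow A g X \<phi> r \<mu>
    by unfold_locales (rule assms(9), rule assms(11))
  obtain k E lam where os: "oseledets_splitting A g X \<phi> \<mu> (\<lambda>_. k) E (\<lambda>_. lam)"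
      and hyp: "\<forall>i\<in>{1..k}. lam i \<noteq> 0"
    using assms(13) unfolding hyperbolic_measure_def by blast
  show ?thesis
  proof (rule ballI)
    fix Y assume Y: "Y \<in> C1_centralizer A X"
    obtain c where "AE x in \<mu>. Y x = c *\<^sub>R X x"
      using ergodic_factor_constant[OF assms(12) Y AE_commuting_field_parallel[OF os hyp Y]] by blast
    then have c: "Y x = c *\<^sub>R X x" if "x \<in> measure_support \<mu>" for x
      using field_eq_on_support[OF Y _ that] by blast
    have "\<psi> t ` measure_support \<mu> = measure_support \<mu>" if "generates_flow A Y \<psi>" for \<psi> t
    proof -
      have "\<psi> t ` measure_support \<mu> = \<phi> (c * t) ` measure_support \<mu>"
        by (intro image_cong refl commuting_flow_on_support[OF Y c that])
      then show ?thesis by (simp only: flow_support)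
    qed
    with c show "(\<forall>\<psi>. generates_flow A Y \<psi> \<longrightarrow>
        (\<forall>t. \<psi> t ` measure_support \<mu> = measure_support \<mu>)) \<and>
        (\<exists>c::real. \<forall>x\<in>measure_support \<mu>. Y x = c *\<^sub>R X x)"
      by metis
  qed
qed

end
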